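(* Let $\varphi:\mathbb{R}^n\to(-\infty,\infty]$ have the form $\varphi=f+g$, where $f:\mathbb{R}^n\to\mathbb{R}$ is twice continuously differentiable and $g:\mathbb{R}^n\to(-\infty,\infty]$ is a proper lower semicontinuous prox-bounded function. Assume that $\operatorname{proxreg}\varphi$ is dense in $\operatorname{gph}\partial\varphi$, and let $\bar x\in\mathbb{R}^n$ satisfy $0\in\partial\varphi(\bar x)$. Furthermore, let $\partial g$ be SCD semismooth$^*$ at $(\bar x,-\nabla f(\bar x))$, and assume that the regularity condition $\mathcal{S}\partial\varphi(\bar x,0)\subset\mathcal{Z}_n^{\rm reg}$ holds. Then, for every $\eta>0$, there is a neighborhood $U$ of $\bar x$ such that for every starting point $x^{(0)}\in U$ the SCD semismooth$^*$ Newton method for $0\in\partial(f+g)(x)$ (the algorithm given in the context, with this $\eta$) is well defined, and the iterates $x^{(k)}$ converge superlinearly to $\bar x$.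
   Context: Subdifferentials. For $q:\mathbb{R}^n\to(-\infty,\infty]$ and $\bar x$ with $q(\bar x)<\infty$, the regular subdifferential is $\widehat\partial q(\bar x)=\{x^*:\liminf_{x\to\bar x}\frac{q(x)-q(\bar x)-\langle x^*,x-\bar x\rangle}{\|x-\bar x\|}\ge0\}$, and the (limiting) subdifferential $\partial q(\bar x)$ is the set of all $x^*$ for which there are $(x_k,x_k^* )\to(\bar x,x^* )$ with $x_k^*\in\widehat\partial q(x_k)$ for all $k$ and $q(x_k)\to q(\bar x)$. If $q(\bar x)=\infty$, then $\partial q(\bar x)=\emptyset$. The graph of a set-valued mapping $G:\mathbb{R}^n\rightrightarrows\mathbb{R}^n$ is $\operatorname{gph}G=\{(x,y):y\in G(x)\}$. $q$ is prox-bounded if there are $\lambda>0$ and $x\in\mathbb{R}^n$ with $\inf_z\{\frac1{2\lambda}\|z-x\|^2+q(z)\}>-\infty$. Prox-regularity. $q$ is prox-regular at $\bar x$ for $\bar x^*\in\partial q(\bar x)$ if there are $\epsilon>0$, $\rho\ge0$ such that for all $x',x$ in the ball $\mathcal{B}_\epsilon(\bar x)$ with $|q(x)-q(\bar x)|\le\epsilon$ one has $q(x')\ge q(x)+\langle x^*,x'-x\rangle-\frac\rho2\|x'-x\|^2$ whenever $x^*\in\partial q(x)\cap\mathcal{B}_\epsilon(\bar x^* )$. $q$ is subdifferentially continuous at $\bar x$ for $\bar x^*$ if $q(x_k)\to q(\bar x)$ for every sequence $(x_k,x_k^* )\in\operatorname{gph}\partial q$ converging to $(\bar x,\bar x^*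 )$. $\operatorname{proxreg}\varphi$ is the set of all $(x,x^* )\in\operatorname{gph}\partial\varphi$ such that $\varphi$ is prox-regular and subdifferentially continuous at $x$ for $x^*$. Subspaces and SC derivative. $\mathcal{Z}_n$ is the metric space of $n$-dimensional subspaces of $\mathbb{R}^n\times\mathbb{R}^n$ with $d(L_1,L_2)=\|P_1-P_2\|$, $P_i$ being the orthogonal projection onto $L_i$. For $n\times n$ matrices $X,Y$, $\operatorname{rge}(X,Y):=\{(Xp,Yp):p\in\mathbb{R}^n\}$. The tangent cone to $\Omega$ at $\bar x\in\Omega$ is $T_\Omega(\bar x)=\{u:\exists\,t_k\downarrow0,\ u_k\to u,\ \bar x+t_ku_k\in\Omega\ \forall k\}$. For $G:\mathbb{R}^n\rightrightarrows\mathbb{R}^n$, $\mathcal{O}_G$ is the set of $(x,y)\in\operatorname{gph}G$ for which $T_{\operatorname{gph}G}(x,y)$ is an $n$-dimensional subspace. The subspace containing (SC) derivative $\mathcal{S}G(x,y)$ at $(x,y)\in\operatorname{gph}G$ is the set of all $L\in\mathcal{Z}_n$ for which there is a sequence $(x_k,y_k)\in\mathcal{O}_G$ converging to $(x,y)$ with $d(L,T_{\operatorname{gph}G}(x_k,y_k))\to0$. $G$ has the SCD property at $(x,y)\in\operatorname{gph}G$ if $\mathcal{S}G(x,y)\ne\emptyset$, and around $(x,y)$ if it has the SCD property at every point of $\operatorname{gph}G\cap V$ for some neighborhood $V$ of $(x,y)$. $G$ is SCD semismooth$^*$ at $(\bar x,\bar y)\in\operatorname{gph}G$ if $G$ has the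 SCD property around $(\bar x,\bar y)$ and for all $\epsilon>0$ there is $\delta>0$ such that for all $(x,y)\in\operatorname{gph}G\cap\mathcal{B}_\delta(\bar x,\bar y)$ and all $L\in\mathcal{S}G(x,y)$ one has $\operatorname{dist}((x-\bar x,y-\bar y),L)\le\epsilon\|(x-\bar x,y-\bar y)\|$. $\mathcal{Z}_n^{\rm reg}$ is the collection of all $L\in\mathcal{Z}_n$ such that $(y^*,0)\in L$ implies $y^*=0$. $\mathcal{Z}_n^{P,W}$ is the collection of all $L\in\mathcal{Z}_n$ for which there are symmetric $n\times n$ matrices $P,W$ with $L=\operatorname{rge}(P,W)$, $P^2=P$ and $W(I-P)=I-P$. Set $\mathcal{S}_{P,W}\partial g(x,x^* ):=\mathcal{S}\partial g(x,x^* )\cap\mathcal{Z}_n^{P,W}$; writing $\operatorname{rge}(P,W)\in\mathcal{S}_{P,W}\partial g(x,x^* )$ means that $P,W$ are matrices with these properties. Algorithm (SCD semismooth$^*$ Newton method for $0\in\partial\varphi(x)$ with $\varphi=f+g$). Given $x^{(0)}\in\mathbb{R}^n$ and $\eta>0$, repeat for $k=0,1,2,\dots$: 1. Approximation step: compute (choose any) $(\hat x^{(k)},\hat y^{(k)})\in\operatorname{gph}\partial\varphi$ satisfying $\|(\hat x^{(k)}-\bar x,\hat y^{(k)}-0)\|\le\eta\|x^{(k)}-\bar x\|$. 2. Newton step: select $n\times n$ matrices $P^{(k)},W^{(k)}$ with $\operatorname{rge}(P^{(k)},W^{(k)})\in\mathcal{S}_{P,W}\partial g(\hat x^{(k)},\hat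 y^{(k)}-\nabla f(\hat x^{(k)}))$, compute a stationary point $\bar s^{(k)}$ of the quadratic program $\min_s\frac12s^T\big(P^{(k)}\nabla^2f(\hat x^{(k)})P^{(k)}+W^{(k)}\big)s+\langle\hat y^{(k)},s\rangle$ subject to $s\in\operatorname{rge}P^{(k)}$ (i.e. $0$ lies in the limiting subdifferential at $\bar s^{(k)}$ of the objective plus the indicator function of $\operatorname{rge}P^{(k)}$), and set $x^{(k+1)}:=\hat x^{(k)}+\bar s^{(k)}$. Well defined means that all these steps can be carried out at every iteration. Superlinear convergence means $x^{(k)}\to\bar x$ and $\|x^{(k+1)}-\bar x\|=o(\|x^{(k)}-\bar x\|)$. *)

theory Defs
  imports "HOL-Analysis.Analysis" "HOL-Library.Landau_Symbols"
begin

section \<open>Extended-real-valued functions\<close>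

definition proper :: "('a \<Rightarrow> ereal) \<Rightarrow> bool" where
  "proper q \<longleftrightarrow> (\<forall>x. q x \<noteq> -\<infinity>) \<and> (\<exists>x. q x \<noteq> \<infinity>)"

definition lsc :: "('a::topological_space \<Rightarrow> ereal) \<Rightarrow> bool" where
  "lsc q \<longleftrightarrow> (\<forall>x. q x \<le> Liminf (at x) q)"

definition prox_bounded :: "('a::real_normed_vector \<Rightarrow> ereal) \<Rightarrow> bool" where
  "prox_bounded q \<longleftrightarrow>
     (\<exists>l>0. \<exists>x. (INF z. ereal (1 / (2 * l) * (norm (z - x))\<^sup>2) + q z) > -\<infinity>)"

definition indicator_fun :: "'a set \<Rightarrow> 'a \<Rightarrow> ereal" where
  "indicator_fun S x = (if x \<in> S then 0 else \<infinity>)"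

section \<open>Subdifferentials and prox-regularity\<close>

text \<open>All functions considered never take the value \<open>-\<infinity>\<close>, so the finiteness condition below
  just says \<open>q x < \<infinity>\<close>; both subdifferentials are empty where \<open>q\<close> is infinite.\<close>

definition regular_subdiff :: "('a::real_inner \<Rightarrow> ereal) \<Rightarrow> 'a \<Rightarrow> 'a set" where
  "regular_subdiff q xb = {v. \<bar>q xb\<bar> \<noteq> \<infinity> \<and>
     0 \<le> Liminf (at xb) (\<lambda>x. (q x - q xb - ereal (v \<bullet> (x - xb))) / ereal (norm (x - xb)))}"

definition subdiff :: "('a::real_inner \<Rightarrow> ereal) \<Rightarrow> 'a \<Rightarrow> 'a set" where
  "subdiff q xb = {v. \<bar>q xb\<bar> \<noteq> \<infinity> \<and>
     (\<exists>X V. X \<longlonglongrightarrow> xb \<and> V \<longlonglongrightarrow> v \<and> (\<forall>k. V k \<in> regular_subdiff q (X k)) \<and>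
            (\<lambda>k. q (X k)) \<longlonglongrightarrow> q xb)}"

definition gph :: "('a \<Rightarrow> 'b set) \<Rightarrow> ('a \<times> 'b) set" where
  "gph G = {(x, y). y \<in> G x}"

definition prox_regular_at :: "('a::real_inner \<Rightarrow> ereal) \<Rightarrow> 'a \<Rightarrow> 'a \<Rightarrow> bool" where
  "prox_regular_at q xb vb \<longleftrightarrow> vb \<in> subdiff q xb \<and>
     (\<exists>\<epsilon>>0. \<exists>\<rho>\<ge>0. \<forall>x'\<in>cball xb \<epsilon>. \<forall>x\<in>cball xb \<epsilon>. \<bar>q x - q xb\<bar> \<le> ereal \<epsilon> \<longrightarrow>
        (\<forall>v \<in> subdiff q x \<inter> cball vb \<epsilon>.
           q x' \<ge> q x + ereal (v \<bullet> (x' - x) - \<rho> / 2 * (norm (x' - x))\<^sup>2)))"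

definition subdiff_continuous_at :: "('a::real_inner \<Rightarrow> ereal) \<Rightarrow> 'a \<Rightarrow> 'a \<Rightarrow> bool" where
  "subdiff_continuous_at q xb vb \<longleftrightarrow>
     (\<forall>X V. (\<forall>k. (X k, V k) \<in> gph (subdiff q)) \<and> X \<longlonglongrightarrow> xb \<and> V \<longlonglongrightarrow> vb \<longrightarrow>
        (\<lambda>k. q (X k)) \<longlonglongrightarrow> q xb)"

definition proxreg :: "('a::real_inner \<Rightarrow> ereal) \<Rightarrow> ('a \<times> 'a) set" where
  "proxreg q = {(x, v) \<in> gph (subdiff q). prox_regular_at q x v \<and> subdiff_continuous_at q x v}"

section \<open>Gradient, Hessian and twice continuous differentiability\<close>

definition grad :: "(real^'n \<Rightarrow> real) \<Rightarrow> real^'n \<Rightarrow> real^'n" where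
  "grad f x = (THE D. GDERIV f x :> D)"

definition hessian :: "(real^'n \<Rightarrow> real) \<Rightarrow> real^'n \<Rightarrow> real^'n^'n" where
  "hessian f x = jacobian (grad f) (at x)"

definition twice_continuously_differentiable :: "(real^'n \<Rightarrow> real) \<Rightarrow> bool" where
  "twice_continuously_differentiable f \<longleftrightarrow>
     (\<forall>x. f differentiable (at x)) \<and> (\<forall>x. grad f differentiable (at x)) \<and>
     continuous_on UNIV (hessian f)"

section \<open>Subspaces and the SC derivative\<close>

definition Zn :: "((real^'n) \<times> (real^'n)) set set" where
  "Zn = {L. subspace L \<and> dim L = CARD('n)}"

definition orth_proj :: "'a::euclidean_space set \<Rightarrow> 'a \<Rightarrow> 'a" where
  "orth_proj L z = (THE p. p \<in> L \<and> (\<forall>w\<in>L. orthogonal (z - p) w))"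

definition subspace_dist :: "'a::euclidean_space set \<Rightarrow> 'a set \<Rightarrow> real" where
  "subspace_dist L1 L2 = onorm (\<lambda>z. orth_proj L1 z - orth_proj L2 z)"

definition rge :: "real^'n^'n \<Rightarrow> real^'n^'n \<Rightarrow> ((real^'n) \<times> (real^'n)) set" where
  "rge X Y = range (\<lambda>p. (X *v p, Y *v p))"

definition tangent_cone :: "'a::real_normed_vector set \<Rightarrow> 'a \<Rightarrow> 'a set" where
  "tangent_cone \<Omega> xb = {u. \<exists>t U. (\<forall>k. 0 < t k) \<and> t \<longlonglongrightarrow> 0 \<and> U \<longlonglongrightarrow> u \<and>
     (\<forall>k::nat. xb + t k *\<^sub>R U k \<in> \<Omega>)}"

definition SC_points :: "(real^'n \<Rightarrow> (real^'n) set) \<Rightarrow> ((real^'n) \<times> (real^'n)) set" where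
  "SC_points G = {z \<in> gph G. tangent_cone (gph G) z \<in> Zn}"

definition SC_deriv ::
  "(real^'n \<Rightarrow> (real^'n) set) \<Rightarrow> (real^'n) \<times> (real^'n) \<Rightarrow> ((real^'n) \<times> (real^'n)) set set" where
  "SC_deriv G z = {L \<in> Zn. \<exists>Z. (\<forall>k. Z k \<in> SC_points G) \<and> Z \<longlonglongrightarrow> z \<and>
     (\<lambda>k. subspace_dist L (tangent_cone (gph G) (Z k))) \<longlonglongrightarrow> 0}"

definition SCD_at :: "(real^'n \<Rightarrow> (real^'n) set) \<Rightarrow> (real^'n) \<times> (real^'n) \<Rightarrow> bool" where
  "SCD_at G z \<longleftrightarrow> SC_deriv G z \<noteq> {}"

definition SCD_around :: "(real^'n \<Rightarrow> (real^'n) set) \<Rightarrow> (real^'n) \<times> (real^'n) \<Rightarrow> bool" where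
  "SCD_around G z \<longleftrightarrow> (\<exists>V. open V \<and> z \<in> V \<and> (\<forall>w \<in> gph G \<inter> V. SCD_at G w))"

definition SCD_semismooth :: "(real^'n \<Rightarrow> (real^'n) set) \<Rightarrow> (real^'n) \<times> (real^'n) \<Rightarrow> bool" where
  "SCD_semismooth G zb \<longleftrightarrow> zb \<in> gph G \<and> SCD_around G zb \<and>
     (\<forall>\<epsilon>>0. \<exists>\<delta>>0. \<forall>z \<in> gph G \<inter> cball zb \<delta>. \<forall>L \<in> SC_deriv G z.
        infdist (z - zb) L \<le> \<epsilon> * norm (z - zb))"

definition Zn_reg :: "((real^'n) \<times> (real^'n)) set set" where
  "Zn_reg = {L \<in> Zn. \<forall>y. (y, 0) \<in> L \<longrightarrow> y = 0}"

definition PW_pair :: "real^'n^'n \<Rightarrow> real^'n^'n \<Rightarrow> bool" where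
  "PW_pair P W \<longleftrightarrow> transpose P = P \<and> transpose W = W \<and> P ** P = P \<and>
     W ** (mat 1 - P) = mat 1 - P"

definition Zn_PW :: "((real^'n) \<times> (real^'n)) set set" where
  "Zn_PW = {L \<in> Zn. \<exists>P W. PW_pair P W \<and> L = rge P W}"

definition SC_deriv_PW ::
  "(real^'n \<Rightarrow> (real^'n) set) \<Rightarrow> (real^'n) \<times> (real^'n) \<Rightarrow> ((real^'n) \<times> (real^'n)) set set" where
  "SC_deriv_PW G z = SC_deriv G z \<inter> Zn_PW"

section \<open>The SCD semismooth* Newton method\<close>

text \<open>The method is nondeterministic: each iteration involves free choices of
  \<open>(xh, yh)\<close>, of \<open>(P, W)\<close> and of the stationary point \<open>s\<close>.\<close>

definition newton_objective ::
  "(real^'n \<Rightarrow> real) \<Rightarrow> real^'n \<Rightarrow> real^'n \<Rightarrow> real^'n^'n \<Rightarrow> real^'n^'n \<Rightarrow> real^'n \<Rightarrow> real" where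
  "newton_objective f xh yh P W s =
     1 / 2 * (s \<bullet> ((P ** hessian f xh ** P + W) *v s)) + yh \<bullet> s"

definition approx_choice ::
  "(real^'n \<Rightarrow> real) \<Rightarrow> (real^'n \<Rightarrow> ereal) \<Rightarrow> real^'n \<Rightarrow> real \<Rightarrow> real^'n \<Rightarrow> real^'n \<Rightarrow> real^'n \<Rightarrow> bool"
where
  "approx_choice f g xb \<eta> x xh yh \<longleftrightarrow>
     (xh, yh) \<in> gph (subdiff (\<lambda>x. ereal (f x) + g x)) \<and>
     norm (xh - xb, yh - 0) \<le> \<eta> * norm (x - xb)"

definition matrix_choice ::
  "(real^'n \<Rightarrow> real) \<Rightarrow> (real^'n \<Rightarrow> ereal) \<Rightarrow> real^'n \<Rightarrow> real^'n \<Rightarrow> real^'n^'n \<Rightarrow> real^'n^'n \<Rightarrow> bool"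
where
  "matrix_choice f g xh yh P W \<longleftrightarrow>
     PW_pair P W \<and> rge P W \<in> SC_deriv_PW (subdiff g) (xh, yh - grad f xh)"

definition direction_choice ::
  "(real^'n \<Rightarrow> real) \<Rightarrow> real^'n \<Rightarrow> real^'n \<Rightarrow> real^'n^'n \<Rightarrow> real^'n^'n \<Rightarrow> real^'n \<Rightarrow> bool" where
  "direction_choice f xh yh P W s \<longleftrightarrow>
     0 \<in> subdiff (\<lambda>u. ereal (newton_objective f xh yh P W u) + indicator_fun (range ((*v) P)) u) s"

definition newton_step ::
  "(real^'n \<Rightarrow> real) \<Rightarrow> (real^'n \<Rightarrow> ereal) \<Rightarrow> real^'n \<Rightarrow> real \<Rightarrow> real^'n \<Rightarrow> real^'n \<Rightarrow> bool" where
  "newton_step f g xb \<eta> x x' \<longleftrightarrow>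
     (\<exists>xh yh P W s. approx_choice f g xb \<eta> x xh yh \<and> matrix_choice f g xh yh P W \<and>
        direction_choice f xh yh P W s \<and> x' = xh + s)"

text \<open>No sequence of choices, starting from \<open>x0\<close>, ever gets stuck at any of the steps.\<close>

definition newton_well_defined ::
  "(real^'n \<Rightarrow> real) \<Rightarrow> (real^'n \<Rightarrow> ereal) \<Rightarrow> real^'n \<Rightarrow> real \<Rightarrow> real^'n \<Rightarrow> bool" where
  "newton_well_defined f g xb \<eta> x0 \<longleftrightarrow>
     (\<forall>x. (newton_step f g xb \<eta>)\<^sup>*\<^sup>* x0 x \<longrightarrow>
        (\<exists>xh yh. approx_choice f g xb \<eta> x xh yh) \<and>
        (\<forall>xh yh. approx_choice f g xb \<eta> x xh yh \<longrightarrow>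
           (\<exists>P W. matrix_choice f g xh yh P W) \<and>
           (\<forall>P W. matrix_choice f g xh yh P W \<longrightarrow> (\<exists>s. direction_choice f xh yh P W s))))"

definition newton_iterates ::
  "(real^'n \<Rightarrow> real) \<Rightarrow> (real^'n \<Rightarrow> ereal) \<Rightarrow> real^'n \<Rightarrow> real \<Rightarrow> real^'n \<Rightarrow> (nat \<Rightarrow> real^'n) \<Rightarrow> bool"
where
  "newton_iterates f g xb \<eta> x0 X \<longleftrightarrow> X 0 = x0 \<and> (\<forall>k. newton_step f g xb \<eta> (X k) (X (Suc k)))"

definition superlinearly_converges :: "(nat \<Rightarrow> 'a::real_normed_vector) \<Rightarrow> 'a \<Rightarrow> bool" where
  "superlinearly_converges X xb \<longleftrightarrow>
     X \<longlonglongrightarrow> xb \<and> (\<lambda>k. norm (X (Suc k) - xb)) \<in> o(\<lambda>k. norm (X k - xb))"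

end

theory Submission
  imports Defs
begin

text \<open>Write \<open>zb = (xb, - grad f xb)\<close>. Since \<open>f\<close> is smooth, the map
\<open>(x, v) \<mapsto> (x, v + grad f x)\<close> carries the graph of \<open>subdiff g\<close> onto the graph of
\<open>subdiff \<phi>\<close>, and its derivative, the shear \<open>(u, w) \<mapsto> (u, w + H u)\<close> with \<open>H\<close> the Hessian of
\<open>f\<close>, carries tangent cones to tangent cones and SC derivatives into SC derivatives
(\<open>tangent_cone_lift\<close>, \<open>SC_deriv_lift\<close>).

The Newton direction has a coordinate-free description: for \<open>L = rge P W\<close>, a vector \<open>s\<close> is stationary
for the quadratic program exactly when \<open>(s, - yh)\<close> lies in the sheared subspace
\<open>L' = {(u, w + H u) | (u, w) \<in> L}\<close> (\<open>direction_choice_iff\<close>). Hence everything is governed by the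
bound \<open>norm u \<le> \<kappa> * norm w'\<close> for \<open>(u, w') \<in> L'\<close>. Such a bound holds with one \<open>\<kappa>\<close> for all
graph points near \<open>zb\<close>: otherwise compactness of the space of n-dimensional subspaces
(\<open>Zn_sequentially_compact\<close>) and closedness of the SC derivative (\<open>SC_deriv_closed\<close>) would yield
an element of the SC derivative of \<open>subdiff \<phi>\<close> at \<open>(xb, 0)\<close> that violates the
regularity condition (\<open>uniform_regularity\<close>). The bound makes the direction unique and
existent, because on \<open>L'\<close> the first component is then a linear function of the second one, which by
dimension takes every value. Semismoothness gives
\<open>(u, w) \<in> L\<close> that agrees with \<open>(xh, yh - grad f xh) - zb\<close> up to a small relative error; after shearing
and adding \<open>(s, - yh)\<close>, the first component is \<open>u + s\<close>, which is close to the new error \<open>xh + s - xb\<close>,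
and the second one is small because the gradient is differentiable with continuous Hessian. The bound
with \<open>\<kappa>\<close> then yields the superlinear rate (\<open>newton_step_estimate\<close>).

It remains to see that a pair \<open>(P, W)\<close> always exists (\<open>SC_deriv_PW_nonempty\<close>). The subspaces of
the form \<open>rge P W\<close> include all n-dimensional subspaces that are isotropic for the standard symplectic
form (\<open>isotropic_imp_Zn_PW\<close>), and isotropy survives limits, so by compactness it is enough to find,
arbitrarily near a given graph point, points whose tangent cone is n-dimensional and isotropic.
Prox-regular points of \<open>\<phi>\<close> are dense, near each of them the prox-regularity inequality
persists, and since \<open>subdiff g\<close> has the SCD property there are points close by at which the tangent cone is
an n-dimensional subspace \<open>T\<close>. That \<open>T\<close> is isotropic rests on two facts. First, near such a
point the graph is a full Lipschitz manifold (\<open>subdiff_local_surjectivity\<close>), so that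
every element of \<open>T\<close> is a limit of difference quotients along any prescribed sequence of step sizes
(\<open>tangent_cone_derivable\<close>). Second, summing the prox-regularity inequality around a closed
polygon of graph points eliminates the function values and gives, in the limit, a cyclic
inequality on \<open>T\<close> (\<open>tangent_cone_cyclic\<close>); for polygons inscribed in an ellipse the
sum measures the symplectic area, which is thereby seen to vanish (\<open>tangent_cone_symplectic_le\<close>).\<close>

section \<open>The metric space of n-dimensional subspaces\<close>

lemma
  fixes L :: "'a::euclidean_space set"
  assumes L: "subspace L"
  shows orth_proj_in: "orth_proj L z \<in> L"
    and orth_proj_orthogonal: "w \<in> L \<Longrightarrow> (z - orth_proj L z) \<bullet> w = 0"
    and orth_proj_eqI: "\<lbrakk>p \<in> L; \<And>w. w \<in> L \<Longrightarrow> (z - p) \<bullet> w = 0\<rbrakk> \<Longrightarrow> orth_proj L z = p"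
proof -
  obtain p q where p: "p \<in> span L" and q: "\<And>w. w \<in> span L \<Longrightarrow> orthogonal q w" and z: "z = p + q"
    using orthogonal_subspace_decomp_exists[of L z] by metis
  have sp: "span L = L" using L by (simp add: span_eq_iff)
  have p1: "p \<in> L \<and> (\<forall>w\<in>L. orthogonal (z - p) w)" using p q z sp by simp
  have uniq: "p1 = p2"
    if "p1 \<in> L" "\<And>w. w \<in> L \<Longrightarrow> (z - p1) \<bullet> w = 0" "p2 \<in> L" "\<And>w. w \<in> L \<Longrightarrow> (z - p2) \<bullet> w = 0"
    for p1 p2
  proof -
    have d: "p1 - p2 \<in> L" using that L by (simp add: subspace_diff)
    have "(p1 - p2) \<bullet> (p1 - p2) = (z - p2) \<bullet> (p1 - p2) - (z - p1) \<bullet> (p1 - p2)"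
      by (simp add: inner_diff_left)
    also have "\<dots> = 0" using that(2,4)[OF d] by simp
    finally show ?thesis by simp
  qed
  have the: "orth_proj L z \<in> L \<and> (\<forall>w\<in>L. orthogonal (z - orth_proj L z) w)"
    unfolding orth_proj_def
    by (rule theI[of _ p], rule p1) (use uniq p1 in \<open>auto simp: orthogonal_def\<close>)
  show "orth_proj L z \<in> L" using the by blast
  show "w \<in> L \<Longrightarrow> (z - orth_proj L z) \<bullet> w = 0" using the by (auto simp: orthogonal_def)
  show "\<lbrakk>p \<in> L; \<And>w. w \<in> L \<Longrightarrow> (z - p) \<bullet> w = 0\<rbrakk> \<Longrightarrow> orth_proj L z = p" for p
    using uniq the by (auto simp: orthogonal_def)
qed

lemma orth_proj_id: "subspace L \<Longrightarrow> z \<in> L \<Longrightarrow> orth_proj L z = (z::'a::euclidean_space)"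
  by (rule orth_proj_eqI) auto

lemma linear_orth_proj:
  fixes L :: "'a::euclidean_space set"
  assumes L: "subspace L"
  shows "linear (orth_proj L)"
proof (rule linearI)
  fix x y :: 'a and c :: real
  show "orth_proj L (x + y) = orth_proj L x + orth_proj L y"
  proof (rule orth_proj_eqI[OF L])
    show "orth_proj L x + orth_proj L y \<in> L" by (intro subspace_add L orth_proj_in)
    show "(x + y - (orth_proj L x + orth_proj L y)) \<bullet> w = 0" if "w \<in> L" for w
      using orth_proj_orthogonal[OF L that, of x] orth_proj_orthogonal[OF L that, of y]
      by (simp add: inner_add_left inner_diff_left)
  qed
  show "orth_proj L (c *\<^sub>R x) = c *\<^sub>R orth_proj L x"
  proof (rule orth_proj_eqI[OF L])
    show "c *\<^sub>R orth_proj L x \<in> L" by (intro subspace_scale L orth_proj_in)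
    show "(c *\<^sub>R x - c *\<^sub>R orth_proj L x) \<bullet> w = 0" if "w \<in> L" for w
      using orth_proj_orthogonal[OF L that, of x] by (simp add: inner_diff_left)
  qed
qed

lemma orth_proj_self_adjoint:
  fixes L :: "'a::euclidean_space set"
  assumes L: "subspace L"
  shows "orth_proj L x \<bullet> y = x \<bullet> orth_proj L y"
proof -
  have "(x - orth_proj L x) \<bullet> orth_proj L y = 0" "(y - orth_proj L y) \<bullet> orth_proj L x = 0"
    using orth_proj_orthogonal[OF L] orth_proj_in[OF L] by blast+
  then show ?thesis by (simp add: inner_diff_left inner_diff_right inner_commute)
qed

lemma norm_orth_proj_diff_le:
  fixes L :: "'a::euclidean_space set"
  assumes L: "subspace L" and w: "w \<in> L"
  shows "norm (z - orth_proj L z) \<le> norm (z - w)"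
proof -
  let ?p = "orth_proj L z"
  have "?p - w \<in> L" using L w orth_proj_in[OF L] by (simp add: subspace_diff)
  then have "(z - ?p) \<bullet> (?p - w) = 0" by (rule orth_proj_orthogonal[OF L])
  then have "(norm ((z - ?p) + (?p - w)))\<^sup>2 = (norm (z - ?p))\<^sup>2 + (norm (?p - w))\<^sup>2"
    by (intro norm_add_Pythagorean) (simp add: orthogonal_def)
  then have "(norm (z - ?p))\<^sup>2 \<le> (norm (z - w))\<^sup>2" by simp
  then show ?thesis by (rule power2_le_imp_le) simp
qed

lemma infdist_eq_norm_orth_proj:
  fixes L :: "'a::euclidean_space set"
  assumes L: "subspace L"
  shows "infdist z L = norm (z - orth_proj L z)"
proof (rule antisym)
  show "infdist z L \<le> norm (z - orth_proj L z)"
    using infdist_le[OF orth_proj_in[OF L], of z] by (simp add: dist_norm)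
  have ne: "L \<noteq> {}" using L subspace_0 by blast
  show "norm (z - orth_proj L z) \<le> infdist z L"
    unfolding infdist_notempty[OF ne]
    by (rule cINF_greatest[OF ne]) (simp add: dist_norm norm_orth_proj_diff_le[OF L])
qed

lemma subspace_dist_bound:
  fixes L :: "'a::euclidean_space set"
  assumes "subspace L" "subspace M"
  shows "norm (orth_proj L z - orth_proj M z) \<le> subspace_dist L M * norm z"
  unfolding subspace_dist_def
  by (rule onorm) (intro bounded_linear_sub linear_conv_bounded_linear[THEN iffD1] linear_orth_proj assms)

lemma subspace_dist_nonneg:
  fixes L :: "'a::euclidean_space set"
  assumes "subspace L" "subspace M"
  shows "0 \<le> subspace_dist L M"
  unfolding subspace_dist_def
  by (rule onorm_pos_le) (intro bounded_linear_sub linear_conv_bounded_linear[THEN iffD1] linear_orth_proj assms)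

text \<open>The vectors are indexed by a type, so that frames form a bounded subset of the Euclidean space
\<open>'a^'n\<close> and the Bolzano-Weierstrass theorem applies to them.\<close>

definition orthonormal_frame :: "('a::euclidean_space)^'n \<Rightarrow> bool" where
  "orthonormal_frame b \<longleftrightarrow> (\<forall>i j. b $ i \<bullet> b $ j = (if i = j then 1 else 0))"

lemma orthonormal_frame_exists:
  fixes L :: "'a::euclidean_space set"
  assumes "subspace L" "dim L = CARD('n::finite)"
  shows "\<exists>b :: 'a^'n. orthonormal_frame b \<and> span (range (($) b)) = L"
proof -
  obtain B where B: "pairwise orthogonal B" "\<And>x. x \<in> B \<Longrightarrow> norm x = 1"
      "independent B" "card B = dim L" "span B = L"
    using orthonormal_basis_subspace[OF assms(1)] by metis
  have "finite B" using B(3) finiteI_independent by blast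
  then obtain h where h: "bij_betw h (UNIV::'n set) B"
    using finite_same_card_bij[of "UNIV::'n set" B] B(4) assms(2) by auto
  have "orthonormal_frame (\<chi> i. h i)"
    unfolding orthonormal_frame_def
  proof (intro allI)
    fix i j
    have ij: "h i \<in> B" "h j \<in> B" using h by (auto simp: bij_betw_def)
    have "h i \<bullet> h i = 1" using B(2)[OF ij(1)] by (simp add: dot_square_norm)
    moreover have "h i \<bullet> h j = 0" if "i \<noteq> j"
    proof -
      have "h i \<noteq> h j" using h that by (auto simp: bij_betw_def inj_on_def)
      then show ?thesis using B(1) ij by (auto simp: pairwise_def orthogonal_def)
    qed
    ultimately show "(\<chi> i. h i) $ i \<bullet> (\<chi> i. h i) $ j = (if i = j then 1 else 0)" by auto
  qed
  moreover have "range (($) (\<chi> i. h i)) = B" using h by (auto simp: bij_betw_def)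
  ultimately show ?thesis using B(5) by metis
qed

lemma orth_proj_frame:
  fixes b :: "('a::euclidean_space)^'n"
  assumes "orthonormal_frame b"
  shows "orth_proj (span (range (($) b))) z = (\<Sum>i\<in>UNIV. (z \<bullet> b $ i) *\<^sub>R b $ i)"
proof (rule orth_proj_eqI)
  show "(\<Sum>i\<in>UNIV. (z \<bullet> b $ i) *\<^sub>R b $ i) \<in> span (range (($) b))"
    by (intro span_sum span_scale span_base) auto
  have base: "(z - (\<Sum>i\<in>UNIV. (z \<bullet> b $ i) *\<^sub>R b $ i)) \<bullet> b $ j = 0" for j
  proof -
    have "(\<Sum>i\<in>UNIV. z \<bullet> b $ i * (b $ i \<bullet> b $ j)) = (\<Sum>i\<in>UNIV. if i = j then z \<bullet> b $ i else 0)"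
      using assms by (intro sum.cong) (auto simp: orthonormal_frame_def)
    then show ?thesis by (simp add: inner_diff_left inner_sum_left)
  qed
  show "(z - (\<Sum>i\<in>UNIV. (z \<bullet> b $ i) *\<^sub>R b $ i)) \<bullet> w = 0" if "w \<in> span (range (($) b))" for w
    using that
    by (induction w rule: span_induct_alt) (auto simp: inner_add_right base)
qed simp

lemma dim_span_frame:
  fixes b :: "('a::euclidean_space)^'n"
  assumes b: "orthonormal_frame b"
  shows "dim (span (range (($) b))) = CARD('n)"
proof -
  have ne: "b $ i \<noteq> 0" for i
    using b unfolding orthonormal_frame_def by (metis inner_zero_left zero_neq_one)
  have inj: "inj (($) b)"
    by (rule injI) (use b in \<open>metis orthonormal_frame_def zero_neq_one\<close>)
  have "independent (range (($) b))"
  proof (rule pairwise_orthogonal_independent)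
    show "pairwise orthogonal (range (($) b))"
      using b by (auto simp: pairwise_def orthogonal_def orthonormal_frame_def)
    show "0 \<notin> range (($) b)" using ne by (metis rangeE)
  qed
  then show ?thesis
    using inj by (simp add: dim_eq_card_independent card_image)
qed

lemma subspace_dist_frame_le:
  fixes b c :: "('a::euclidean_space)^'n"
  assumes b: "orthonormal_frame b" and c: "orthonormal_frame c"
  shows "subspace_dist (span (range (($) b))) (span (range (($) c)))
         \<le> (\<Sum>i\<in>UNIV. 2 * norm (b $ i - c $ i))"
  unfolding subspace_dist_def
proof (rule onorm_bound)
  show "0 \<le> (\<Sum>i\<in>UNIV. 2 * norm (b $ i - c $ i))" by (intro sum_nonneg) auto
  fix z :: 'a
  have nb: "norm (b $ i) = 1" "norm (c $ i) = 1" for i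
    using b c by (auto simp: orthonormal_frame_def norm_eq_sqrt_inner)
  have "norm (orth_proj (span (range (($) b))) z - orth_proj (span (range (($) c))) z)
      = norm (\<Sum>i\<in>UNIV. (z \<bullet> b $ i) *\<^sub>R (b $ i - c $ i) + (z \<bullet> (b $ i - c $ i)) *\<^sub>R c $ i)"
    by (simp add: orth_proj_frame[OF b] orth_proj_frame[OF c] sum_subtractf[symmetric]
         algebra_simps)
  also have "\<dots> \<le> (\<Sum>i\<in>UNIV. 2 * norm (b $ i - c $ i) * norm z)"
  proof (rule sum_norm_le)
    fix i :: 'n
    have "norm ((z \<bullet> b $ i) *\<^sub>R (b $ i - c $ i)) \<le> norm (b $ i - c $ i) * norm z"
      using Cauchy_Schwarz_ineq2[of z "b $ i"] nb
      by (simp add: mult.commute[of _ "norm z"] mult_right_mono)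
    moreover have "norm ((z \<bullet> (b $ i - c $ i)) *\<^sub>R c $ i) \<le> norm (b $ i - c $ i) * norm z"
      using Cauchy_Schwarz_ineq2[of z "b $ i - c $ i"] nb by (simp add: mult.commute)
    ultimately show "norm ((z \<bullet> b $ i) *\<^sub>R (b $ i - c $ i) + (z \<bullet> (b $ i - c $ i)) *\<^sub>R c $ i)
        \<le> 2 * norm (b $ i - c $ i) * norm z"
      using norm_triangle_ineq[of "(z \<bullet> b $ i) *\<^sub>R (b $ i - c $ i)" "(z \<bullet> (b $ i - c $ i)) *\<^sub>R c $ i"]
      by linarith
  qed
  also have "\<dots> = (\<Sum>i\<in>UNIV. 2 * norm (b $ i - c $ i)) * norm z"
    by (simp add: sum_distrib_right)
  finally show "norm (orth_proj (span (range (($) b))) z - orth_proj (span (range (($) c))) z)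
     \<le> (\<Sum>i\<in>UNIV. 2 * norm (b $ i - c $ i)) * norm z" .
qed

text \<open>Subspaces of the same dimension are spanned by orthonormal frames, frames have convergent
subsequences, the limit is again a frame, and the projection onto the span depends continuously on the
frame.\<close>

lemma Zn_sequentially_compact:
  fixes L :: "nat \<Rightarrow> ((real^'n) \<times> (real^'n)) set"
  assumes L: "\<And>k. L k \<in> Zn"
  obtains M r where "M \<in> Zn" "strict_mono (r :: nat \<Rightarrow> nat)" "(\<lambda>k. subspace_dist M (L (r k))) \<longlonglongrightarrow> 0"
proof -
  have "\<forall>k. \<exists>b :: ((real^'n) \<times> (real^'n))^'n. orthonormal_frame b \<and> span (range (($) b)) = L k"
    using L orthonormal_frame_exists unfolding Zn_def by blast
  then obtain b :: "nat \<Rightarrow> ((real^'n) \<times> (real^'n))^'n"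
    where b: "\<And>k. orthonormal_frame (b k)" "\<And>k. span (range (($) (b k))) = L k" by metis
  have "norm (b k) \<le> real CARD('n)" for k
  proof -
    have "norm (b k) \<le> (\<Sum>i\<in>UNIV. norm (b k $ i))"
      by (simp add: norm_vec_def L2_set_le_sum)
    also have "\<dots> = (\<Sum>i\<in>(UNIV::'n set). 1)"
      using b(1)[of k] by (intro sum.cong) (auto simp: orthonormal_frame_def norm_eq_sqrt_inner)
    finally show ?thesis by simp
  qed
  then have "bounded (range b)" by (auto simp: bounded_iff)
  then obtain c r where r: "strict_mono r" and c: "(b \<circ> r) \<longlonglongrightarrow> c"
    using bounded_imp_convergent_subsequence by blast
  have ci: "(\<lambda>k. b (r k) $ i) \<longlonglongrightarrow> c $ i" for i
    using tendsto_vec_nth[OF c] by (simp add: o_def)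
  have fc: "orthonormal_frame c"
    unfolding orthonormal_frame_def
  proof (intro allI)
    fix i j
    have "(\<lambda>k. b (r k) $ i \<bullet> b (r k) $ j) \<longlonglongrightarrow> c $ i \<bullet> c $ j" by (intro tendsto_inner ci)
    then have "(\<lambda>k. if i = j then 1 else 0) \<longlonglongrightarrow> c $ i \<bullet> c $ j"
      using b(1) by (simp add: orthonormal_frame_def)
    then show "c $ i \<bullet> c $ j = (if i = j then 1 else 0)"
      using LIMSEQ_unique tendsto_const by blast
  qed
  let ?M = "span (range (($) c))"
  have "(\<lambda>k. (\<Sum>i\<in>UNIV. 2 * norm (c $ i - b (r k) $ i))) \<longlonglongrightarrow> (\<Sum>i\<in>UNIV. 2 * norm (c $ i - c $ i))"
    by (intro tendsto_intros ci)
  then have lim: "(\<lambda>k. (\<Sum>i\<in>UNIV. 2 * norm (c $ i - b (r k) $ i))) \<longlonglongrightarrow> 0" by simp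
  have "(\<lambda>k. subspace_dist ?M (L (r k))) \<longlonglongrightarrow> 0"
  proof (rule tendsto_sandwich[OF _ _ tendsto_const lim])
    show "\<forall>\<^sub>F k in sequentially. 0 \<le> subspace_dist ?M (L (r k))"
      using L by (intro always_eventually allI subspace_dist_nonneg) (auto simp: Zn_def)
    show "\<forall>\<^sub>F k in sequentially. subspace_dist ?M (L (r k)) \<le> (\<Sum>i\<in>UNIV. 2 * norm (c $ i - b (r k) $ i))"
      by (intro always_eventually allI subspace_dist_frame_le[OF fc b(1), unfolded b(2)])
  qed
  moreover have "?M \<in> Zn" using dim_span_frame[OF fc] by (simp add: Zn_def)
  ultimately show ?thesis using that r by blast
qed

lemma subspace_dist_tendsto_imp_orth_proj:
  fixes L :: "nat \<Rightarrow> 'a::euclidean_space set"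
  assumes lim: "(\<lambda>k. subspace_dist M (L k)) \<longlonglongrightarrow> 0" and M: "subspace M" and L: "\<And>k. subspace (L k)"
  shows "(\<lambda>k. orth_proj (L k) z) \<longlonglongrightarrow> orth_proj M z"
proof -
  have "(\<lambda>k. subspace_dist M (L k) * norm z) \<longlonglongrightarrow> 0 * norm z" by (intro tendsto_intros lim)
  then have "(\<lambda>k. subspace_dist M (L k) * norm z) \<longlonglongrightarrow> 0" by simp
  then have "(\<lambda>k. orth_proj M z - orth_proj (L k) z) \<longlonglongrightarrow> 0"
    by (rule Lim_null_comparison[rotated]) (use subspace_dist_bound[OF M L] in auto)
  then have "(\<lambda>k. orth_proj M z - (orth_proj M z - orth_proj (L k) z)) \<longlonglongrightarrow> orth_proj M z - 0"
    by (intro tendsto_intros)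
  then show ?thesis by simp
qed

text \<open>Convergence in the gap metric forces the limit to contain all limits of points of the subspaces.\<close>

lemma subspace_dist_tendsto_imp_limit_in:
  fixes L :: "nat \<Rightarrow> 'a::euclidean_space set"
  assumes lim: "(\<lambda>k. subspace_dist M (L k)) \<longlonglongrightarrow> 0" and M: "subspace M" and L: "\<And>k. subspace (L k)"
    and l: "l \<longlonglongrightarrow> l0" "\<And>k. l k \<in> L k"
  shows "l0 \<in> M"
proof -
  have "(\<lambda>k. norm (l k)) \<longlonglongrightarrow> norm l0" by (intro tendsto_norm l(1))
  then have "(\<lambda>k. subspace_dist M (L k) * norm (l k)) \<longlonglongrightarrow> 0 * norm l0" by (rule tendsto_mult[OF lim])
  then have "(\<lambda>k. subspace_dist M (L k) * norm (l k)) \<longlonglongrightarrow> 0" by simp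
  moreover have "infdist (l k) M \<le> subspace_dist M (L k) * norm (l k)" for k
    using subspace_dist_bound[OF M L, of "l k" k] orth_proj_id[OF L l(2), of k]
    by (simp add: infdist_eq_norm_orth_proj[OF M] norm_minus_commute)
  ultimately have "(\<lambda>k. infdist (l k) M) \<longlonglongrightarrow> 0"
    by (intro Lim_null_comparison[of "\<lambda>k. infdist (l k) M" "\<lambda>k. subspace_dist M (L k) * norm (l k)"])
      (simp_all add: infdist_nonneg)
  moreover have "(\<lambda>k. infdist (l k) M) \<longlonglongrightarrow> infdist l0 M" by (intro tendsto_infdist l(1))
  ultimately have "infdist l0 M = 0" by (rule LIMSEQ_unique[rotated])
  then show ?thesis
    using in_closed_iff_infdist_zero[OF closed_subspace[OF M], of l0] subspace_0[OF M] by auto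
qed

lemma not_tendsto_subseq:
  fixes a :: "nat \<Rightarrow> 'a::metric_space"
  assumes "\<not> a \<longlonglongrightarrow> l"
  obtains e r where "e > 0" "strict_mono (r :: nat \<Rightarrow> nat)" "\<And>k. e \<le> dist (a (r k)) l"
proof -
  obtain e where e: "e > 0" "\<forall>N. \<exists>n\<ge>N. e \<le> dist (a n) l"
    using assms unfolding lim_sequentially by (meson not_less)
  then have "infinite {n. e \<le> dist (a n) l}"
    by (simp add: infinite_nat_iff_unbounded_le)
  then obtain r :: "nat \<Rightarrow> nat" where "strict_mono r" "\<forall>k. r k \<in> {n. e \<le> dist (a n) l}"
    using infinite_enumerate by metis
  then show ?thesis using that e(1) by blast
qed

text \<open>For subspaces of equal dimension, convergence in the gap metric only has to be tested on points of
the limit: any cluster point of the sequence contains \<open>M\<close> and has the same dimension, so it is \<open>M\<close>.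
This form is stable under convergent families of linear isomorphisms.\<close>

lemma subspace_dist_tendsto_iff:
  fixes L :: "nat \<Rightarrow> ((real^'n) \<times> (real^'n)) set"
  assumes M: "M \<in> Zn" and L: "\<And>k. L k \<in> Zn"
  shows "(\<lambda>k. subspace_dist M (L k)) \<longlonglongrightarrow> 0 \<longleftrightarrow> (\<forall>l\<in>M. (\<lambda>k. infdist l (L k)) \<longlonglongrightarrow> 0)"
proof
  have sM: "subspace M" and sL: "\<And>k. subspace (L k)" using M L by (auto simp: Zn_def)
  show "\<forall>l\<in>M. (\<lambda>k. infdist l (L k)) \<longlonglongrightarrow> 0" if lim: "(\<lambda>k. subspace_dist M (L k)) \<longlonglongrightarrow> 0"
  proof
    fix l assume l: "l \<in> M"
    have "(\<lambda>k. norm (l - orth_proj (L k) l)) \<longlonglongrightarrow> norm (l - orth_proj M l)"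
      by (intro tendsto_intros subspace_dist_tendsto_imp_orth_proj lim sM sL)
    then show "(\<lambda>k. infdist l (L k)) \<longlonglongrightarrow> 0"
      by (simp add: infdist_eq_norm_orth_proj[OF sL] orth_proj_id[OF sM l])
  qed
  show "(\<lambda>k. subspace_dist M (L k)) \<longlonglongrightarrow> 0" if lim: "\<forall>l\<in>M. (\<lambda>k. infdist l (L k)) \<longlonglongrightarrow> 0"
  proof (rule ccontr)
    assume "\<not> (\<lambda>k. subspace_dist M (L k)) \<longlonglongrightarrow> 0"
    then obtain e r where e: "e > 0" "strict_mono (r :: nat \<Rightarrow> nat)"
        "\<And>k. e \<le> dist (subspace_dist M (L (r k))) 0"
      using not_tendsto_subseq by metis
    obtain M' s where M': "M' \<in> Zn" and s: "strict_mono (s :: nat \<Rightarrow> nat)"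
        and lim': "(\<lambda>k. subspace_dist M' (L (r (s k)))) \<longlonglongrightarrow> 0"
      using Zn_sequentially_compact[of "\<lambda>k. L (r k)"] L by metis
    have sM': "subspace M'" using M' by (auto simp: Zn_def)
    have "M \<subseteq> M'"
    proof
      fix l assume l: "l \<in> M"
      have "(\<lambda>k. infdist l (L k)) \<longlonglongrightarrow> 0" using lim l by blast
      from LIMSEQ_subseq_LIMSEQ[OF this strict_mono_o[OF e(2) s]]
      have "(\<lambda>k. norm (l - orth_proj (L (r (s k))) l)) \<longlonglongrightarrow> 0"
        by (simp add: o_def infdist_eq_norm_orth_proj[OF sL])
      moreover have "(\<lambda>k. norm (l - orth_proj (L (r (s k))) l)) \<longlonglongrightarrow> norm (l - orth_proj M' l)"
        by (intro tendsto_intros subspace_dist_tendsto_imp_orth_proj lim' sM' sL)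
      ultimately have "norm (l - orth_proj M' l) = 0" by (rule LIMSEQ_unique[rotated])
      then show "l \<in> M'" using orth_proj_in[OF sM', of l] by simp
    qed
    then have "M = M'"
      using subspace_dim_equal[OF sM sM'] M M' by (simp add: Zn_def)
    then have "\<forall>\<^sub>F k in sequentially. dist (subspace_dist M (L (r (s k)))) 0 < e"
      using tendstoD[OF lim' e(1)] by simp
    then obtain k where "dist (subspace_dist M (L (r (s k)))) 0 < e"
      using eventually_happens'[of sequentially] by fastforce
    then show False using e(3)[of "s k"] by simp
  qed
qed

lemma subspace_dist_triangle:
  fixes L :: "'a::euclidean_space set"
  assumes "subspace L" "subspace M" "subspace N"
  shows "subspace_dist L N \<le> subspace_dist L M + subspace_dist M N"
  unfolding subspace_dist_def[of L N]
proof (rule onorm_bound)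
  show "0 \<le> subspace_dist L M + subspace_dist M N" using assms by (simp add: subspace_dist_nonneg)
  fix z
  have "norm (orth_proj L z - orth_proj N z) \<le> norm (orth_proj L z - orth_proj M z) + norm (orth_proj M z - orth_proj N z)"
    using norm_triangle_ineq[of "orth_proj L z - orth_proj M z" "orth_proj M z - orth_proj N z"] by simp
  also have "\<dots> \<le> (subspace_dist L M + subspace_dist M N) * norm z"
    unfolding distrib_right by (intro add_mono subspace_dist_bound assms)
  finally show "norm (orth_proj L z - orth_proj N z) \<le> (subspace_dist L M + subspace_dist M N) * norm z" .
qed

section \<open>Calculus of subdifferentials and tangent cones\<close>

text \<open>Clearing the denominator in the difference quotient gives a condition free of extended-real
division.\<close>

lemma regular_subdiff_iff:
  "v \<in> regular_subdiff q x \<longleftrightarrow> \<bar>q x\<bar> \<noteq> \<infinity> \<and>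
     (\<forall>e>0. \<forall>\<^sub>F x' in at x. q x + ereal (v \<bullet> (x' - x) - e * norm (x' - x)) \<le> q x')"
proof (cases "\<bar>q x\<bar> = \<infinity>")
  case True
  then show ?thesis by (simp add: regular_subdiff_def)
next
  case False
  then obtain a where a: "q x = ereal a" by auto
  let ?R = "\<lambda>x'. (q x' - q x - ereal (v \<bullet> (x' - x))) / ereal (norm (x' - x))"
  have ne: "\<forall>\<^sub>F x' in at x. x' \<noteq> x" by (simp add: eventually_at_filter)
  have ratio_ge: "ereal (- e) \<le> ?R x' \<longleftrightarrow> q x + ereal (v \<bullet> (x' - x) - e * norm (x' - x)) \<le> q x'"
    if "x' \<noteq> x" for e x'
  proof (cases "q x'")
    case (real b)
    have n: "0 < norm (x' - x)" using that by simp
    have "ereal (- e) \<le> ?R x' \<longleftrightarrow> - e \<le> (b - a - v \<bullet> (x' - x)) / norm (x' - x)"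
      using n by (simp add: a real)
    also have "\<dots> \<longleftrightarrow> - e * norm (x' - x) \<le> b - a - v \<bullet> (x' - x)"
      using n by (simp add: pos_le_divide_eq)
    finally show ?thesis by (simp add: a real algebra_simps)
  qed (use that a in \<open>auto simp: divide_ereal_def\<close>)
  have "0 \<le> Liminf (at x) ?R \<longleftrightarrow> (\<forall>e>0. \<forall>\<^sub>F x' in at x. ereal (- e) \<le> ?R x')"
  proof
    assume "0 \<le> Liminf (at x) ?R"
    then have A: "\<forall>y<0. \<forall>\<^sub>F x' in at x. y < ?R x'" by (simp only: le_Liminf_iff)
    show "\<forall>e>0. \<forall>\<^sub>F x' in at x. ereal (- e) \<le> ?R x'"
    proof (intro allI impI)
      fix e :: real assume "e > 0"
      then have "\<forall>\<^sub>F x' in at x. ereal (- e) < ?R x'" using A by simp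
      then show "\<forall>\<^sub>F x' in at x. ereal (- e) \<le> ?R x'" by eventually_elim (rule less_imp_le)
    qed
  next
    assume A: "\<forall>e>0. \<forall>\<^sub>F x' in at x. ereal (- e) \<le> ?R x'"
    show "0 \<le> Liminf (at x) ?R"
      unfolding le_Liminf_iff
    proof (intro allI impI)
      fix y :: ereal assume "y < 0"
      \<comment> \<open>A real number below zero is needed, as \<open>y\<close> may be \<open>- \<infinity>\<close>.\<close>
      then obtain r where r: "y < ereal r" "ereal r < 0" using ereal_dense2 by metis
      then have "\<forall>\<^sub>F x' in at x. ereal r \<le> ?R x'" using A[rule_format, of "- r"] by simp
      then show "\<forall>\<^sub>F x' in at x. y < ?R x'" by eventually_elim (use r in order)
    qed
  qed
  also have "\<dots> \<longleftrightarrow> (\<forall>e>0. \<forall>\<^sub>F x' in at x. q x + ereal (v \<bullet> (x' - x) - e * norm (x' - x)) \<le> q x')"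
  proof (intro all_cong1 imp_cong refl eventually_cong[OF ne])
    show "(ereal (- e) \<le> ?R x') = (q x + ereal (v \<bullet> (x' - x) - e * norm (x' - x)) \<le> q x')"
      if "x' \<noteq> x" for e x' by (rule ratio_ge[OF that])
  qed
  finally show ?thesis using False by (simp add: regular_subdiff_def)
qed

lemma subdiffI:
  assumes "\<bar>q x\<bar> \<noteq> \<infinity>" "X \<longlonglongrightarrow> x" "V \<longlonglongrightarrow> v" "\<And>k. V k \<in> regular_subdiff q (X k)"
    "(\<lambda>k. q (X k)) \<longlonglongrightarrow> q x"
  shows "v \<in> subdiff q x"
  unfolding subdiff_def mem_Collect_eq
  by (intro conjI exI[of _ X] exI[of _ V] allI assms)

lemma regular_subdiff_subset_subdiff: "regular_subdiff q x \<subseteq> subdiff q x"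
proof
  fix v assume v: "v \<in> regular_subdiff q x"
  then have "\<bar>q x\<bar> \<noteq> \<infinity>" by (simp add: regular_subdiff_def)
  then show "v \<in> subdiff q x" by (rule subdiffI[of q x "\<lambda>_. x" "\<lambda>_. v"]) (simp_all add: v)
qed

lemma regular_subdiff_add_smooth:
  fixes h :: "'a::real_inner \<Rightarrow> real"
  assumes h: "GDERIV h x :> G" and v: "v \<in> regular_subdiff q x"
  shows "v + G \<in> regular_subdiff (\<lambda>x. ereal (h x) + q x) x"
  unfolding regular_subdiff_iff
proof (intro conjI allI impI)
  obtain a where a: "q x = ereal a" using v unfolding regular_subdiff_iff by auto
  then show "\<bar>ereal (h x) + q x\<bar> \<noteq> \<infinity>" by simp
  fix e :: real assume e: "e > 0"
  have 1: "\<forall>\<^sub>F x' in at x. q x + ereal (v \<bullet> (x' - x) - e/2 * norm (x' - x)) \<le> q x'"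
    using v e unfolding regular_subdiff_iff by (meson half_gt_zero)
  obtain d where d: "d > 0" "\<And>y. norm (y - x) < d \<Longrightarrow> norm (h y - h x - (y - x) \<bullet> G) \<le> e/2 * norm (y - x)"
    using h e unfolding gderiv_def has_derivative_at_alt by (meson half_gt_zero)
  have 2: "\<forall>\<^sub>F x' in at x. norm (x' - x) < d"
    using d(1) by (auto simp: eventually_at dist_norm intro!: exI[of _ d])
  show "\<forall>\<^sub>F x' in at x. (ereal (h x) + q x) + ereal ((v + G) \<bullet> (x' - x) - e * norm (x' - x))
          \<le> ereal (h x') + q x'"
    using 1 2
  proof eventually_elim
    case (elim x')
    have "h x + (x' - x) \<bullet> G - e/2 * norm (x' - x) \<le> h x'"
      using d(2)[OF elim(2)] unfolding real_norm_def abs_le_iff by linarith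
    moreover have "(v + G) \<bullet> (x' - x) = v \<bullet> (x' - x) + (x' - x) \<bullet> G"
      by (simp add: inner_add_left inner_commute[of _ G])
    ultimately show ?case
      using elim(1) a by (cases "q x'") auto
  qed
qed

lemma subdiff_add_smooth_aux:
  fixes h :: "'a::real_inner \<Rightarrow> real"
  assumes h: "\<And>x. GDERIV h x :> G x" and G: "continuous_on UNIV G" and v: "v \<in> subdiff q x"
  shows "v + G x \<in> subdiff (\<lambda>x. ereal (h x) + q x) x"
proof -
  obtain X V where XV: "\<bar>q x\<bar> \<noteq> \<infinity>" "X \<longlonglongrightarrow> x" "V \<longlonglongrightarrow> v" "\<And>k. V k \<in> regular_subdiff q (X k)"
      "(\<lambda>k. q (X k)) \<longlonglongrightarrow> q x"
    using v unfolding subdiff_def by auto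
  have GX: "(\<lambda>k. G (X k)) \<longlonglongrightarrow> G x"
    using G XV(2) by (metis UNIV_I continuous_on_tendsto_compose eventually_sequentiallyI)
  have "isCont h x" using h[of x] has_derivative_continuous unfolding gderiv_def by blast
  then have hX: "(\<lambda>k. ereal (h (X k))) \<longlonglongrightarrow> ereal (h x)"
    using XV(2) isCont_tendsto_compose by (intro tendsto_ereal) blast
  have "(\<lambda>k. ereal (h (X k)) + q (X k)) \<longlonglongrightarrow> ereal (h x) + q x"
    by (rule tendsto_add_ereal[OF _ XV(1) hX XV(5)]) simp
  moreover have "(\<lambda>k. V k + G (X k)) \<longlonglongrightarrow> v + G x" by (intro tendsto_intros XV GX)
  moreover have "V k + G (X k) \<in> regular_subdiff (\<lambda>x. ereal (h x) + q x) (X k)" for k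
    by (rule regular_subdiff_add_smooth[OF h XV(4)])
  moreover have "\<bar>ereal (h x) + q x\<bar> \<noteq> \<infinity>" using XV(1) by (cases "q x") auto
  ultimately show ?thesis using XV(2)
    by (intro subdiffI[of _ x X "\<lambda>k. V k + G (X k)"])
qed

text \<open>One inclusion holds for every smooth \<open>h\<close>; the other one is the same inclusion for \<open>- h\<close>, because
adding \<open>- h\<close> to \<open>h + q\<close> gives back \<open>q\<close>.\<close>

lemma subdiff_add_smooth:
  fixes h :: "'a::real_inner \<Rightarrow> real"
  assumes h: "\<And>x. GDERIV h x :> G x" and G: "continuous_on UNIV G"
  shows "v \<in> subdiff (\<lambda>x. ereal (h x) + q x) x \<longleftrightarrow> v - G x \<in> subdiff q x"
proof
  assume "v - G x \<in> subdiff q x"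
  from subdiff_add_smooth_aux[OF h G this] show "v \<in> subdiff (\<lambda>x. ereal (h x) + q x) x" by simp
next
  assume v: "v \<in> subdiff (\<lambda>x. ereal (h x) + q x) x"
  have h': "GDERIV (\<lambda>x. - h x) y :> - G y" for y by (rule GDERIV_minus[OF h])
  have G': "continuous_on UNIV (\<lambda>x. - G x)" by (intro continuous_intros G)
  have "(\<lambda>x. ereal (- h x) + (ereal (h x) + q x)) = q"
  proof
    fix x show "ereal (- h x) + (ereal (h x) + q x) = q x" by (cases "q x") auto
  qed
  then show "v - G x \<in> subdiff q x" using subdiff_add_smooth_aux[OF h' G' v] by simp
qed

text \<open>The difference quotients of \<open>\<Phi>\<close> along \<open>t k *\<^sub>R U k\<close> differ from \<open>D (U k)\<close> by a null sequence, since
\<open>U\<close> is bounded.\<close>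

lemma tangent_cone_image:
  fixes \<Phi> :: "'a::real_normed_vector \<Rightarrow> 'b::real_normed_vector"
  assumes D: "(\<Phi> has_derivative D) (at z)" and u: "u \<in> tangent_cone S z"
    and S: "\<And>w. w \<in> S \<Longrightarrow> \<Phi> w \<in> S'"
  shows "D u \<in> tangent_cone S' (\<Phi> z)"
proof -
  obtain t U where t: "\<And>k. 0 < t k" "t \<longlonglongrightarrow> 0" and U: "U \<longlonglongrightarrow> u" and in_S: "\<And>k::nat. z + t k *\<^sub>R U k \<in> S"
    using u unfolding tangent_cone_def by auto
  have blD: "bounded_linear D" using D by (rule has_derivative_bounded_linear)
  define V where "V = (\<lambda>k. (\<Phi> (z + t k *\<^sub>R U k) - \<Phi> z) /\<^sub>R t k)"
  have tU: "(\<lambda>k. t k *\<^sub>R U k) \<longlonglongrightarrow> 0" using tendsto_scaleR[OF t(2) U] by simp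
  obtain K where K: "K > 0" "\<And>k. norm (U k) \<le> K"
    using U convergent_imp_Bseq[of U] unfolding convergent_def Bseq_def by auto
  have "(\<lambda>k. V k - D (U k)) \<longlonglongrightarrow> 0"
  proof (rule tendstoI)
    fix e :: real assume e: "e > 0"
    define e' where "e' = e / (2 * K)"
    have "e' > 0" using e K by (simp add: e'_def)
    then obtain d where d: "d > 0" "\<And>y. norm (y - z) < d \<Longrightarrow> norm (\<Phi> y - \<Phi> z - D (y - z)) \<le> e' * norm (y - z)"
      using D unfolding has_derivative_at_alt by metis
    have "\<forall>\<^sub>F k in sequentially. norm (t k *\<^sub>R U k) < d" using tendstoD[OF tU d(1)] by simp
    then show "\<forall>\<^sub>F k in sequentially. dist (V k - D (U k)) 0 < e"
    proof eventually_elim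
      case (elim k)
      have "V k - D (U k) = (\<Phi> (z + t k *\<^sub>R U k) - \<Phi> z - D (t k *\<^sub>R U k)) /\<^sub>R t k"
        using t(1)[of k] bounded_linear.linear[OF blD]
        by (simp add: V_def linear_scale scaleR_diff_right)
      then have "norm (V k - D (U k)) = norm (\<Phi> (z + t k *\<^sub>R U k) - \<Phi> z - D (t k *\<^sub>R U k)) / t k"
        using t(1)[of k] by (simp add: divide_inverse mult.commute)
      also have "\<dots> \<le> e' * norm (t k *\<^sub>R U k) / t k"
        using d(2)[of "z + t k *\<^sub>R U k"] elim t(1)[of k] by (intro divide_right_mono) auto
      also have "\<dots> = e' * norm (U k)" using t(1)[of k] by simp
      also have "\<dots> \<le> e' * K" using K \<open>e' > 0\<close> by (intro mult_left_mono) auto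
      also have "\<dots> < e" using e K by (simp add: e'_def)
      finally show ?case by simp
    qed
  qed
  then have "(\<lambda>k. V k - D (U k) + D (U k)) \<longlonglongrightarrow> 0 + D u"
    by (intro tendsto_intros bounded_linear.tendsto[OF blD U])
  then have "V \<longlonglongrightarrow> D u" by simp
  moreover have "\<Phi> z + t k *\<^sub>R V k \<in> S'" for k
    using S[OF in_S[of k]] t(1)[of k] by (simp add: V_def)
  ultimately show ?thesis unfolding tangent_cone_def using t by blast
qed

section \<open>Gradients and the symmetry of the Hessian\<close>

lemma GDERIV_grad:
  assumes "f differentiable (at x)"
  shows "GDERIV f x :> grad f x"
proof -
  obtain f' where f': "(f has_derivative f') (at x)" using assms by (auto simp: differentiable_def)
  have "(\<lambda>h. h \<bullet> adjoint f' 1) = f'"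
    using adjoint_works[OF has_derivative_linear[OF f'], where y = 1] by (auto simp: inner_real_def)
  then have D: "GDERIV f x :> adjoint f' 1" using f' by (simp add: gderiv_def)
  show ?thesis
    unfolding grad_def
  proof (rule theI, rule D)
    fix D assume "GDERIV f x :> D"
    then have "(\<lambda>h. h \<bullet> D) = (\<lambda>h. h \<bullet> adjoint f' 1)"
      using D unfolding gderiv_def by (rule has_derivative_unique)
    then have "\<forall>h. h \<bullet> D = h \<bullet> adjoint f' 1" by metis
    then show "D = adjoint f' 1" using vector_eq_rdot[of D "adjoint f' 1"] by (simp add: inner_commute)
  qed
qed

text \<open>The increment of \<open>f\<close> along the segment from \<open>x + t a\<close> to \<open>x + t b\<close> is the line integral of
the gradient. Replacing the gradient by its linearization at \<open>x\<close> alone gives the increment up to \<open>o(t\<^sup>2)\<close>,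
uniformly along the segment; the mean value theorem stands in for the integral.\<close>

lemma gradient_derivative_edge:
  fixes f :: "'a::real_inner \<Rightarrow> real"
  assumes f: "\<And>x. GDERIV f x :> G x" and H: "(G has_derivative H) (at x)" and e: "e > 0"
  obtains \<delta> where "\<delta> > 0" "\<And>t. \<lbrakk>0 < t; t < \<delta>\<rbrakk> \<Longrightarrow>
    \<bar>f (x + t *\<^sub>R b) - f (x + t *\<^sub>R a) - t * (G x \<bullet> (b - a))
        - t\<^sup>2 * (H a \<bullet> (b - a) + H (b - a) \<bullet> (b - a) / 2)\<bar> \<le> e * t\<^sup>2"
proof -
  define d where "d = b - a"
  define C where "C = norm d * (norm a + norm d) + 1"
  have C: "C > 0" unfolding C_def by (simp add: add_nonneg_pos)
  have "e / C > 0" using e C by simp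
  then obtain \<delta> where \<delta>: "\<delta> > 0"
      "\<And>y. norm (y - x) < \<delta> \<Longrightarrow> norm (G y - G x - H (y - x)) \<le> e / C * norm (y - x)"
    using H unfolding has_derivative_at_alt by meson
  have linH: "linear H" using H by (rule has_derivative_linear)
  define \<delta>' where "\<delta>' = \<delta> / (norm a + norm d + 1)"
  have \<delta>'0: "\<delta>' > 0" unfolding \<delta>'_def using \<delta>(1) by (simp add: add_nonneg_pos)
  have main: "\<bar>f (x + t *\<^sub>R b) - f (x + t *\<^sub>R a) - t * (G x \<bullet> d)
        - t\<^sup>2 * (H a \<bullet> d + H d \<bullet> d / 2)\<bar> \<le> e * t\<^sup>2" if t: "0 < t" "t < \<delta>'" for t
  proof -
    define p where "p = (\<lambda>s. f (x + t *\<^sub>R (a + s *\<^sub>R d)) - t * s * (G x \<bullet> d)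
        - t\<^sup>2 * (s * (H a \<bullet> d) + s\<^sup>2 * (H d \<bullet> d / 2)))"
    define p' where "p' = (\<lambda>s. t * (d \<bullet> G (x + t *\<^sub>R (a + s *\<^sub>R d))) - t * (G x \<bullet> d)
        - t\<^sup>2 * (H a \<bullet> d + s * (H d \<bullet> d)))"
    have der: "DERIV p s :> p' s" for s
    proof -
      have "((\<lambda>s. x + t *\<^sub>R (a + s *\<^sub>R d)) has_derivative (\<lambda>r. t *\<^sub>R (r *\<^sub>R d))) (at s)"
        by (auto intro!: derivative_eq_intros)
      from has_derivative_compose[OF this f[unfolded gderiv_def]]
      have "((\<lambda>s. f (x + t *\<^sub>R (a + s *\<^sub>R d))) has_derivative
          (\<lambda>r. (t *\<^sub>R (r *\<^sub>R d)) \<bullet> G (x + t *\<^sub>R (a + s *\<^sub>R d)))) (at s)" .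
      then have 1: "DERIV (\<lambda>s. f (x + t *\<^sub>R (a + s *\<^sub>R d))) s :> t * (d \<bullet> G (x + t *\<^sub>R (a + s *\<^sub>R d)))"
        unfolding has_field_derivative_def
        by (elim back_subst[where P = "\<lambda>g. (_ has_derivative g) _"]) (auto simp: fun_eq_iff mult_ac)
      show ?thesis unfolding p_def p'_def
        by (rule derivative_eq_intros 1 refl | simp)+
    qed
    obtain s where s: "0 < s" "s < 1" "p 1 - p 0 = (1 - 0) * p' s"
      using MVT2[of 0 1 p p'] der by auto
    define w where "w = a + s *\<^sub>R d"
    have nw: "norm w \<le> norm a + norm d"
      unfolding w_def using norm_triangle_ineq[of a "s *\<^sub>R d"] s
        mult_right_mono[of s 1 "norm d"] by simp
    have Hw: "H (t *\<^sub>R w) = t *\<^sub>R (H a + s *\<^sub>R H d)"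
      unfolding w_def using linH by (simp add: linear_add linear_scale)
    have p's: "p' s = t * (d \<bullet> (G (x + t *\<^sub>R w) - G x - H (t *\<^sub>R w)))"
      unfolding Hw p'_def w_def[symmetric]
      by (simp add: inner_diff_right inner_add_right inner_commute power2_eq_square algebra_simps)
    have "t * norm w \<le> t * (norm a + norm d + 1)" using nw t by (intro mult_left_mono) auto
    also have "\<dots> < \<delta>" using t(2) unfolding \<delta>'_def
      by (subst (asm) pos_less_divide_eq) (auto simp: add_nonneg_pos)
    finally have "norm (x + t *\<^sub>R w - x) < \<delta>" using t by simp
    from \<delta>(2)[OF this] have g: "norm (G (x + t *\<^sub>R w) - G x - H (t *\<^sub>R w)) \<le> e / C * (t * norm w)"
      using t by simp
    have "\<bar>p' s\<bar> = t * \<bar>d \<bullet> (G (x + t *\<^sub>R w) - G x - H (t *\<^sub>R w))\<bar>"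
      unfolding p's using t by (simp add: abs_mult)
    also have "\<dots> \<le> t * (norm d * (e / C * (t * norm w)))"
      using t by (intro mult_left_mono order_trans[OF Cauchy_Schwarz_ineq2] g) auto
    also have "\<dots> = e * t\<^sup>2 * (norm d * norm w / C)" by (simp add: power2_eq_square)
    also have "\<dots> \<le> e * t\<^sup>2 * 1"
    proof (intro mult_left_mono)
      have "norm d * norm w \<le> norm d * (norm a + norm d)" using nw by (intro mult_left_mono) auto
      then show "norm d * norm w / C \<le> 1" using C unfolding C_def by simp
    qed (use e in auto)
    finally have "\<bar>p 1 - p 0\<bar> \<le> e * t\<^sup>2" using s(3) by simp
    moreover have "p 1 - p 0 = f (x + t *\<^sub>R b) - f (x + t *\<^sub>R a) - t * (G x \<bullet> d)
        - t\<^sup>2 * (H a \<bullet> d + H d \<bullet> d / 2)"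
      unfolding p_def d_def by (simp add: algebra_simps)
    ultimately show ?thesis by simp
  qed
  show ?thesis by (rule that[OF \<delta>'0]) (use main in \<open>simp add: d_def\<close>)
qed

text \<open>The increments of \<open>f\<close> around the triangle with vertices \<open>x\<close>, \<open>x + t a\<close>, \<open>x + t b\<close> add up to
zero. In their second-order expansions everything cancels except half the skew part
\<open>H a \<bullet> b - a \<bullet> H b\<close>, multiplied by \<open>t\<^sup>2\<close>.\<close>

lemma gradient_derivative_symmetric:
  fixes f :: "'a::real_inner \<Rightarrow> real"
  assumes f: "\<And>x. GDERIV f x :> G x" and H: "(G has_derivative H) (at x)"
  shows "H a \<bullet> b = a \<bullet> H b"
proof -
  have linH: "linear H" using H by (rule has_derivative_linear)
  have H0: "H 0 = 0" using linH by (rule linear_0)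
  define D where "D = \<bar>(H a \<bullet> b - a \<bullet> H b) / 2\<bar>"
  have "D \<le> 3 * e" if e: "e > 0" for e
  proof -
    obtain \<delta>1 where 1: "\<delta>1 > 0" "\<And>t. \<lbrakk>0 < t; t < \<delta>1\<rbrakk> \<Longrightarrow>
      \<bar>f (x + t *\<^sub>R a) - f (x + t *\<^sub>R 0) - t * (G x \<bullet> (a - 0))
          - t\<^sup>2 * (H 0 \<bullet> (a - 0) + H (a - 0) \<bullet> (a - 0) / 2)\<bar> \<le> e * t\<^sup>2"
      using gradient_derivative_edge[OF f H e, of a 0] by metis
    obtain \<delta>2 where 2: "\<delta>2 > 0" "\<And>t. \<lbrakk>0 < t; t < \<delta>2\<rbrakk> \<Longrightarrow>
      \<bar>f (x + t *\<^sub>R b) - f (x + t *\<^sub>R a) - t * (G x \<bullet> (b - a))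
          - t\<^sup>2 * (H a \<bullet> (b - a) + H (b - a) \<bullet> (b - a) / 2)\<bar> \<le> e * t\<^sup>2"
      using gradient_derivative_edge[OF f H e, of b a] by metis
    obtain \<delta>3 where 3: "\<delta>3 > 0" "\<And>t. \<lbrakk>0 < t; t < \<delta>3\<rbrakk> \<Longrightarrow>
      \<bar>f (x + t *\<^sub>R 0) - f (x + t *\<^sub>R b) - t * (G x \<bullet> (0 - b))
          - t\<^sup>2 * (H b \<bullet> (0 - b) + H (0 - b) \<bullet> (0 - b) / 2)\<bar> \<le> e * t\<^sup>2"
      using gradient_derivative_edge[OF f H e, of 0 b] by metis
    define t where "t = min \<delta>1 (min \<delta>2 \<delta>3) / 2"
    have t: "0 < t" "t < \<delta>1" "t < \<delta>2" "t < \<delta>3" using 1(1) 2(1) 3(1) by (auto simp: t_def)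
    have E: "(H 0 \<bullet> (a - 0) + H (a - 0) \<bullet> (a - 0) / 2) + (H a \<bullet> (b - a) + H (b - a) \<bullet> (b - a) / 2)
        + (H b \<bullet> (0 - b) + H (0 - b) \<bullet> (0 - b) / 2) = (H a \<bullet> b - a \<bullet> H b) / 2"
      using linH by (simp add: linear_diff linear_neg inner_diff_left inner_diff_right inner_commute H0 field_simps)
    have G: "t * (G x \<bullet> (a - 0)) + t * (G x \<bullet> (b - a)) + t * (G x \<bullet> (0 - b)) = 0"
      by (simp add: inner_diff_right algebra_simps)
    have sum3: "\<bar>s * (E1 + E2 + E3)\<bar> \<le> 3 * m"
      if "\<bar>F1 - g1 - s * E1\<bar> \<le> m" "\<bar>F2 - g2 - s * E2\<bar> \<le> m" "\<bar>F3 - g3 - s * E3\<bar> \<le> m"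
        "F1 + F2 + F3 = 0" "g1 + g2 + g3 = 0" for s E1 E2 E3 F1 F2 F3 g1 g2 g3 m :: real
      using that unfolding distrib_left by linarith
    have "\<bar>t\<^sup>2 * ((H a \<bullet> b - a \<bullet> H b) / 2)\<bar> \<le> 3 * (e * t\<^sup>2)"
      unfolding E[symmetric]
      by (rule sum3[OF 1(2)[OF t(1,2)] 2(2)[OF t(1,3)] 3(2)[OF t(1,4)] _ G]) simp
    then have "t\<^sup>2 * D \<le> t\<^sup>2 * (3 * e)" unfolding D_def abs_mult by (simp add: mult_ac)
    then show ?thesis using t(1) by (simp only: mult_le_cancel_left_pos zero_less_power)
  qed
  from this[of "D / 4"] have "D \<le> 0" by (cases "D > 0") auto
  then show ?thesis by (simp add: D_def)
qed

lemma tendsto_matrix_vector_mult: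
  fixes A :: "'b \<Rightarrow> real^'n^'m"
  assumes A: "(A \<longlongrightarrow> A0) F" and x: "(x \<longlongrightarrow> x0) F"
  shows "((\<lambda>k. A k *v x k) \<longlongrightarrow> A0 *v x0) F"
  unfolding matrix_vector_mult_def
  by (intro tendsto_vec_lambda tendsto_sum tendsto_mult tendsto_vec_nth A x)

lemma matrix_vector_norm_bound:
  obtains B where "B > 0" "\<And>(A :: real^'n^'m) x. norm (A *v x) \<le> norm A * norm x * B"
proof -
  have "bilinear ((*v) :: real^'n^'m \<Rightarrow> real^'n \<Rightarrow> real^'m)"
    unfolding bilinear_def
    by (auto intro!: linearI simp: matrix_vector_right_distrib matrix_vector_mult_scaleR
        matrix_vector_mult_add_rdistrib scaleR_matrix_vector_assoc)
  then have "bounded_bilinear ((*v) :: real^'n^'m \<Rightarrow> real^'n \<Rightarrow> real^'m)"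
    by (simp add: bilinear_conv_bounded_bilinear)
  from bounded_bilinear.pos_bounded[OF this] show ?thesis using that by blast
qed

section \<open>Tangent spaces to subdifferential graphs at prox-regular points\<close>

text \<open>The inequality of prox-regularity without a restriction on function values, and with the same constants at
all graph points near \<open>z\<close>.\<close>

definition uniform_prox_ineq :: "('a::real_inner \<Rightarrow> ereal) \<Rightarrow> real \<Rightarrow> real \<Rightarrow> 'a \<times> 'a \<Rightarrow> bool" where
  "uniform_prox_ineq q \<rho> \<delta> z \<longleftrightarrow> (\<forall>x v x'. (x, v) \<in> gph (subdiff q) \<inter> ball z \<delta> \<longrightarrow> x' \<in> ball (fst z) \<delta> \<longrightarrow>
      q x + ereal (v \<bullet> (x' - x) - \<rho> / 2 * (norm (x' - x))\<^sup>2) \<le> q x')"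

lemma gph_subdiff_finite: "(x, v) \<in> gph (subdiff q) \<Longrightarrow> \<bar>q x\<bar> \<noteq> \<infinity>"
  by (simp add: gph_def subdiff_def)

text \<open>Subdifferential continuity makes the condition on function values in the definition of prox-regularity
hold automatically on a small part of the graph.\<close>

lemma proxreg_imp_uniform_prox_ineq:
  assumes z: "z \<in> proxreg q"
  obtains \<rho> \<delta> where "\<rho> \<ge> 0" "\<delta> > 0" "uniform_prox_ineq q \<rho> \<delta> z"
proof -
  obtain xb vb where zb: "z = (xb, vb)" by (cases z)
  have pr: "prox_regular_at q xb vb" and sc: "subdiff_continuous_at q xb vb"
    and zg: "(xb, vb) \<in> gph (subdiff q)"
    using z by (auto simp: zb proxreg_def)
  obtain a where a: "q xb = ereal a" using gph_subdiff_finite[OF zg] by auto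
  obtain \<epsilon> \<rho> where e: "\<epsilon> > 0" "\<rho> \<ge> 0"
    and ineq: "\<And>x' x v. \<lbrakk>x' \<in> cball xb \<epsilon>; x \<in> cball xb \<epsilon>; \<bar>q x - q xb\<bar> \<le> ereal \<epsilon>; v \<in> subdiff q x; v \<in> cball vb \<epsilon>\<rbrakk>
        \<Longrightarrow> q x + ereal (v \<bullet> (x' - x) - \<rho> / 2 * (norm (x' - x))\<^sup>2) \<le> q x'"
    using pr unfolding prox_regular_at_def by blast
  have "\<exists>\<delta>>0. \<forall>x v. (x, v) \<in> gph (subdiff q) \<inter> ball z \<delta> \<longrightarrow> \<bar>q x - q xb\<bar> \<le> ereal \<epsilon>"
  proof (rule ccontr)
    assume neg: "\<not> ?thesis"
    have "\<forall>n::nat. \<exists>x v. (x, v) \<in> gph (subdiff q) \<inter> ball z (inverse (real (Suc n))) \<and> \<not> \<bar>q x - q xb\<bar> \<le> ereal \<epsilon>"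
    proof
      fix n :: nat
      have "0 < inverse (real (Suc n))" by simp
      then show "\<exists>x v. (x, v) \<in> gph (subdiff q) \<inter> ball z (inverse (real (Suc n))) \<and> \<not> \<bar>q x - q xb\<bar> \<le> ereal \<epsilon>"
        using neg by blast
    qed
    then obtain X V where XV: "\<And>n. (X n, V n) \<in> gph (subdiff q)"
        "\<And>n. (X n, V n) \<in> ball z (inverse (real (Suc n)))" "\<And>n. \<not> \<bar>q (X n) - q xb\<bar> \<le> ereal \<epsilon>"
      by (metis Int_iff)
    have "(\<lambda>n. (X n, V n)) \<longlonglongrightarrow> z"
    proof (rule metric_tendsto_imp_tendsto[OF LIMSEQ_inverse_real_of_nat])
      show "\<forall>\<^sub>F n in sequentially. dist (X n, V n) z \<le> dist (inverse (real (Suc n))) 0"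
        using XV(2) by (intro always_eventually allI) (auto simp: dist_commute less_imp_le)
    qed
    then have "X \<longlonglongrightarrow> xb" "V \<longlonglongrightarrow> vb" using tendsto_fst[of "\<lambda>n. (X n, V n)"] tendsto_snd[of "\<lambda>n. (X n, V n)"]
      by (auto simp: zb)
    then have "(\<lambda>n. q (X n)) \<longlonglongrightarrow> ereal a"
      using sc XV(1) unfolding subdiff_continuous_at_def a[symmetric] by blast
    then have "\<forall>\<^sub>F n in sequentially. ereal (a - \<epsilon>) < q (X n)" "\<forall>\<^sub>F n in sequentially. q (X n) < ereal (a + \<epsilon>)"
      using e by (auto simp: order_tendsto_iff)
    then have "\<forall>\<^sub>F n in sequentially. \<bar>q (X n) - q xb\<bar> \<le> ereal \<epsilon>"
    proof eventually_elim
      case (elim n)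
      then show ?case by (cases "q (X n)") (auto simp: a)
    qed
    then show False using XV(3) by simp
  qed
  then obtain \<delta> where \<delta>: "\<delta> > 0" "\<And>x v. (x, v) \<in> gph (subdiff q) \<inter> ball z \<delta> \<Longrightarrow> \<bar>q x - q xb\<bar> \<le> ereal \<epsilon>"
    by blast
  have "uniform_prox_ineq q \<rho> (min \<delta> \<epsilon>) z"
    unfolding uniform_prox_ineq_def
  proof (intro allI impI)
    fix x v x' assume xv: "(x, v) \<in> gph (subdiff q) \<inter> ball z (min \<delta> \<epsilon>)" and x': "x' \<in> ball (fst z) (min \<delta> \<epsilon>)"
    have "dist (xb, vb) (x, v) < \<epsilon>" using xv by (simp add: zb)
    then have "dist xb x < \<epsilon>" "dist vb v < \<epsilon>"
      using dist_fst_le[of "(xb, vb)" "(x, v)"] dist_snd_le[of "(xb, vb)" "(x, v)"] by auto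
    then show "q x + ereal (v \<bullet> (x' - x) - \<rho> / 2 * (norm (x' - x))\<^sup>2) \<le> q x'"
      using xv x' \<delta>(2)[of x v] by (intro ineq) (auto simp: zb gph_def)
  qed
  then show ?thesis using that[of \<rho> "min \<delta> \<epsilon>"] e \<delta>(1) by simp
qed

text \<open>The inequality is an open property along the graph. It can therefore be transported from a prox-regular point
to nearby points at which the tangent cone is a subspace.\<close>

lemma uniform_prox_ineq_shift:
  assumes "uniform_prox_ineq q \<rho> \<delta> z" "dist w z + \<delta>' \<le> \<delta>"
  shows "uniform_prox_ineq q \<rho> \<delta>' w"
proof -
  have sub: "ball p \<delta>' \<subseteq> ball p' \<delta>" if "dist p p' \<le> dist w z" for p p' :: "'b::metric_space"
  proof
    fix y assume "y \<in> ball p \<delta>'"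
    then show "y \<in> ball p' \<delta>"
      using that assms(2) dist_triangle[of p' y p] by (simp add: dist_commute)
  qed
  have "ball w \<delta>' \<subseteq> ball z \<delta>" by (rule sub) simp
  moreover have "ball (fst w) \<delta>' \<subseteq> ball (fst z) \<delta>" by (rule sub) (rule dist_fst_le)
  ultimately show ?thesis using assms(1) unfolding uniform_prox_ineq_def by blast
qed

lemma lsc_eventually_greater:
  assumes "lsc h" "c < h x"
  shows "\<forall>\<^sub>F y in nhds x. c < h y"
proof -
  have "\<forall>\<^sub>F y in at x. c < h y"
    using assms less_le_trans unfolding lsc_def le_Liminf_iff by blast
  then show ?thesis using assms(2) by (auto simp: eventually_at_filter elim!: eventually_mono)
qed

text \<open>If no point of \<open>K\<close> were a minimizer, the sets \<open>{x. h y < h x}\<close> with \<open>y \<in> K\<close>, which are open by lower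
semicontinuity, would cover \<open>K\<close>. Finitely many would suffice, but the one with the smallest value
\<open>h y\<close> already contains all others and misses \<open>y\<close>.\<close>

lemma lsc_attains_inf:
  fixes h :: "'a::topological_space \<Rightarrow> ereal"
  assumes h: "lsc h" and K: "compact K" "K \<noteq> {}"
  obtains x where "x \<in> K" "\<And>y. y \<in> K \<Longrightarrow> h x \<le> h y"
proof (rule ccontr)
  assume "\<not> thesis"
  then have neg: "\<And>x. x \<in> K \<Longrightarrow> \<exists>y\<in>K. h y < h x" using that by (meson not_less)
  have op: "open {x. h y < h x}" for y
    unfolding open_subopen[of "{x. h y < h x}"]
  proof
    fix x assume "x \<in> {x. h y < h x}"
    then have "\<forall>\<^sub>F x' in nhds x. h y < h x'" using lsc_eventually_greater[OF h] by simp
    then show "\<exists>T. open T \<and> x \<in> T \<and> T \<subseteq> {x. h y < h x}"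
      unfolding eventually_nhds by blast
  qed
  have "K \<subseteq> (\<Union>y\<in>K. {x. h y < h x})" using neg by blast
  then obtain F where F: "F \<subseteq> K" "finite F" "K \<subseteq> (\<Union>y\<in>F. {x. h y < h x})"
    using compactE_image[OF K(1), of K "\<lambda>y. {x. h y < h x}"] op by metis
  have "F \<noteq> {}" using F(3) K(2) by auto
  then obtain m where "m \<in> F" "\<And>y. y \<in> F \<Longrightarrow> h m \<le> h y"
    using F(2) by (metis (no_types, lifting) arg_min_if_finite(1) arg_min_least)
  then show False using F(1,3) by fastforce
qed

lemma lsc_add_continuous:
  assumes q: "lsc q" "\<And>x. q x \<noteq> -\<infinity>" and a: "\<And>x. isCont a x"
  shows "lsc (\<lambda>x. ereal (a x) + q x)"
  unfolding lsc_def le_Liminf_iff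
proof (intro allI impI)
  fix x and c :: ereal assume c: "c < ereal (a x) + q x"
  show "\<forall>\<^sub>F y in at x. c < ereal (a y) + q y"
  proof (cases c)
    case (real r)
    then have "ereal (r - a x) < q x" using c by (cases "q x") auto
    then obtain d where d: "ereal (r - a x) < ereal d" "ereal d < q x" using ereal_dense2 by metis
    have "\<forall>\<^sub>F y in at x. ereal d < q y"
      using q(1) d(2) less_le_trans unfolding lsc_def le_Liminf_iff by blast
    moreover have "\<forall>\<^sub>F y in at x. r - d < a y"
      using a[of x] d(1) unfolding isCont_def by (intro order_tendstoD(1)) auto
    ultimately show ?thesis
    proof eventually_elim
      case (elim y)
      then show ?case by (cases "q y") (auto simp: real)
    qed
  next
    case PInf then show ?thesis using c by simp
  next
    case MInf
    have "- \<infinity> < ereal (a y) + q y" for y using q(2)[of y] by (cases "q y") auto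
    then show ?thesis by (simp add: MInf)
  qed
qed

text \<open>A local form of Minty's theorem: \<open>v + (\<rho> + 1) x\<close> covers a neighbourhood as \<open>(x, v)\<close> runs through
the graph near \<open>(x0, v0)\<close>. The point belonging to \<open>y\<close> is obtained by minimizing \<open>q\<close> minus the linear function
\<open>y\<close> plus a quadratic of curvature \<open>\<rho> + 1\<close> over a ball. For
\<open>y = v0 + (\<rho> + 1) x0\<close> this function grows quadratically away from \<open>x0\<close>, so for nearby \<open>y\<close> the minimizer stays in the interior and
yields a subgradient.\<close>

lemma subdiff_local_surjectivity:
  fixes q :: "'a::euclidean_space \<Rightarrow> ereal"
  assumes q: "lsc q" "\<And>x. q x \<noteq> -\<infinity>" and z0: "(x0, v0) \<in> gph (subdiff q)"
    and upi: "uniform_prox_ineq q \<rho> \<delta> (x0, v0)" and \<rho>: "\<rho> \<ge> 0" and \<delta>: "\<delta> > 0" and e: "e > 0"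
  obtains \<eta> where "\<eta> > 0" "\<And>y. norm (y - (v0 + (\<rho> + 1) *\<^sub>R x0)) < \<eta> \<Longrightarrow>
      \<exists>x v. (x, v) \<in> gph (subdiff q) \<and> v + (\<rho> + 1) *\<^sub>R x = y \<and> dist (x, v) (x0, v0) < e"
proof -
  define r where "r = \<rho> + 1"
  have r: "r \<ge> 1" using \<rho> by (simp add: r_def)
  \<comment> \<open>Minimizers move by at most \<open>2 \<eta>\<close>, and the subgradients by at most \<open>(1 + 2 r) \<eta>\<close>.\<close>
  define \<eta> where "\<eta> = min (\<delta> / 4) (e / (3 + 2 * r))"
  have \<eta>0: "\<eta> > 0" using \<delta> e r by (simp add: \<eta>_def)
  obtain c0 where c0: "q x0 = ereal c0" using gph_subdiff_finite[OF z0] by auto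
  have main: "\<exists>x v. (x, v) \<in> gph (subdiff q) \<and> v + r *\<^sub>R x = y \<and> dist (x, v) (x0, v0) < e"
    if y: "norm (y - (v0 + r *\<^sub>R x0)) < \<eta>" for y
  proof -
    define a where "a = (\<lambda>x. r / 2 * (x \<bullet> x) - y \<bullet> x)"
    have "lsc (\<lambda>x. ereal (a x) + q x)"
      unfolding a_def by (rule lsc_add_continuous[OF q]) (intro continuous_intros)
    then obtain x where x: "x \<in> cball x0 (\<delta> / 2)"
        and min: "\<And>x'. x' \<in> cball x0 (\<delta> / 2) \<Longrightarrow> ereal (a x) + q x \<le> ereal (a x') + q x'"
    proof (rule lsc_attains_inf)
      show "compact (cball x0 (\<delta> / 2))" "cball x0 (\<delta> / 2) \<noteq> {}" using \<delta> by simp_all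
    qed (rule that)
    have min0: "ereal (a x) + q x \<le> ereal (a x0) + q x0" using min[of x0] \<delta> by simp
    then obtain c where c: "q x = ereal c" using c0 q(2)[of x] by (cases "q x") auto
    have adiff: "a x' - a x'' = (r *\<^sub>R x'' - y) \<bullet> (x' - x'') + r / 2 * (norm (x' - x''))\<^sup>2" for x' x''
      unfolding a_def power2_norm_eq_inner
      by (simp add: inner_diff_left inner_diff_right inner_commute algebra_simps)
    have "q x0 + ereal (v0 \<bullet> (x - x0) - \<rho> / 2 * (norm (x - x0))\<^sup>2) \<le> q x"
      using upi z0 x \<delta> unfolding uniform_prox_ineq_def by simp
    then have "c0 + v0 \<bullet> (x - x0) - \<rho> / 2 * (norm (x - x0))\<^sup>2 \<le> c" by (simp add: c0 c)
    moreover have "c - c0 \<le> - (a x - a x0)" using min0 by (simp add: c0 c)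
    moreover have "(y - (v0 + r *\<^sub>R x0)) \<bullet> (x - x0)
        = - ((r *\<^sub>R x0 - y) \<bullet> (x - x0)) - v0 \<bullet> (x - x0)"
      by (simp add: inner_diff_left inner_add_left)
    moreover have "(y - (v0 + r *\<^sub>R x0)) \<bullet> (x - x0) \<le> norm (y - (v0 + r *\<^sub>R x0)) * norm (x - x0)"
      by (rule norm_cauchy_schwarz)
    moreover have "r / 2 * (norm (x - x0))\<^sup>2 = \<rho> / 2 * (norm (x - x0))\<^sup>2 + (norm (x - x0))\<^sup>2 / 2"
      by (simp add: r_def field_simps)
    ultimately have "(norm (x - x0))\<^sup>2 / 2 \<le> norm (y - (v0 + r *\<^sub>R x0)) * norm (x - x0)"
      unfolding adiff by linarith
    then have nx: "norm (x - x0) \<le> 2 * norm (y - (v0 + r *\<^sub>R x0))"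
      by (cases "norm (x - x0) = 0") (auto simp: power2_eq_square)
    \<comment> \<open>The minimizer lies in the interior of the ball, so the objective has a local minimum there, and \<open>v\<close> is minus the gradient of its smooth part.\<close>
    define v where "v = y - r *\<^sub>R x"
    have near: "norm (x - x0) < \<delta> / 2" using nx y by (simp add: \<eta>_def)
    have "v \<in> regular_subdiff q x"
      unfolding regular_subdiff_iff
    proof (intro conjI allI impI)
      show "\<bar>q x\<bar> \<noteq> \<infinity>" by (simp add: c)
      fix e' :: real assume e': "e' > 0"
      have "\<forall>\<^sub>F x' in at x. x' \<in> ball x0 (\<delta> / 2)"
        using near by (intro eventually_at_topological[THEN iffD2] exI[of _ "ball x0 (\<delta> / 2)"])
          (auto simp: dist_norm norm_minus_commute)
      moreover have "\<forall>\<^sub>F x' in at x. norm (x' - x) < 2 * e' / r"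
        using e' r by (auto simp: eventually_at dist_norm intro!: exI[of _ "2 * e' / r"])
      ultimately show "\<forall>\<^sub>F x' in at x. q x + ereal (v \<bullet> (x' - x) - e' * norm (x' - x)) \<le> q x'"
      proof eventually_elim
        case (elim x')
        have "r / 2 * (norm (x' - x))\<^sup>2 = (r / 2 * norm (x' - x)) * norm (x' - x)"
          by (simp add: power2_eq_square)
        also have "\<dots> \<le> e' * norm (x' - x)"
          using elim(2) r by (intro mult_right_mono) (auto simp: field_simps)
        finally have 1: "r / 2 * (norm (x' - x))\<^sup>2 \<le> e' * norm (x' - x)" .
        have 2: "v \<bullet> (x' - x) = - ((r *\<^sub>R x - y) \<bullet> (x' - x))" by (simp add: v_def inner_diff_left)
        have "ereal (a x) + q x \<le> ereal (a x') + q x'" using elim(1) by (intro min) simp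
        then show ?case using 1 2 adiff[of x' x] by (cases "q x'") (auto simp: c)
      qed
    qed
    then have "(x, v) \<in> gph (subdiff q)"
      using regular_subdiff_subset_subdiff by (auto simp: gph_def)
    moreover have "v + r *\<^sub>R x = y" by (simp add: v_def)
    moreover have "dist (x, v) (x0, v0) < e"
    proof -
      have "v - v0 = (y - (v0 + r *\<^sub>R x0)) - r *\<^sub>R (x - x0)" by (simp add: v_def scaleR_diff_right)
      then have "norm (v - v0) \<le> norm (y - (v0 + r *\<^sub>R x0)) + norm (r *\<^sub>R (x - x0))"
        by (simp only: norm_triangle_ineq4)
      also have "\<dots> \<le> norm (y - (v0 + r *\<^sub>R x0)) + r * (2 * norm (y - (v0 + r *\<^sub>R x0)))"
        using nx r by (simp add: mult_left_mono)
      finally have "norm (x - x0) + norm (v - v0) \<le> (3 + 2 * r) * norm (y - (v0 + r *\<^sub>R x0))"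
        using nx by (simp add: algebra_simps)
      also have "\<dots> < (3 + 2 * r) * \<eta>" using y r by (intro mult_strict_left_mono) auto
      also have "\<dots> \<le> (3 + 2 * r) * (e / (3 + 2 * r))"
        using r unfolding \<eta>_def by (intro mult_left_mono) auto
      also have "\<dots> = e" using r by simp
      finally show ?thesis using norm_Pair_le[of "x - x0" "v - v0"] by (simp add: dist_norm)
    qed
    ultimately show ?thesis by blast
  qed
  show ?thesis by (rule that[OF \<eta>0]) (use main in \<open>simp add: r_def\<close>)
qed

lemma uniform_prox_ineq_hypomonotone:
  assumes upi: "uniform_prox_ineq q \<rho> \<delta> z"
    and 1: "(x1, v1) \<in> gph (subdiff q) \<inter> ball z \<delta>" and 2: "(x2, v2) \<in> gph (subdiff q) \<inter> ball z \<delta>"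
  shows "- \<rho> * (norm (x1 - x2))\<^sup>2 \<le> (v1 - v2) \<bullet> (x1 - x2)"
proof -
  obtain c1 c2 where c: "q x1 = ereal c1" "q x2 = ereal c2"
    using gph_subdiff_finite[of x1 v1 q] gph_subdiff_finite[of x2 v2 q] 1 2 by auto
  have "x1 \<in> ball (fst z) \<delta>" "x2 \<in> ball (fst z) \<delta>"
    using 1 2 dist_fst_le[of z "(x1, v1)"] dist_fst_le[of z "(x2, v2)"] by auto
  then have "c1 + (v1 \<bullet> (x2 - x1) - \<rho> / 2 * (norm (x2 - x1))\<^sup>2) \<le> c2"
      "c2 + (v2 \<bullet> (x1 - x2) - \<rho> / 2 * (norm (x1 - x2))\<^sup>2) \<le> c1"
    using upi 1 2 unfolding uniform_prox_ineq_def by (metis c plus_ereal.simps(1) ereal_less_eq(3))+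
  then show ?thesis by (simp add: norm_minus_commute inner_diff_left inner_diff_right)
qed

lemma tangent_cone_hypomonotone:
  assumes upi: "uniform_prox_ineq q \<rho> \<delta> (x0, v0)" and \<delta>: "\<delta> > 0"
    and z0: "(x0, v0) \<in> gph (subdiff q)" and T: "(u, w) \<in> tangent_cone (gph (subdiff q)) (x0, v0)"
  shows "- \<rho> * (norm u)\<^sup>2 \<le> w \<bullet> u"
proof -
  obtain t U where t: "\<And>k. 0 < t k" "t \<longlonglongrightarrow> 0" and U: "U \<longlonglongrightarrow> (u, w)"
      and g: "\<And>k::nat. (x0, v0) + t k *\<^sub>R U k \<in> gph (subdiff q)"
    using T unfolding tangent_cone_def by auto
  have "(\<lambda>k. (x0, v0) + t k *\<^sub>R U k) \<longlonglongrightarrow> (x0, v0) + 0 *\<^sub>R (u, w)" by (intro tendsto_intros t U)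
  then have "\<forall>\<^sub>F k in sequentially. dist ((x0, v0) + t k *\<^sub>R U k) (x0, v0) < \<delta>"
    using tendstoD[OF _ \<delta>] by fastforce
  then have ev: "\<forall>\<^sub>F k in sequentially. - \<rho> * (norm (fst (U k)))\<^sup>2 \<le> snd (U k) \<bullet> fst (U k)"
  proof eventually_elim
    case (elim k)
    have "(x0 + t k *\<^sub>R fst (U k), v0 + t k *\<^sub>R snd (U k)) \<in> gph (subdiff q) \<inter> ball (x0, v0) \<delta>"
      using elim g[of k] by (cases "U k") (auto simp: dist_commute)
    from uniform_prox_ineq_hypomonotone[OF upi this, of x0 v0] z0 \<delta>
    have "(t k)\<^sup>2 * (- \<rho> * (norm (fst (U k)))\<^sup>2) \<le> (t k)\<^sup>2 * (snd (U k) \<bullet> fst (U k))"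
      using t(1)[of k] by (simp add: power_mult_distrib power2_eq_square mult_ac)
    then show ?case using t(1)[of k] by (simp only: mult_le_cancel_left_pos zero_less_power)
  qed
  have "(\<lambda>k. - \<rho> * (norm (fst (U k)))\<^sup>2) \<longlonglongrightarrow> - \<rho> * (norm (fst (u, w)))\<^sup>2"
       "(\<lambda>k. snd (U k) \<bullet> fst (U k)) \<longlonglongrightarrow> snd (u, w) \<bullet> fst (u, w)"
    by (intro tendsto_intros U)+
  from LIMSEQ_le[OF this] ev show ?thesis by (auto simp: eventually_sequentially)
qed

text \<open>The tangent cone only provides one sequence of step sizes for each of its elements. By local surjectivity,
for every \<open>t\<close> in the given sequence there is a graph point at which \<open>v + (\<rho> + 1) x\<close> has moved by
exactly \<open>t (w + (\<rho> + 1) u)\<close>. The quotients of its displacement by \<open>t\<close> are bounded, and all their cluster points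
are elements of the tangent cone with the same value of \<open>w + (\<rho> + 1) u\<close>; hypomonotonicity of
the subspace allows only one such element.\<close>

lemma tangent_cone_derivable:
  fixes q :: "'a::euclidean_space \<Rightarrow> ereal"
  assumes q: "lsc q" "\<And>x. q x \<noteq> -\<infinity>" and z0: "(x0, v0) \<in> gph (subdiff q)"
    and upi: "uniform_prox_ineq q \<rho> \<delta> (x0, v0)" and \<rho>: "\<rho> \<ge> 0" and \<delta>: "\<delta> > 0"
    and sub: "subspace (tangent_cone (gph (subdiff q)) (x0, v0))"
    and T: "(u, w) \<in> tangent_cone (gph (subdiff q)) (x0, v0)"
    and t: "\<And>k::nat. 0 < t k" "t \<longlonglongrightarrow> 0"
  obtains U where "U \<longlonglongrightarrow> (u, w)" "\<forall>\<^sub>F k in sequentially. (x0, v0) + t k *\<^sub>R U k \<in> gph (subdiff q)"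
proof -
  define r where "r = \<rho> + 1"
  have r: "r \<ge> 1" using \<rho> by (simp add: r_def)
  let ?T = "tangent_cone (gph (subdiff q)) (x0, v0)"
  define d where "d = w + r *\<^sub>R u"
  obtain \<eta> where \<eta>: "\<eta> > 0" "\<And>y. norm (y - (v0 + r *\<^sub>R x0)) < \<eta> \<Longrightarrow>
      \<exists>x v. (x, v) \<in> gph (subdiff q) \<and> v + r *\<^sub>R x = y \<and> dist (x, v) (x0, v0) < \<delta>"
    using subdiff_local_surjectivity[OF q z0 upi \<rho> \<delta> \<delta>] unfolding r_def by metis
  have "(\<lambda>k. t k *\<^sub>R d) \<longlonglongrightarrow> 0 *\<^sub>R d" by (intro tendsto_intros t)
  then have "\<forall>\<^sub>F k in sequentially. norm (t k *\<^sub>R d) < \<eta>"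
    using tendstoD[OF _ \<eta>(1), of "\<lambda>k. t k *\<^sub>R d" 0] by simp
  then obtain N where N: "\<And>k. k \<ge> N \<Longrightarrow> norm (t k *\<^sub>R d) < \<eta>" by (auto simp: eventually_sequentially)
  have "\<forall>k. \<exists>x v. k \<ge> N \<longrightarrow> (x, v) \<in> gph (subdiff q) \<and> v + r *\<^sub>R x = v0 + r *\<^sub>R x0 + t k *\<^sub>R d \<and> dist (x, v) (x0, v0) < \<delta>"
    using N \<eta>(2) by (metis add_diff_cancel_left')
  then obtain X V where XV: "\<And>k. k \<ge> N \<Longrightarrow> (X k, V k) \<in> gph (subdiff q)"
      "\<And>k. k \<ge> N \<Longrightarrow> V k + r *\<^sub>R X k = v0 + r *\<^sub>R x0 + t k *\<^sub>R d" "\<And>k. k \<ge> N \<Longrightarrow> dist (X k, V k) (x0, v0) < \<delta>"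
    by metis
  define a where "a = (\<lambda>k. (X k - x0) /\<^sub>R t k)"
  define U where "U = (\<lambda>k. (a k, d - r *\<^sub>R a k))"
  have U_gph: "(x0, v0) + t k *\<^sub>R U k \<in> gph (subdiff q)" if "k \<ge> N" for k
  proof -
    have "V k = v0 + r *\<^sub>R x0 + t k *\<^sub>R d - r *\<^sub>R X k" using XV(2)[OF that] by (metis add_diff_cancel_right')
    moreover have ta: "t k *\<^sub>R a k = X k - x0" using t(1)[of k] by (simp add: a_def)
    moreover have "t k *\<^sub>R (d - r *\<^sub>R a k) = t k *\<^sub>R d - r *\<^sub>R (X k - x0)"
      by (metis scaleR_diff_right scaleR_left_commute ta)
    ultimately have "(x0, v0) + t k *\<^sub>R U k = (X k, V k)"
      by (simp add: U_def scaleR_diff_right)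
    then show ?thesis using XV(1)[OF that] by simp
  qed
  have bnd: "norm (a k) \<le> norm d" if "k \<ge> N" for k
  proof -
    have tk: "t k > 0" by (rule t)
    have eq: "V k - v0 = t k *\<^sub>R d - r *\<^sub>R (X k - x0)"
      using XV(2)[OF that] by (simp add: algebra_simps)
    have "- \<rho> * (norm (X k - x0))\<^sup>2 \<le> (V k - v0) \<bullet> (X k - x0)"
      using XV(1,3)[OF that] z0 \<delta> by (intro uniform_prox_ineq_hypomonotone[OF upi]) (auto simp: dist_commute)
    then have "(norm (X k - x0))\<^sup>2 \<le> t k * (d \<bullet> (X k - x0))"
      unfolding eq r_def by (simp add: inner_diff_left inner_add_left power2_norm_eq_inner algebra_simps)
    also have "\<dots> \<le> t k * (norm d * norm (X k - x0))"
      using tk by (intro mult_left_mono norm_cauchy_schwarz) auto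
    finally have "norm (X k - x0) \<le> t k * norm d"
      by (cases "norm (X k - x0) = 0") (use tk in \<open>auto simp: power2_eq_square\<close>)
    moreover have "norm (a k) = norm (X k - x0) / t k" using tk by (simp add: a_def divide_inverse mult.commute)
    ultimately show ?thesis using tk by (simp add: pos_divide_le_eq mult.commute)
  qed
  have "a \<longlonglongrightarrow> u"
  proof (rule ccontr)
    assume "\<not> a \<longlonglongrightarrow> u"
    then obtain e s where e: "e > 0" "strict_mono (s :: nat \<Rightarrow> nat)" "\<And>k. e \<le> dist (a (s k)) u"
      using not_tendsto_subseq by metis
    \<comment> \<open>The quotients \<open>a\<close> are controlled from the index \<open>N\<close> on only.\<close>
    define s' where "s' = (\<lambda>k. s (k + N))"
    have s': "strict_mono s'" using e(2) by (simp add: s'_def strict_mono_def)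
    have s'N: "s' k \<ge> N" for k
      using strict_mono_imp_increasing[OF e(2), of "k + N"] by (simp add: s'_def)
    have "bounded (range (\<lambda>k. a (s' k)))" using bnd s'N by (auto simp: bounded_iff)
    then obtain u' p where p: "strict_mono (p :: nat \<Rightarrow> nat)" "((\<lambda>k. a (s' k)) \<circ> p) \<longlonglongrightarrow> u'"
      using bounded_imp_convergent_subsequence by blast
    have lim: "(\<lambda>k. a (s' (p k))) \<longlonglongrightarrow> u'" using p(2) by (simp add: o_def)
    have "(u', d - r *\<^sub>R u') \<in> ?T"
      unfolding tangent_cone_def
    proof (intro CollectI exI conjI allI)
      show "0 < t (s' (p k))" for k by (rule t)
      show "(\<lambda>k. t (s' (p k))) \<longlonglongrightarrow> 0"
        using LIMSEQ_subseq_LIMSEQ[OF t(2) strict_mono_o[OF s' p(1)]] by (simp add: o_def)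
      show "(\<lambda>k. U (s' (p k))) \<longlonglongrightarrow> (u', d - r *\<^sub>R u')" unfolding U_def by (intro tendsto_intros lim)
      show "(x0, v0) + t (s' (p k)) *\<^sub>R U (s' (p k)) \<in> gph (subdiff q)" for k by (rule U_gph[OF s'N])
    qed
    from subspace_diff[OF sub this T] have "(u' - u, - r *\<^sub>R (u' - u)) \<in> ?T"
      by (simp add: d_def algebra_simps)
    from tangent_cone_hypomonotone[OF upi \<delta> z0 this]
    have "(norm (u' - u))\<^sup>2 \<le> 0" by (simp add: r_def power2_norm_eq_inner algebra_simps)
    then have "u' = u" by simp
    then have "\<forall>\<^sub>F k in sequentially. dist (a (s' (p k))) u < e" using tendstoD[OF lim e(1)] by simp
    then show False using e(3) by (auto simp: eventually_sequentially s'_def not_less[symmetric])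
  qed
  then have "U \<longlonglongrightarrow> (u, d - r *\<^sub>R u)" unfolding U_def by (intro tendsto_intros)
  then have "U \<longlonglongrightarrow> (u, w)" by (simp add: d_def)
  moreover have "\<forall>\<^sub>F k in sequentially. (x0, v0) + t k *\<^sub>R U k \<in> gph (subdiff q)"
    using U_gph by (auto simp: eventually_sequentially)
  ultimately show ?thesis by (rule that)
qed

text \<open>Choosing the same step sizes for all vertices produces closed polygons of graph points that look
like \<open>a\<close> after rescaling. Along each of them the function values and the contribution of \<open>v0\<close>
telescope.\<close>

lemma tangent_cone_cyclic:
  fixes q :: "'a::euclidean_space \<Rightarrow> ereal"
  assumes q: "lsc q" "\<And>x. q x \<noteq> -\<infinity>" and z0: "(x0, v0) \<in> gph (subdiff q)"
    and upi: "uniform_prox_ineq q \<rho> \<delta> (x0, v0)" and \<rho>: "\<rho> \<ge> 0" and \<delta>: "\<delta> > 0"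
    and sub: "subspace (tangent_cone (gph (subdiff q)) (x0, v0))"
    and a: "\<And>i. a i \<in> tangent_cone (gph (subdiff q)) (x0, v0)" and cyc: "a N = a 0"
  shows "(\<Sum>i<N. snd (a i) \<bullet> (fst (a (Suc i)) - fst (a i)) - \<rho> / 2 * (norm (fst (a (Suc i)) - fst (a i)))\<^sup>2) \<le> 0"
proof -
  define t where "t = (\<lambda>k. inverse (real (Suc k)))"
  have t: "0 < t k" "t \<longlonglongrightarrow> 0" for k
    using LIMSEQ_inverse_real_of_nat by (auto simp: t_def)
  have "\<exists>U. U \<longlonglongrightarrow> b \<and> (\<forall>\<^sub>F k in sequentially. (x0, v0) + t k *\<^sub>R U k \<in> gph (subdiff q))"
    if "b \<in> tangent_cone (gph (subdiff q)) (x0, v0)" for b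
  proof -
    have "(fst b, snd b) \<in> tangent_cone (gph (subdiff q)) (x0, v0)" using that by simp
    from tangent_cone_derivable[OF q z0 upi \<rho> \<delta> sub this t] show ?thesis by auto
  qed
  then obtain S where "\<And>b. b \<in> tangent_cone (gph (subdiff q)) (x0, v0) \<Longrightarrow> S b \<longlonglongrightarrow> b \<and>
        (\<forall>\<^sub>F k in sequentially. (x0, v0) + t k *\<^sub>R S b k \<in> gph (subdiff q))"
    using choice[of "\<lambda>b U. b \<in> tangent_cone (gph (subdiff q)) (x0, v0) \<longrightarrow> U \<longlonglongrightarrow> b \<and>
        (\<forall>\<^sub>F k in sequentially. (x0, v0) + t k *\<^sub>R U k \<in> gph (subdiff q))"] by blast
  then have S: "\<And>b. b \<in> tangent_cone (gph (subdiff q)) (x0, v0) \<Longrightarrow> S b \<longlonglongrightarrow> b"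
      "\<And>b. b \<in> tangent_cone (gph (subdiff q)) (x0, v0) \<Longrightarrow>
        \<forall>\<^sub>F k in sequentially. (x0, v0) + t k *\<^sub>R S b k \<in> gph (subdiff q)"
    by blast+
  define u where "u = (\<lambda>i k. fst (S (a i) k))"
  define w where "w = (\<lambda>i k. snd (S (a i) k))"
  have ulim: "u i \<longlonglongrightarrow> fst (a i)" and wlim: "w i \<longlonglongrightarrow> snd (a i)" for i
    unfolding u_def w_def by (intro tendsto_intros S a)+
  define tm where "tm = (\<lambda>i k. w i k \<bullet> (u (Suc i) k - u i k) - \<rho> / 2 * (norm (u (Suc i) k - u i k))\<^sup>2)"
  have "(\<lambda>k. (x0, v0) + t k *\<^sub>R S (a i) k) \<longlonglongrightarrow> (x0, v0) + 0 *\<^sub>R a i" for i by (intro tendsto_intros t S a)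
  then have "\<forall>\<^sub>F k in sequentially. dist ((x0, v0) + t k *\<^sub>R S (a i) k) (x0, v0) < \<delta>" for i
    using tendstoD[OF _ \<delta>] by fastforce
  then have "\<forall>\<^sub>F k in sequentially. (x0, v0) + t k *\<^sub>R S (a i) k \<in> gph (subdiff q) \<inter> ball (x0, v0) \<delta>" for i
    using S(2)[OF a[of i]] by (rule eventually_elim2) (simp add: dist_commute)
  then have "\<forall>\<^sub>F k in sequentially. \<forall>i\<in>{..N}. (x0, v0) + t k *\<^sub>R S (a i) k \<in> gph (subdiff q) \<inter> ball (x0, v0) \<delta>"
    by (intro eventually_ball_finite) auto
  then have ev: "\<forall>\<^sub>F k in sequentially. (\<Sum>i<N. tm i k) \<le> 0"
  proof eventually_elim
    case (elim k)
    define x where "x = (\<lambda>i. x0 + t k *\<^sub>R u i k)"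
    define v where "v = (\<lambda>i. v0 + t k *\<^sub>R w i k)"
    have xv: "(x i, v i) \<in> gph (subdiff q) \<inter> ball (x0, v0) \<delta>" if "i \<le> N" for i
    proof -
      have "(x i, v i) = (x0, v0) + t k *\<^sub>R S (a i) k"
        by (simp add: x_def v_def u_def w_def prod_eq_iff)
      then show ?thesis using elim that by simp
    qed
    define Q where "Q = (\<lambda>i. real_of_ereal (q (x i)))"
    have Q: "q (x i) = ereal (Q i)" if "i \<le> N" for i
      unfolding Q_def using xv[OF that] gph_subdiff_finite[of "x i" "v i" q] by (simp add: ereal_real)
    have step: "t k * (v0 \<bullet> (u (Suc i) k - u i k)) + (t k)\<^sup>2 * tm i k \<le> Q (Suc i) - Q i" if "i < N" for i
    proof -
      have "x (Suc i) \<in> ball (fst (x0, v0)) \<delta>"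
        using xv[of "Suc i"] that dist_fst_le[of "(x0, v0)" "(x (Suc i), v (Suc i))"] by auto
      then have "q (x i) + ereal (v i \<bullet> (x (Suc i) - x i) - \<rho> / 2 * (norm (x (Suc i) - x i))\<^sup>2) \<le> q (x (Suc i))"
        using upi xv[of i] that unfolding uniform_prox_ineq_def by simp
      then have "v i \<bullet> (x (Suc i) - x i) - \<rho> / 2 * (norm (x (Suc i) - x i))\<^sup>2 \<le> Q (Suc i) - Q i"
        using Q[of i] Q[of "Suc i"] that by simp
      moreover have d: "x (Suc i) - x i = t k *\<^sub>R (u (Suc i) k - u i k)" by (simp add: x_def scaleR_diff_right)
      moreover have "v i \<bullet> (t k *\<^sub>R (u (Suc i) k - u i k)) = t k * (v0 \<bullet> (u (Suc i) k - u i k))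
          + (t k)\<^sup>2 * (w i k \<bullet> (u (Suc i) k - u i k))"
        by (simp only: v_def inner_add_left inner_scaleR_left inner_scaleR_right power2_eq_square) (simp add: algebra_simps)
      moreover have "(norm (t k *\<^sub>R (u (Suc i) k - u i k)))\<^sup>2 = (t k)\<^sup>2 * (norm (u (Suc i) k - u i k))\<^sup>2"
        by (simp add: power_mult_distrib)
      ultimately show ?thesis unfolding tm_def by (simp only: d) (simp add: right_diff_distrib mult_ac)
    qed
    have aN: "u N k = u 0 k" "Q N = Q 0" by (simp_all add: u_def Q_def x_def cyc)
    have "(\<Sum>i<N. t k * (v0 \<bullet> (u (Suc i) k - u i k)) + (t k)\<^sup>2 * tm i k) \<le> (\<Sum>i<N. Q (Suc i) - Q i)"
      by (intro sum_mono step) simp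
    also have "\<dots> = 0" by (simp add: sum_lessThan_telescope aN)
    finally have "t k * (v0 \<bullet> (\<Sum>i<N. u (Suc i) k - u i k)) + (t k)\<^sup>2 * (\<Sum>i<N. tm i k) \<le> 0"
      by (simp only: sum.distrib sum_distrib_left inner_sum_right)
    moreover have "(\<Sum>i<N. u (Suc i) k - u i k) = 0"
      using sum_lessThan_telescope[of "\<lambda>i. u i k" N] aN by simp
    ultimately have "(t k)\<^sup>2 * (\<Sum>i<N. tm i k) \<le> 0" by simp
    then show ?case using t(1)[of k] by (simp add: mult_le_0_iff)
  qed
  have "(\<lambda>k. \<Sum>i<N. tm i k) \<longlonglongrightarrow> (\<Sum>i<N. snd (a i) \<bullet> (fst (a (Suc i)) - fst (a i)) - \<rho> / 2 * (norm (fst (a (Suc i)) - fst (a i)))\<^sup>2)"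
    unfolding tm_def by (intro tendsto_intros ulim wlim)
  from LIMSEQ_le_const2[OF this] show ?thesis using ev by (auto simp: eventually_sequentially)
qed

text \<open>Apply the cyclic inequality to the regular \<open>N\<close>-gon \<open>cos \<theta> a1 + sin \<theta> a2\<close> in the plane of
\<open>a1 = (u1, w1)\<close> and \<open>a2 = (u2, w2)\<close>, and to the same polygon turned by a right angle.
Added term by term, the two sums no longer depend on the vertex: each step contributes
\<open>sin \<alpha>\<close> times the symplectic product, and an error of order \<open>1 - cos \<alpha>\<close>, where
\<open>\<alpha> = 2 pi / N\<close>. The error is negligible as \<open>N\<close> tends to infinity.\<close>

lemma tangent_cone_symplectic_le:
  fixes q :: "'a::euclidean_space \<Rightarrow> ereal"
  assumes q: "lsc q" "\<And>x. q x \<noteq> -\<infinity>" and z0: "(x0, v0) \<in> gph (subdiff q)"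
    and upi: "uniform_prox_ineq q \<rho> \<delta> (x0, v0)" and \<rho>: "\<rho> \<ge> 0" and \<delta>: "\<delta> > 0"
    and sub: "subspace (tangent_cone (gph (subdiff q)) (x0, v0))"
    and 1: "(u1, w1) \<in> tangent_cone (gph (subdiff q)) (x0, v0)"
    and 2: "(u2, w2) \<in> tangent_cone (gph (subdiff q)) (x0, v0)"
  shows "w1 \<bullet> u2 \<le> w2 \<bullet> u1"
proof -
  let ?T = "tangent_cone (gph (subdiff q)) (x0, v0)"
  define B where "B = w1 \<bullet> u1 + w2 \<bullet> u2 + \<rho> * ((norm u1)\<^sup>2 + (norm u2)\<^sup>2)"
  have key: "cos (pi / real (n + 2)) * (w1 \<bullet> u2 - w2 \<bullet> u1) \<le> sin (pi / real (n + 2)) * B" for n :: nat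
  proof -
    define N where "N = n + 2"
    \<comment> \<open>Half the angle of a step: \<open>1 - cos (2 \<beta>)\<close> and \<open>sin (2 \<beta>)\<close> share the positive factor \<open>2 sin \<beta>\<close>.\<close>
    define \<beta> where "\<beta> = pi / real N"
    define C where "C = (\<lambda>i. cos (real i * (2 * \<beta>)))"
    define S where "S = (\<lambda>i. sin (real i * (2 * \<beta>)))"
    define c where "c = (\<lambda>i. C i *\<^sub>R (u1, w1) + S i *\<^sub>R (u2, w2))"
    \<comment> \<open>The polygon \<open>c\<close> turned by a right angle: \<open>(a1, a2)\<close> is replaced by \<open>(a2, - a1)\<close>.\<close>
    define c' where "c' = (\<lambda>i. C i *\<^sub>R (u2, w2) - S i *\<^sub>R (u1, w1))"
    have "real N * (2 * \<beta>) = 2 * pi" by (simp add: \<beta>_def N_def)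
    then have cN: "c N = c 0" "c' N = c' 0" unfolding c_def c'_def C_def S_def by (simp_all only: of_nat_0 mult_zero_left cos_zero sin_zero cos_two_pi sin_two_pi)
    have inT: "c i \<in> ?T" "c' i \<in> ?T" for i
      unfolding c_def c'_def by (intro subspace_add subspace_diff subspace_scale sub 1 2)+
    note ineqs = tangent_cone_cyclic[where a = c, OF q z0 upi \<rho> \<delta> sub inT(1) cN(1)]
                 tangent_cone_cyclic[where a = c', OF q z0 upi \<rho> \<delta> sub inT(2) cN(2)]
    have terms: "(snd (c i) \<bullet> (fst (c (Suc i)) - fst (c i)) - \<rho> / 2 * (norm (fst (c (Suc i)) - fst (c i)))\<^sup>2)
        + (snd (c' i) \<bullet> (fst (c' (Suc i)) - fst (c' i)) - \<rho> / 2 * (norm (fst (c' (Suc i)) - fst (c' i)))\<^sup>2)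
        = sin (2 * \<beta>) * (w1 \<bullet> u2 - w2 \<bullet> u1) - (1 - cos (2 * \<beta>)) * B" for i
    proof -
      define X where "X = C (Suc i)"
      define Y where "Y = S (Suc i)"
      have k: "C i * C i + S i * S i = 1" "X * X + Y * Y = 1"
        unfolding X_def Y_def C_def S_def by (simp_all add: power2_eq_square[symmetric])
      have ar: "real (Suc i) * (2 * \<beta>) - real i * (2 * \<beta>) = 2 * \<beta>" by (simp add: algebra_simps)
      have k1: "C i * X + S i * Y = cos (2 * \<beta>)"
        using cos_diff[of "real (Suc i) * (2 * \<beta>)" "real i * (2 * \<beta>)"]
        unfolding ar X_def Y_def C_def S_def by (simp add: mult_ac)
      have k2: "C i * Y - S i * X = sin (2 * \<beta>)"
        using sin_diff[of "real (Suc i) * (2 * \<beta>)" "real i * (2 * \<beta>)"]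
        unfolding ar X_def Y_def C_def S_def by (simp add: mult_ac)
      have e1: "snd (c i) \<bullet> (fst (c (Suc i)) - fst (c i)) + snd (c' i) \<bullet> (fst (c' (Suc i)) - fst (c' i))
        = ((C i * X + S i * Y) - (C i * C i + S i * S i)) * (w1 \<bullet> u1 + w2 \<bullet> u2)
          + (C i * Y - S i * X) * (w1 \<bullet> u2 - w2 \<bullet> u1)"
        unfolding c_def c'_def X_def[symmetric] Y_def[symmetric]
        by (simp add: inner_add_left inner_diff_left inner_add_right inner_diff_right algebra_simps)
      have e2: "(norm (fst (c (Suc i)) - fst (c i)))\<^sup>2 + (norm (fst (c' (Suc i)) - fst (c' i)))\<^sup>2
        = ((X * X + Y * Y) + (C i * C i + S i * S i) - 2 * (C i * X + S i * Y)) * ((norm u1)\<^sup>2 + (norm u2)\<^sup>2)"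
        unfolding c_def c'_def X_def[symmetric] Y_def[symmetric] power2_norm_eq_inner
        by (simp add: inner_add_left inner_diff_left inner_add_right inner_diff_right inner_commute algebra_simps)
      have "(snd (c i) \<bullet> (fst (c (Suc i)) - fst (c i)) - \<rho> / 2 * (norm (fst (c (Suc i)) - fst (c i)))\<^sup>2)
        + (snd (c' i) \<bullet> (fst (c' (Suc i)) - fst (c' i)) - \<rho> / 2 * (norm (fst (c' (Suc i)) - fst (c' i)))\<^sup>2)
        = (cos (2 * \<beta>) - 1) * (w1 \<bullet> u1 + w2 \<bullet> u2) + sin (2 * \<beta>) * (w1 \<bullet> u2 - w2 \<bullet> u1)
          - \<rho> / 2 * ((1 + 1 - 2 * cos (2 * \<beta>)) * ((norm u1)\<^sup>2 + (norm u2)\<^sup>2))"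
      proof -
        have comb: "(m1 - \<rho> / 2 * n1) + (m2 - \<rho> / 2 * n2) = (m1 + m2) - \<rho> / 2 * (n1 + n2)" for m1 m2 n1 n2
          by (simp add: algebra_simps)
        show ?thesis unfolding comb e1 e2 k k1 k2 by (rule refl)
      qed
      then show ?thesis by (simp add: B_def algebra_simps)
    qed
    have "(\<Sum>i<N. sin (2 * \<beta>) * (w1 \<bullet> u2 - w2 \<bullet> u1) - (1 - cos (2 * \<beta>)) * B) \<le> 0"
      using add_nonpos_nonpos[OF ineqs] unfolding sum.distrib[symmetric] terms .
    then have "real N * (sin (2 * \<beta>) * (w1 \<bullet> u2 - w2 \<bullet> u1) - (1 - cos (2 * \<beta>)) * B) \<le> 0" by simp
    then have "sin (2 * \<beta>) * (w1 \<bullet> u2 - w2 \<bullet> u1) - (1 - cos (2 * \<beta>)) * B \<le> 0"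
      by (simp add: N_def mult_le_0_iff)
    moreover have "1 - cos (2 * \<beta>) = 2 * sin \<beta> * sin \<beta>" unfolding cos_double_sin by (simp add: power2_eq_square)
    moreover have "sin (2 * \<beta>) = 2 * sin \<beta> * cos \<beta>" by (rule sin_double)
    ultimately have "2 * sin \<beta> * (cos \<beta> * (w1 \<bullet> u2 - w2 \<bullet> u1)) \<le> 2 * sin \<beta> * (sin \<beta> * B)"
      by (simp only: mult.assoc diff_le_0_iff_le)
    moreover have "sin \<beta> > 0" by (rule sin_gt_zero) (auto simp: \<beta>_def N_def field_simps add_pos_nonneg)
    ultimately show ?thesis by (simp add: \<beta>_def N_def)
  qed
  have lim: "(\<lambda>n. pi / real (n + 2)) \<longlonglongrightarrow> 0"
    using LIMSEQ_ignore_initial_segment[OF lim_const_over_n[of pi], of 2] by simp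
  have "(\<lambda>n. cos (pi / real (n + 2)) * (w1 \<bullet> u2 - w2 \<bullet> u1)) \<longlonglongrightarrow> cos 0 * (w1 \<bullet> u2 - w2 \<bullet> u1)"
       "(\<lambda>n. sin (pi / real (n + 2)) * B) \<longlonglongrightarrow> sin 0 * B"
    by (intro tendsto_intros lim)+
  from LIMSEQ_le[OF this] key show ?thesis by auto
qed

text \<open>Isotropy with respect to the standard symplectic form. For n-dimensional subspaces these are the
Lagrangian subspaces.\<close>

definition isotropic :: "('a::real_inner \<times> 'a) set \<Rightarrow> bool" where
  "isotropic L \<longleftrightarrow> (\<forall>a\<in>L. \<forall>b\<in>L. snd a \<bullet> fst b = snd b \<bullet> fst a)"

lemma tangent_cone_isotropic:
  fixes q :: "'a::euclidean_space \<Rightarrow> ereal"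
  assumes q: "lsc q" "\<And>x. q x \<noteq> -\<infinity>" and z0: "z0 \<in> gph (subdiff q)"
    and upi: "uniform_prox_ineq q \<rho> \<delta> z0" and \<rho>: "\<rho> \<ge> 0" and \<delta>: "\<delta> > 0"
    and sub: "subspace (tangent_cone (gph (subdiff q)) z0)"
  shows "isotropic (tangent_cone (gph (subdiff q)) z0)"
proof -
  obtain x0 v0 where z: "z0 = (x0, v0)" by (cases z0)
  note le = tangent_cone_symplectic_le[OF q z0[unfolded z] upi[unfolded z] \<rho> \<delta> sub[unfolded z]]
  show ?thesis unfolding isotropic_def z using le by (auto intro!: antisym)
qed

section \<open>Isotropic subspaces and their representation by pairs of matrices\<close>

text \<open>An n-dimensional isotropic subspace is contained in its symplectic complement, which has dimension
\<open>2 n - n\<close>; so the two coincide.\<close>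

lemma isotropic_maximal:
  fixes L :: "((real^'n) \<times> (real^'n)) set"
  assumes L: "L \<in> Zn" and iso: "isotropic L" and z: "\<And>l. l \<in> L \<Longrightarrow> snd z \<bullet> fst l = snd l \<bullet> fst z"
  shows "z \<in> L"
proof -
  have sL: "subspace L" and dL: "dim L = CARD('n)" using L by (auto simp: Zn_def)
  \<comment> \<open>The symplectic complement of \<open>L\<close> is the orthogonal complement of its image under \<open>J\<close>.\<close>
  define J :: "(real^'n) \<times> (real^'n) \<Rightarrow> (real^'n) \<times> (real^'n)" where "J = (\<lambda>l. (snd l, - fst l))"
  have linJ: "linear J" by (rule linearI) (auto simp: J_def)
  have injJ: "inj J" by (auto simp: J_def inj_on_def prod_eq_iff)
  have sJL: "subspace (J ` L)" by (rule linear_subspace_image[OF linJ sL])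
  have dJL: "dim (J ` L) = CARD('n)" using dim_image_eq[OF linJ] injJ dL by (metis inj_on_subset subset_UNIV)
  define M where "M = {y. \<forall>x\<in>J ` L. orthogonal x y}"
  have M_iff: "y \<in> M \<longleftrightarrow> (\<forall>l\<in>L. snd y \<bullet> fst l = snd l \<bullet> fst y)" for y
    by (auto simp: M_def J_def orthogonal_def inner_prod_def inner_commute)
  have "dim M + CARD('n) = dim (UNIV :: ((real^'n) \<times> (real^'n)) set)"
    using dim_subspace_orthogonal_to_vectors[OF sJL subspace_UNIV] dJL by (simp add: M_def)
  then have dM: "dim M = CARD('n)" by simp
  have sM: "subspace M"
    unfolding M_def by (auto simp: subspace_def orthogonal_def inner_add_right)
  have "L \<subseteq> M" using iso by (auto simp: M_iff isotropic_def)
  then have "L = M" by (rule subspace_dim_equal[OF sL sM]) (simp add: dM dL)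
  then show ?thesis using z M_iff by blast
qed

lemma symmetric_matrixI:
  fixes A :: "real^'n^'n"
  assumes "\<And>x y. (A *v x) \<bullet> y = x \<bullet> (A *v y)"
  shows "transpose A = A"
proof -
  have "transpose A *v x = A *v x" for x
  proof -
    have "(transpose A *v x - A *v x) \<bullet> y = 0" for y
      using assms[of x y] by (simp add: inner_diff_left transpose_matrix_vector dot_lmul_matrix)
    then show ?thesis by (metis inner_eq_zero_iff right_minus_eq)
  qed
  then show ?thesis by (simp add: matrix_eq)
qed

lemma symmetric_matrixD:
  fixes A :: "real^'n^'n"
  assumes "transpose A = A"
  shows "(A *v x) \<bullet> y = x \<bullet> (A *v y)"
  using dot_lmul_matrix[of x A y] transpose_matrix_vector[of A x] assms by simp

text \<open>Let \<open>R\<close> be the first projection of \<open>L\<close> and \<open>P\<close> the orthogonal projection onto it. The fibre of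
\<open>L\<close> over \<open>0\<close> is the orthogonal complement of \<open>R\<close>, by isotropy and maximality. Hence over
each \<open>u \<in> R\<close> there is a unique second component in \<open>R\<close>, which depends linearly and
symmetrically on \<open>u\<close>. Adding to it the identity on the complement of \<open>R\<close> gives \<open>W\<close>.\<close>

lemma isotropic_imp_Zn_PW:
  fixes L :: "((real^'n) \<times> (real^'n)) set"
  assumes L: "L \<in> Zn" and iso: "isotropic L"
  shows "L \<in> Zn_PW"
proof -
  have sL: "subspace L" using L by (auto simp: Zn_def)
  define R where "R = fst ` L"
  have sR: "subspace R" unfolding R_def by (rule linear_subspace_image[OF linear_fst sL])
  define p where "p = orth_proj R"
  have linp: "linear p" unfolding p_def by (rule linear_orth_proj[OF sR])
  have pR: "p x \<in> R" for x unfolding p_def by (rule orth_proj_in[OF sR])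
  have pid: "x \<in> R \<Longrightarrow> p x = x" for x unfolding p_def by (rule orth_proj_id[OF sR])
  have psym: "p x \<bullet> y = x \<bullet> p y" for x y unfolding p_def by (rule orth_proj_self_adjoint[OF sR])
  have pperp: "(x - p x) \<bullet> y = 0" if "y \<in> R" for x y unfolding p_def by (rule orth_proj_orthogonal[OF sR that])
  have p0: "p x = 0" if "\<And>y. y \<in> R \<Longrightarrow> x \<bullet> y = 0" for x
    unfolding p_def using sR that by (intro orth_proj_eqI) (auto simp: subspace_0)
  have vert: "(0, x - p x) \<in> L" for x
    by (rule isotropic_maximal[OF L iso]) (use pperp in \<open>auto simp: R_def\<close>)
  define h where "h = (\<lambda>u. SOME w. (u, w) \<in> L)"
  have h: "(u, h u) \<in> L" if "u \<in> R" for u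
  proof -
    have "\<exists>w. (u, w) \<in> L" using that by (auto simp: R_def)
    then show ?thesis unfolding h_def by (rule someI_ex)
  qed
  have ph: "p (h u) = p w" if "(u, w) \<in> L" for u w
  proof -
    have "u \<in> R" using that by (force simp: R_def)
    from subspace_diff[OF sL h[OF this] that] have d: "(0, h u - w) \<in> L" by simp
    have "p (h u - w) = 0"
    proof (rule p0)
      fix y assume "y \<in> R"
      then obtain w' where "(y, w') \<in> L" by (auto simp: R_def)
      then show "(h u - w) \<bullet> y = 0" using iso d by (fastforce simp: isotropic_def)
    qed
    then show ?thesis using linp by (simp add: linear_diff)
  qed
  define W where "W = (\<lambda>x. p (h (p x)) + (x - p x))"
  have Wp: "(p x, W x) \<in> L" for x
  proof -
    have "(p x, h (p x)) + (0, x - p x) - (0, h (p x) - p (h (p x))) \<in> L"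
      by (intro subspace_add subspace_diff sL h pR vert)
    then show ?thesis by (simp add: W_def algebra_simps)
  qed
  have linW: "linear W"
  proof (rule linearI)
    fix x y and c :: real
    have "p (h (p (x + y))) = p (h (p x) + h (p y))"
      using subspace_add[OF sL h[OF pR[of x]] h[OF pR[of y]]] linp by (intro ph) (simp add: linear_add)
    then show "W (x + y) = W x + W y" using linp by (simp add: W_def linear_add)
    have "p (h (p (c *\<^sub>R x))) = p (c *\<^sub>R h (p x))"
      using subspace_scale[OF sL h[OF pR[of x]]] linp by (intro ph) (simp add: linear_scale)
    then show "W (c *\<^sub>R x) = c *\<^sub>R W x" using linp by (simp add: W_def linear_scale scaleR_right_diff_distrib scaleR_add_right)
  qed
  have Wsym: "W x \<bullet> y = x \<bullet> W y" for x y
  proof -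
    have "h (p x) \<bullet> p y = h (p y) \<bullet> p x" using iso h[OF pR[of x]] h[OF pR[of y]] by (fastforce simp: isotropic_def)
    then show ?thesis unfolding W_def using psym
      by (simp add: inner_add_left inner_add_right inner_diff_left inner_diff_right inner_commute)
  qed
  define P' where "P' = matrix p"
  define W' where "W' = matrix W"
  have P': "P' *v x = p x" and W': "W' *v x = W x" for x
    unfolding P'_def W'_def using linp linW by (simp_all add: matrix_works)
  have Wc: "W (x - p x) = x - p x" for x
  proof -
    have "p (x - p x) = 0" using linp pid[OF pR] by (simp add: linear_diff)
    moreover have "p (h 0) = 0"
    proof -
      have "(0, 0) \<in> L" using subspace_0[OF sL] by (simp add: zero_prod_def)
      from ph[OF this] show ?thesis using linp by (simp add: linear_0)
    qed
    ultimately show ?thesis by (simp add: W_def)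
  qed
  have "PW_pair P' W'"
    unfolding PW_pair_def
  proof (intro conjI)
    show "transpose P' = P'" "transpose W' = W'"
      by (rule symmetric_matrixI; simp add: P' W' psym Wsym)+
    show "P' ** P' = P'"
      by (simp add: matrix_eq matrix_vector_mul_assoc[symmetric] P' pid[OF pR])
    show "W' ** (mat 1 - P') = mat 1 - P'"
      by (simp add: matrix_eq matrix_vector_mul_assoc[symmetric] matrix_vector_mult_diff_rdistrib P' W' Wc)
  qed
  moreover have "L = rge P' W'"
  proof
    show "rge P' W' \<subseteq> L" using Wp by (auto simp: rge_def P' W')
    show "L \<subseteq> rge P' W'"
    proof
      fix l assume l: "l \<in> L"
      obtain u w where uw: "l = (u, w)" by (cases l)
      \<comment> \<open>The component of \<open>w\<close> orthogonal to \<open>R\<close> is invisible to \<open>P\<close> and reproduced by \<open>W\<close>.\<close>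
      define s where "s = u + (w - p w)"
      have uR: "u \<in> R" using l uw by (force simp: R_def)
      have ps: "p s = u" using linp pid[OF uR] pid[OF pR] by (simp add: s_def linear_add linear_diff)
      moreover have "W s = w" using ph l uw unfolding W_def ps by (simp add: s_def)
      ultimately show "l \<in> rge P' W'" by (auto simp: rge_def P' W' uw intro!: image_eqI[of _ _ s])
    qed
  qed
  ultimately show ?thesis using L unfolding Zn_PW_def by blast
qed

lemma isotropic_closed:
  fixes L :: "nat \<Rightarrow> ('a::euclidean_space \<times> 'a) set"
  assumes lim: "(\<lambda>k. subspace_dist M (L k)) \<longlonglongrightarrow> 0" and M: "subspace M" and L: "\<And>k. subspace (L k)"
    and iso: "\<And>k. isotropic (L k)"
  shows "isotropic M"
  unfolding isotropic_def
proof (intro ballI)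
  fix a b assume ab: "a \<in> M" "b \<in> M"
  have la: "(\<lambda>k. orth_proj (L k) c) \<longlonglongrightarrow> c" if "c \<in> M" for c
    using subspace_dist_tendsto_imp_orth_proj[OF lim M L, of c] orth_proj_id[OF M that] by simp
  have "(\<lambda>k. snd (orth_proj (L k) a) \<bullet> fst (orth_proj (L k) b)) \<longlonglongrightarrow> snd a \<bullet> fst b"
       "(\<lambda>k. snd (orth_proj (L k) b) \<bullet> fst (orth_proj (L k) a)) \<longlonglongrightarrow> snd b \<bullet> fst a"
    by (intro tendsto_intros la ab)+
  moreover have "snd (orth_proj (L k) a) \<bullet> fst (orth_proj (L k) b) = snd (orth_proj (L k) b) \<bullet> fst (orth_proj (L k) a)" for k
    using iso[of k] orth_proj_in[OF L] unfolding isotropic_def by blast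
  ultimately show "snd a \<bullet> fst b = snd b \<bullet> fst a" by (simp add: LIMSEQ_unique)
qed

section \<open>The SC derivative and shears\<close>

lemma SC_point_deriv:
  assumes "z \<in> SC_points G"
  shows "tangent_cone (gph G) z \<in> SC_deriv G z"
proof -
  have "subspace_dist (tangent_cone (gph G) z) (tangent_cone (gph G) z) = 0"
    by (simp add: subspace_dist_def onorm_zero)
  then have "(\<lambda>_::nat. subspace_dist (tangent_cone (gph G) z) (tangent_cone (gph G) z)) \<longlonglongrightarrow> 0" by simp
  then show ?thesis using assms unfolding SC_deriv_def
    by (intro CollectI conjI exI[of _ "\<lambda>_. z"]) (auto simp: SC_points_def)
qed

text \<open>By definition the subspaces \<open>L k\<close> are limits of tangent cones; for each \<open>k\<close> take one of these within
\<open>1 / (k + 1)\<close>, both in base point and in gap, and use the triangle inequality of the gap metric.\<close>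

lemma SC_deriv_closed:
  assumes M: "M \<in> Zn" and L: "\<And>k. L k \<in> SC_deriv G (z k)" and z: "z \<longlonglongrightarrow> z0"
    and lim: "(\<lambda>k. subspace_dist M (L k)) \<longlonglongrightarrow> 0"
  shows "M \<in> SC_deriv G z0"
proof -
  have "\<exists>y. y \<in> SC_points G \<and> dist y (z k) < inverse (real (Suc k)) \<and>
      subspace_dist (L k) (tangent_cone (gph G) y) < inverse (real (Suc k))" for k
  proof -
    obtain Z where Z: "\<And>j. Z j \<in> SC_points G" "Z \<longlonglongrightarrow> z k"
        "(\<lambda>j. subspace_dist (L k) (tangent_cone (gph G) (Z j))) \<longlonglongrightarrow> 0"
      using L[of k] unfolding SC_deriv_def by blast
    have e: "0 < inverse (real (Suc k))" by simp
    have "\<forall>\<^sub>F j in sequentially. dist (Z j) (z k) < inverse (real (Suc k)) \<and>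
        subspace_dist (L k) (tangent_cone (gph G) (Z j)) < inverse (real (Suc k))"
      by (intro eventually_conj tendstoD[OF Z(2) e] order_tendstoD(2)[OF Z(3) e])
    then obtain j where "dist (Z j) (z k) < inverse (real (Suc k)) \<and>
        subspace_dist (L k) (tangent_cone (gph G) (Z j)) < inverse (real (Suc k))"
      by (auto simp: eventually_sequentially)
    then show ?thesis using Z(1) by blast
  qed
  then obtain y where y: "\<And>k. y k \<in> SC_points G" "\<And>k. dist (y k) (z k) < inverse (real (Suc k))"
      "\<And>k. subspace_dist (L k) (tangent_cone (gph G) (y k)) < inverse (real (Suc k))"
    by metis
  have sub: "subspace M" "subspace (L k)" "subspace (tangent_cone (gph G) (y k))" for k
    using M L[of k] y(1)[of k] by (auto simp: Zn_def SC_deriv_def SC_points_def)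
  have "(\<lambda>k. inverse (real (Suc k)) + dist (z k) z0) \<longlonglongrightarrow> 0 + dist z0 z0"
    by (intro tendsto_intros z LIMSEQ_inverse_real_of_nat)
  then have lim1: "(\<lambda>k. inverse (real (Suc k)) + dist (z k) z0) \<longlonglongrightarrow> 0" by simp
  have "y \<longlonglongrightarrow> z0"
  proof (rule metric_tendsto_imp_tendsto[OF lim1], intro always_eventually allI)
    fix k show "dist (y k) z0 \<le> dist (inverse (real (Suc k)) + dist (z k) z0) 0"
      using dist_triangle[of "y k" z0 "z k"] y(2)[of k] by simp
  qed
  moreover have "(\<lambda>k. subspace_dist M (tangent_cone (gph G) (y k))) \<longlonglongrightarrow> 0"
  proof (rule Lim_null_comparison)
    show "(\<lambda>k. subspace_dist M (L k) + inverse (real (Suc k))) \<longlonglongrightarrow> 0"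
      using tendsto_add[OF lim LIMSEQ_inverse_real_of_nat] by simp
    show "\<forall>\<^sub>F k in sequentially. norm (subspace_dist M (tangent_cone (gph G) (y k)))
        \<le> subspace_dist M (L k) + inverse (real (Suc k))"
    proof (intro always_eventually allI)
      fix k
      show "norm (subspace_dist M (tangent_cone (gph G) (y k))) \<le> subspace_dist M (L k) + inverse (real (Suc k))"
        using subspace_dist_triangle[OF sub(1) sub(2)[of k] sub(3)[of k]] subspace_dist_nonneg[OF sub(1,3), of k] y(3)[of k] by simp
    qed
  qed
  ultimately show ?thesis using M y(1) unfolding SC_deriv_def by blast
qed

text \<open>The derivative of \<open>(x, v) \<mapsto> (x, v + grad f x)\<close> is of this form, with \<open>A\<close> the Hessian.\<close>

definition shear :: "real^'n^'n \<Rightarrow> (real^'n) \<times> (real^'n) \<Rightarrow> (real^'n) \<times> (real^'n)" where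
  "shear A z = (fst z, snd z + A *v fst z)"

lemma linear_shear: "linear (shear A)"
  by (rule linearI) (auto simp: shear_def matrix_vector_right_distrib matrix_vector_mult_scaleR scaleR_add_right)

lemma shear_inverse: "shear (- A) (shear A z) = z" "shear A (shear (- A) z) = z"
proof -
  have "(- A) *v x = - (A *v x)" for x by (simp add: vec_eq_iff matrix_vector_mult_def sum_negf)
  then show "shear (- A) (shear A z) = z" "shear A (shear (- A) z) = z" by (simp_all add: shear_def)
qed

lemma shear_image_Zn:
  assumes "L \<in> Zn"
  shows "shear A ` L \<in> Zn"
proof -
  have "inj_on (shear A) (span L)" by (rule inj_on_inverseI) (rule shear_inverse(1))
  then have "dim (shear A ` L) = dim L" by (rule dim_image_eq[OF linear_shear])
  then show ?thesis using assms linear_subspace_image[OF linear_shear, of L A] by (auto simp: Zn_def)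
qed

text \<open>A shear by a symmetric matrix preserves the symplectic form.\<close>

lemma isotropic_shear_iff:
  assumes "transpose A = A"
  shows "isotropic (shear A ` L) \<longleftrightarrow> isotropic L"
proof -
  have "(snd a + A *v fst a) \<bullet> fst b = (snd b + A *v fst b) \<bullet> fst a \<longleftrightarrow> snd a \<bullet> fst b = snd b \<bullet> fst a" for a b
    using symmetric_matrixD[OF assms, of "fst a" "fst b"]
    by (auto simp: inner_add_left inner_add_right inner_commute)
  then show ?thesis by (simp add: isotropic_def shear_def)
qed

section \<open>The quadratic program of the Newton step\<close>

text \<open>A regular subgradient at \<open>x \<in> R\<close> is nonpositive to first order along \<open>d\<close> and along \<open>- d\<close>
for each \<open>d \<in> R\<close>. The normal space does not depend on the base point, so limits give nothing new.\<close>

lemma subdiff_indicator_subspace: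
  fixes R :: "'a::euclidean_space set"
  assumes R: "subspace R"
  shows "v \<in> subdiff (indicator_fun R) s \<longleftrightarrow> s \<in> R \<and> (\<forall>d\<in>R. v \<bullet> d = 0)"
proof -
  have reg: "v \<in> regular_subdiff (indicator_fun R) x \<longleftrightarrow> x \<in> R \<and> (\<forall>d\<in>R. v \<bullet> d = 0)" for v x
  proof
    assume v: "v \<in> regular_subdiff (indicator_fun R) x"
    then have x: "x \<in> R" by (auto simp: regular_subdiff_def indicator_fun_def split: if_splits)
    have le: "v \<bullet> d \<le> e" if d: "d \<in> R" and e: "e > 0" for d e
    proof (cases "d = 0")
      case False
      define e' where "e' = e / norm d"
      have e': "e' > 0" using e False by (simp add: e'_def)
      have "\<forall>\<^sub>F x' in at x. indicator_fun R x + ereal (v \<bullet> (x' - x) - e' * norm (x' - x)) \<le> indicator_fun R x'"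
        using v e' unfolding regular_subdiff_iff by blast
      then obtain r where r: "r > 0" "\<And>x'. x' \<noteq> x \<Longrightarrow> dist x' x < r \<Longrightarrow>
          indicator_fun R x + ereal (v \<bullet> (x' - x) - e' * norm (x' - x)) \<le> indicator_fun R x'"
        unfolding eventually_at by blast
      define t where "t = r / (2 * norm d)"
      have t: "t > 0" using r False by (simp add: t_def)
      have "x + t *\<^sub>R d \<in> R" using R x d by (simp add: subspace_add subspace_scale)
      moreover have "dist (x + t *\<^sub>R d) x < r" using r False t by (simp add: dist_norm t_def)
      moreover have "x + t *\<^sub>R d \<noteq> x" using t False by simp
      ultimately have "v \<bullet> (t *\<^sub>R d) - e' * norm (t *\<^sub>R d) \<le> 0"
        using r(2)[of "x + t *\<^sub>R d"] x by (simp add: indicator_fun_def)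
      then have "t * (v \<bullet> d) \<le> t * e" using t False by (simp add: e'_def)
      then show ?thesis using t by simp
    qed (use e in simp)
    have le0: "v \<bullet> d \<le> 0" if "d \<in> R" for d using le[OF that] field_le_epsilon[of "v \<bullet> d" 0] by simp
    have "v \<bullet> d = 0" if "d \<in> R" for d
      using le0[OF that] le0[of "- d"] subspace_neg[OF R that] by simp
    then show "x \<in> R \<and> (\<forall>d\<in>R. v \<bullet> d = 0)" using x by blast
  next
    assume xv: "x \<in> R \<and> (\<forall>d\<in>R. v \<bullet> d = 0)"
    show "v \<in> regular_subdiff (indicator_fun R) x"
      unfolding regular_subdiff_iff
    proof (intro conjI allI impI always_eventually)
      show "\<bar>indicator_fun R x\<bar> \<noteq> \<infinity>" using xv by (simp add: indicator_fun_def)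
      fix e :: real and x' assume e: "e > 0"
      show "indicator_fun R x + ereal (v \<bullet> (x' - x) - e * norm (x' - x)) \<le> indicator_fun R x'"
      proof (cases "x' \<in> R")
        case True
        then have "v \<bullet> (x' - x) = 0" using xv R by (simp add: subspace_diff)
        then show ?thesis using True xv e by (simp add: indicator_fun_def)
      qed (simp add: indicator_fun_def)
    qed
  qed
  show ?thesis
  proof
    assume "v \<in> subdiff (indicator_fun R) s"
    then obtain X V where s: "\<bar>indicator_fun R s\<bar> \<noteq> \<infinity>"
        and V: "V \<longlonglongrightarrow> v" "\<And>k. V k \<in> regular_subdiff (indicator_fun R) (X k)"
      unfolding subdiff_def by auto
    have "v \<bullet> d = 0" if "d \<in> R" for d
    proof -
      have "(\<lambda>k. V k \<bullet> d) \<longlonglongrightarrow> v \<bullet> d" by (intro tendsto_intros V)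
      then show ?thesis using V(2) that by (simp add: reg LIMSEQ_const_iff)
    qed
    then show "s \<in> R \<and> (\<forall>d\<in>R. v \<bullet> d = 0)" using s by (auto simp: indicator_fun_def split: if_splits)
  next
    assume "s \<in> R \<and> (\<forall>d\<in>R. v \<bullet> d = 0)"
    then show "v \<in> subdiff (indicator_fun R) s" using reg regular_subdiff_subset_subdiff by blast
  qed
qed

lemma quadratic_gderiv:
  fixes A :: "real^'n^'n"
  assumes "transpose A = A"
  shows "GDERIV (\<lambda>s. 1 / 2 * (s \<bullet> (A *v s)) + y \<bullet> s) s :> A *v s + y"
proof -
  have bl: "bounded_linear ((*v) A)" by (rule matrix_vector_mul_bounded_linear)
  have "((\<lambda>s. 1 / 2 * (s \<bullet> (A *v s)) + y \<bullet> s) has_derivative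
      (\<lambda>h. 1 / 2 * (s \<bullet> (A *v h) + h \<bullet> (A *v s)) + y \<bullet> h)) (at s)"
    by (auto intro!: derivative_eq_intros bounded_linear.has_derivative[OF bl])
  moreover have "1 / 2 * (s \<bullet> (A *v h) + h \<bullet> (A *v s)) + y \<bullet> h = h \<bullet> (A *v s + y)" for h
    using symmetric_matrixD[OF assms, of s h] by (simp add: inner_add_right inner_commute)
  ultimately show ?thesis by (simp add: gderiv_def)
qed

text \<open>By the sum rule, stationarity means that \<open>s\<close> lies in the range of \<open>P\<close> and that the gradient of the
objective is annihilated by \<open>P\<close>. The properties of the pair make \<open>W\<close> commute with \<open>P\<close> and act as the
identity on the kernel of \<open>P\<close>. Every vector of that kernel is therefore available as a correction
of the second component, so that the equation tested on the range of \<open>P\<close> becomes a full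
membership in the sheared subspace.\<close>

lemma direction_choice_iff:
  fixes P W :: "real^'n^'n"
  assumes PW: "PW_pair P W" and H: "transpose (hessian f xh) = hessian f xh"
  shows "direction_choice f xh yh P W s \<longleftrightarrow> (s, - yh) \<in> shear (hessian f xh) ` rge P W"
proof -
  let ?H = "hessian f xh"
  let ?A = "P ** ?H ** P + W"
  have P: "transpose P = P" and W: "transpose W = W" and PP: "P ** P = P"
    and WP: "W ** (mat 1 - P) = mat 1 - P" using PW by (auto simp: PW_pair_def)
  have PPx: "P *v (P *v x) = P *v x" for x using PP by (simp add: matrix_vector_mul_assoc)
  have "W *v ((mat 1 - P) *v x) = (mat 1 - P) *v x" for x using WP by (simp add: matrix_vector_mul_assoc)
  then have Wc: "W *v (x - P *v x) = x - P *v x" for x by (simp add: matrix_vector_mult_diff_rdistrib)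
  then have Wx: "W *v x = W *v (P *v x) + (x - P *v x)" for x
    by (metis add.commute diff_add_cancel matrix_vector_right_distrib)
  have Psym: "(P *v x) \<bullet> y = x \<bullet> (P *v y)" and Wsym: "(W *v x) \<bullet> y = x \<bullet> (W *v y)"
    and Hsym: "(?H *v x) \<bullet> y = x \<bullet> (?H *v y)" for x y
    by (intro symmetric_matrixD P W H)+
  have comm: "P *v (W *v x) = W *v (P *v x)" for x
  proof -
    have "(P *v (W *v x) - W *v (P *v x)) \<bullet> y = 0" for y
    proof -
      have "(W *v (x - P *v x)) \<bullet> (P *v y) = 0"
        unfolding Wc by (simp add: inner_diff_left Psym PPx)
      moreover have "(x - P *v x) \<bullet> (W *v (P *v y)) = (W *v (x - P *v x)) \<bullet> (P *v y)" by (simp add: Wsym)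
      moreover have "(P *v x) \<bullet> (W *v (y - P *v y)) = 0"
        unfolding Wc by (simp add: inner_diff_right Psym PPx)
      ultimately show ?thesis
        by (simp add: inner_diff_left inner_diff_right Psym Wsym matrix_vector_mult_diff_distrib)
    qed
    then show ?thesis by (metis inner_eq_zero_iff right_minus_eq)
  qed
  have A: "transpose ?A = ?A"
    by (rule symmetric_matrixI)
      (simp add: matrix_vector_mult_add_rdistrib matrix_vector_mul_assoc[symmetric] inner_add_left inner_add_right Psym Hsym Wsym)
  have Ax: "?A *v x = P *v (?H *v (P *v x)) + W *v x" for x
    by (simp add: matrix_vector_mult_add_rdistrib matrix_vector_mul_assoc[symmetric])
  have sR: "subspace (range ((*v) P))"
    by (rule linear_subspace_image[OF matrix_vector_mul_linear subspace_UNIV])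
  have "direction_choice f xh yh P W s \<longleftrightarrow> 0 - (?A *v s + yh) \<in> subdiff (indicator_fun (range ((*v) P))) s"
    unfolding direction_choice_def newton_objective_def
    by (rule subdiff_add_smooth[OF quadratic_gderiv[OF A]])
      (intro continuous_intros linear_continuous_on matrix_vector_mul_bounded_linear)
  also have "\<dots> \<longleftrightarrow> s \<in> range ((*v) P) \<and> (\<forall>x. (0 - (?A *v s + yh)) \<bullet> (P *v x) = 0)"
    unfolding subdiff_indicator_subspace[OF sR] by blast
  also have "\<dots> \<longleftrightarrow> P *v s = s \<and> P *v (?A *v s + yh) = 0"
  proof -
    have "(\<forall>x. (0 - (?A *v s + yh)) \<bullet> (P *v x) = 0) \<longleftrightarrow> (\<forall>x. (P *v (?A *v s + yh)) \<bullet> x = 0)"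
    proof -
      have "(0 - z) \<bullet> (P *v x) = - ((P *v z) \<bullet> x)" for z x by (simp add: Psym)
      then show ?thesis by (simp only: neg_equal_0_iff_equal)
    qed
    also have "\<dots> \<longleftrightarrow> P *v (?A *v s + yh) = 0" by (metis inner_eq_zero_iff inner_zero_left)
    finally show ?thesis using PPx by (metis (no_types, lifting) imageE rangeI)
  qed
  also have "\<dots> \<longleftrightarrow> (s, - yh) \<in> shear ?H ` rge P W"
  proof
    assume s: "P *v s = s \<and> P *v (?A *v s + yh) = 0"
    define r where "r = ?H *v s + W *v s + yh"
    \<comment> \<open>Here \<open>r\<close> is the residual of the full equation. It lies in the kernel of \<open>P\<close>, so subtracting it from \<open>s\<close> does not change the image under \<open>P\<close> and subtracts it from the image under \<open>W\<close>.\<close>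
    define p where "p = s - (r - P *v r)"
    have Pr: "P *v r = 0"
      using conjunct2[OF s] by (simp add: r_def Ax matrix_vector_right_distrib PPx conjunct1[OF s])
    have Pp: "P *v p = s" using s Pr by (simp add: p_def matrix_vector_mult_diff_distrib)
    have "W *v p = W *v s - r" using Wc[of r] Pr by (simp add: p_def matrix_vector_mult_diff_distrib)
    then have "shear ?H (P *v p, W *v p) = (s, - yh)"
      by (simp add: shear_def Pp r_def)
    then show "(s, - yh) \<in> shear ?H ` rge P W" unfolding rge_def by (rule image_eqI[OF sym rangeI])
  next
    assume "(s, - yh) \<in> shear ?H ` rge P W"
    then obtain p where p: "s = P *v p" "- yh = W *v p + ?H *v (P *v p)"
      by (auto simp: rge_def shear_def)
    then have yh: "yh = - (W *v p + ?H *v (P *v p))" by (metis minus_minus)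
    have neg: "P *v (- x) = - (P *v x)" for x by (simp add: linear_neg[OF matrix_vector_mul_linear])
    show "P *v s = s \<and> P *v (?A *v s + yh) = 0"
      by (simp add: p(1) yh PPx Ax comm neg matrix_vector_right_distrib matrix_vector_mult_diff_distrib)
  qed
  finally show ?thesis .
qed

text \<open>The second projection is injective on a regular subspace, hence onto by dimension.\<close>

lemma regular_subspace_solvable:
  fixes L :: "((real^'n) \<times> (real^'n)) set"
  assumes "L \<in> Zn_reg"
  shows "\<exists>s. (s, y) \<in> L"
proof -
  have sL: "subspace L" and dL: "dim L = CARD('n)" and reg: "\<And>u. (u, 0) \<in> L \<Longrightarrow> u = 0"
    using assms by (auto simp: Zn_reg_def Zn_def)
  have "inj_on snd L"
  proof (rule inj_onI)
    fix a b assume ab: "a \<in> L" "b \<in> L" "snd a = snd b"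
    have "a - b = (fst a - fst b, 0)" using ab(3) by (simp add: prod_eq_iff)
    then have "(fst a - fst b, 0) \<in> L" using subspace_diff[OF sL ab(1,2)] by simp
    then have "fst a - fst b = 0" by (rule reg)
    then show "a = b" using ab(3) by (simp add: prod_eq_iff)
  qed
  then have "dim (snd ` L) = dim L"
    using sL by (intro dim_image_eq[OF linear_snd]) (simp add: span_eq_iff[THEN iffD2])
  then have "span (snd ` L) = UNIV" using dL by (intro dim_eq_full[THEN iffD1]) simp
  then have "snd ` L = UNIV"
    using linear_subspace_image[OF linear_snd sL] by (simp add: span_eq_iff[THEN iffD2])
  then have "y \<in> snd ` L" by blast
  then show ?thesis by force
qed

section \<open>The sum of a smooth and a lower semicontinuous function\<close>

locale composite =
  fixes f :: "real^'n \<Rightarrow> real" and g \<phi> :: "real^'n \<Rightarrow> ereal"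
  assumes phi: "\<phi> = (\<lambda>x. ereal (f x) + g x)"
    and f: "twice_continuously_differentiable f"
    and g_proper: "proper g" and g_lsc: "lsc g"
begin

lemma gderiv_f: "GDERIV f x :> grad f x"
  using f by (intro GDERIV_grad) (simp add: twice_continuously_differentiable_def)

lemma grad_has_derivative: "(grad f has_derivative (\<lambda>u. hessian f x *v u)) (at x)"
  using f jacobian_works[of "grad f" "at x"]
  by (simp add: twice_continuously_differentiable_def hessian_def)

lemma isCont_grad: "isCont (grad f) x"
  by (rule has_derivative_continuous[OF grad_has_derivative])

lemma tendsto_grad: "(X \<longlongrightarrow> x) F \<Longrightarrow> ((\<lambda>k. grad f (X k)) \<longlongrightarrow> grad f x) F"
  by (rule isCont_tendsto_compose[OF isCont_grad])

lemma isCont_hessian: "isCont (hessian f) x"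
  using f by (simp add: twice_continuously_differentiable_def continuous_on_eq_continuous_at)

lemma tendsto_hessian: "(X \<longlongrightarrow> x) F \<Longrightarrow> ((\<lambda>k. hessian f (X k)) \<longlongrightarrow> hessian f x) F"
  by (rule isCont_tendsto_compose[OF isCont_hessian])

lemma hessian_symmetric: "transpose (hessian f x) = hessian f x"
  by (rule symmetric_matrixI) (rule gradient_derivative_symmetric[OF gderiv_f grad_has_derivative])

lemma phi_lsc: "lsc \<phi>" and phi_not_MInf: "\<phi> x \<noteq> -\<infinity>"
proof -
  have g: "g x \<noteq> -\<infinity>" for x using g_proper by (simp add: proper_def)
  have "isCont f x" for x using gderiv_f[of x] has_derivative_continuous unfolding gderiv_def by blast
  then show "lsc \<phi>" unfolding phi by (intro lsc_add_continuous g_lsc g)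
  show "\<phi> x \<noteq> -\<infinity>" using g[of x] by (cases "g x") (auto simp: phi)
qed

definition lift :: "(real^'n) \<times> (real^'n) \<Rightarrow> (real^'n) \<times> (real^'n)" where
  "lift z = (fst z, snd z + grad f (fst z))"

definition unlift :: "(real^'n) \<times> (real^'n) \<Rightarrow> (real^'n) \<times> (real^'n)" where
  "unlift z = (fst z, snd z - grad f (fst z))"

lemma lift_unlift [simp]: "lift (unlift z) = z" "unlift (lift z) = z" "fst (lift z) = fst z" "fst (unlift z) = fst z"
  by (simp_all add: lift_def unlift_def)

lemma gph_phi_iff: "z \<in> gph (subdiff \<phi>) \<longleftrightarrow> unlift z \<in> gph (subdiff g)"
proof -
  have "continuous_on UNIV (grad f)" using isCont_grad by (simp add: continuous_on_eq_continuous_at)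
  from subdiff_add_smooth[OF gderiv_f this] show ?thesis
    unfolding phi gph_def unlift_def by (auto simp: split_beta)
qed

lemma gph_g_iff: "z \<in> gph (subdiff g) \<longleftrightarrow> lift z \<in> gph (subdiff \<phi>)"
  by (simp add: gph_phi_iff)

lemma tendsto_lift: "(Z \<longlongrightarrow> z) F \<Longrightarrow> ((\<lambda>k. lift (Z k)) \<longlongrightarrow> lift z) F"
  unfolding lift_def by (intro tendsto_intros tendsto_grad)

lemma tendsto_unlift: "(Z \<longlongrightarrow> z) F \<Longrightarrow> ((\<lambda>k. unlift (Z k)) \<longlongrightarrow> unlift z) F"
  unfolding unlift_def by (intro tendsto_intros tendsto_grad)

lemma lift_has_derivative: "(lift has_derivative shear (hessian f (fst z))) (at z)"
proof -
  have "((\<lambda>z. grad f (fst z)) has_derivative (\<lambda>h. hessian f (fst z) *v fst h)) (at z)"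
    by (rule has_derivative_compose[OF has_derivative_fst[OF has_derivative_ident] grad_has_derivative])
  then show ?thesis unfolding lift_def shear_def
    by (intro has_derivative_Pair has_derivative_add has_derivative_fst has_derivative_snd has_derivative_ident)
qed

lemma unlift_has_derivative: "(unlift has_derivative shear (- hessian f (fst z))) (at z)"
proof -
  have "((\<lambda>z. grad f (fst z)) has_derivative (\<lambda>h. hessian f (fst z) *v fst h)) (at z)"
    by (rule has_derivative_compose[OF has_derivative_fst[OF has_derivative_ident] grad_has_derivative])
  then have "((\<lambda>z. (fst z, snd z - grad f (fst z))) has_derivative (\<lambda>h. (fst h, snd h - hessian f (fst z) *v fst h))) (at z)"
    by (intro has_derivative_Pair has_derivative_diff has_derivative_fst has_derivative_snd has_derivative_ident)
  moreover have "(- hessian f (fst z)) *v x = - (hessian f (fst z) *v x)" for x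
    by (simp add: vec_eq_iff matrix_vector_mult_def sum_negf)
  ultimately show ?thesis unfolding unlift_def shear_def by simp
qed

text \<open>One inclusion comes from the derivative of \<open>lift\<close>, the other one from that of its inverse.\<close>

lemma tangent_cone_lift:
  "tangent_cone (gph (subdiff \<phi>)) (lift z) = shear (hessian f (fst z)) ` tangent_cone (gph (subdiff g)) z"
proof
  show "shear (hessian f (fst z)) ` tangent_cone (gph (subdiff g)) z \<subseteq> tangent_cone (gph (subdiff \<phi>)) (lift z)"
    using tangent_cone_image[OF lift_has_derivative] gph_g_iff by blast
  show "tangent_cone (gph (subdiff \<phi>)) (lift z) \<subseteq> shear (hessian f (fst z)) ` tangent_cone (gph (subdiff g)) z"
  proof
    fix u assume "u \<in> tangent_cone (gph (subdiff \<phi>)) (lift z)"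
    then have "shear (- hessian f (fst (lift z))) u \<in> tangent_cone (gph (subdiff g)) (unlift (lift z))"
      using gph_phi_iff by (intro tangent_cone_image[OF unlift_has_derivative]) blast+
    then show "u \<in> shear (hessian f (fst z)) ` tangent_cone (gph (subdiff g)) z"
      by (metis image_eqI lift_unlift(2,3) shear_inverse(2))
  qed
qed

lemma SC_points_lift:
  assumes "z \<in> SC_points (subdiff g)"
  shows "lift z \<in> SC_points (subdiff \<phi>)"
  using assms by (auto simp: SC_points_def tangent_cone_lift gph_g_iff shear_image_Zn)

text \<open>The shears at the approximating points converge because the Hessian is continuous.\<close>

lemma SC_deriv_lift:
  assumes "L \<in> SC_deriv (subdiff g) z"
  shows "shear (hessian f (fst z)) ` L \<in> SC_deriv (subdiff \<phi>) (lift z)"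
proof -
  obtain Z where L: "L \<in> Zn" and Z: "\<And>k. Z k \<in> SC_points (subdiff g)" "Z \<longlonglongrightarrow> z"
      "(\<lambda>k. subspace_dist L (tangent_cone (gph (subdiff g)) (Z k))) \<longlonglongrightarrow> 0"
    using assms unfolding SC_deriv_def by blast
  let ?T = "\<lambda>k. tangent_cone (gph (subdiff g)) (Z k)"
  have T: "?T k \<in> Zn" for k using Z(1) by (simp add: SC_points_def)
  have sT: "subspace (?T k)" and sL: "subspace L" for k using T[of k] L by (auto simp: Zn_def)
  have "(\<lambda>k. subspace_dist (shear (hessian f (fst z)) ` L) (tangent_cone (gph (subdiff \<phi>)) (lift (Z k)))) \<longlonglongrightarrow> 0"
    unfolding tangent_cone_lift
  proof (subst subspace_dist_tendsto_iff)
    show "shear (hessian f (fst z)) ` L \<in> Zn" "\<And>k. shear (hessian f (fst (Z k))) ` ?T k \<in> Zn"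
      by (intro shear_image_Zn L T)+
    show "\<forall>l\<in>shear (hessian f (fst z)) ` L. (\<lambda>k. infdist l (shear (hessian f (fst (Z k))) ` ?T k)) \<longlonglongrightarrow> 0"
    proof
      fix l' assume "l' \<in> shear (hessian f (fst z)) ` L"
      then obtain l where l: "l \<in> L" "l' = shear (hessian f (fst z)) l" by blast
      define p where "p = (\<lambda>k. orth_proj (?T k) l)"
      have "p \<longlonglongrightarrow> l"
        using subspace_dist_tendsto_imp_orth_proj[OF Z(3) sL sT, of l] orth_proj_id[OF sL l(1)] by (simp add: p_def)
      then have "(\<lambda>k. shear (hessian f (fst (Z k))) (p k)) \<longlonglongrightarrow> l'"
        unfolding l(2) shear_def by (intro tendsto_intros tendsto_matrix_vector_mult tendsto_hessian Z(2))
      then have "(\<lambda>k. dist l' (shear (hessian f (fst (Z k))) (p k))) \<longlonglongrightarrow> dist l' l'"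
        by (intro tendsto_intros)
      then have "(\<lambda>k. dist l' (shear (hessian f (fst (Z k))) (p k))) \<longlonglongrightarrow> 0" by simp
      then show "(\<lambda>k. infdist l' (shear (hessian f (fst (Z k))) ` ?T k)) \<longlonglongrightarrow> 0"
      proof (rule Lim_null_comparison[rotated], intro always_eventually allI)
        fix k
        have "p k \<in> ?T k" unfolding p_def by (rule orth_proj_in[OF sT])
        then show "norm (infdist l' (shear (hessian f (fst (Z k))) ` ?T k)) \<le> dist l' (shear (hessian f (fst (Z k))) (p k))"
          by (simp add: infdist_nonneg infdist_le)
      qed
    qed
  qed
  moreover have "lift (Z k) \<in> SC_points (subdiff \<phi>)" for k by (rule SC_points_lift[OF Z(1)])
  ultimately show ?thesis
    unfolding SC_deriv_def
    by (intro CollectI conjI exI[of _ "\<lambda>k. lift (Z k)"] allI shear_image_Zn[OF L] tendsto_lift[OF Z(2)])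
qed

text \<open>Density provides a prox-regular point \<open>y\<close> of \<open>\<phi>\<close> near \<open>lift z\<close>, the SCD property of
\<open>subdiff g\<close> provides a point with n-dimensional tangent cone near \<open>unlift y\<close>, and the
prox-regularity inequality at \<open>y\<close> is still valid there.\<close>

lemma isotropic_SC_point_near:
  assumes dense: "gph (subdiff \<phi>) \<subseteq> closure (proxreg \<phi>)"
    and V: "open V" "\<And>w. w \<in> gph (subdiff g) \<inter> V \<Longrightarrow> SCD_at (subdiff g) w"
    and z: "z \<in> gph (subdiff g)" "z \<in> V" and e: "e > 0"
  obtains p where "p \<in> SC_points (subdiff g)" "dist p z < e" "isotropic (tangent_cone (gph (subdiff g)) p)"
proof -
  have "lift z \<in> closure (proxreg \<phi>)" using z(1) dense gph_g_iff by blast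
  then obtain Y where Y: "\<And>n. Y n \<in> proxreg \<phi>" "Y \<longlonglongrightarrow> lift z"
    unfolding closure_sequential by blast
  have Yz: "(\<lambda>n. unlift (Y n)) \<longlonglongrightarrow> z" using tendsto_unlift[OF Y(2)] by simp
  have "\<forall>\<^sub>F n in sequentially. unlift (Y n) \<in> V \<and> dist (unlift (Y n)) z < e / 2"
    using topological_tendstoD[OF Yz V(1) z(2)] tendstoD[OF Yz, of "e / 2"] e by (auto intro: eventually_conj)
  then obtain n where n: "unlift (Y n) \<in> V" "dist (unlift (Y n)) z < e / 2"
    by (auto simp: eventually_sequentially)
  define y where "y = Y n"
  obtain \<rho> \<delta> where \<rho>: "\<rho> \<ge> 0" and \<delta>: "\<delta> > 0" and upi: "uniform_prox_ineq \<phi> \<rho> \<delta> y"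
    using proxreg_imp_uniform_prox_ineq[OF Y(1)[of n]] unfolding y_def by metis
  have "y \<in> gph (subdiff \<phi>)" using Y(1)[of n] by (auto simp: y_def proxreg_def)
  then have "SC_deriv (subdiff g) (unlift y) \<noteq> {}"
    using V(2)[of "unlift y"] n(1) by (simp add: gph_phi_iff SCD_at_def y_def)
  then obtain Z where Z: "\<And>k. Z k \<in> SC_points (subdiff g)" "Z \<longlonglongrightarrow> unlift y"
    unfolding SC_deriv_def by blast
  have "(\<lambda>k. lift (Z k)) \<longlonglongrightarrow> y" using tendsto_lift[OF Z(2)] by simp
  then have "\<forall>\<^sub>F k in sequentially. dist (lift (Z k)) y < \<delta> / 2 \<and> dist (Z k) (unlift y) < e / 2"
    using \<delta> e Z(2) by (intro eventually_conj tendstoD) auto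
  then obtain k where k: "dist (lift (Z k)) y < \<delta> / 2" "dist (Z k) (unlift y) < e / 2"
    by (auto simp: eventually_sequentially)
  have upi': "uniform_prox_ineq \<phi> \<rho> (\<delta> / 2) (lift (Z k))"
    using k(1) by (intro uniform_prox_ineq_shift[OF upi]) simp
  have SC: "lift (Z k) \<in> SC_points (subdiff \<phi>)" by (rule SC_points_lift[OF Z(1)])
  then have "isotropic (tangent_cone (gph (subdiff \<phi>)) (lift (Z k)))"
    using \<rho> \<delta> by (intro tangent_cone_isotropic[OF phi_lsc phi_not_MInf _ upi']) (auto simp: SC_points_def Zn_def)
  then have "isotropic (tangent_cone (gph (subdiff g)) (Z k))"
    by (simp add: tangent_cone_lift isotropic_shear_iff hessian_symmetric)
  moreover have "dist (Z k) z < e"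
    using k(2) n(2) dist_triangle[of "Z k" z "unlift y"] by (simp add: y_def)
  ultimately show ?thesis using that Z(1) by blast
qed

text \<open>A cluster point of the isotropic tangent spaces found near \<open>z\<close> is isotropic and belongs to the SC
derivative at \<open>z\<close>.\<close>

lemma SC_deriv_PW_nonempty:
  assumes dense: "gph (subdiff \<phi>) \<subseteq> closure (proxreg \<phi>)"
    and V: "open V" "\<And>w. w \<in> gph (subdiff g) \<inter> V \<Longrightarrow> SCD_at (subdiff g) w"
    and z: "z \<in> gph (subdiff g)" "z \<in> V"
  shows "SC_deriv_PW (subdiff g) z \<noteq> {}"
proof -
  have "\<exists>p. p \<in> SC_points (subdiff g) \<and> dist p z < inverse (real (Suc k)) \<and>
      isotropic (tangent_cone (gph (subdiff g)) p)" for k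
    using isotropic_SC_point_near[OF dense V z, of "inverse (real (Suc k))"] by (metis inverse_positive_iff_positive of_nat_0_less_iff zero_less_Suc)
  then obtain p where p: "\<And>k. p k \<in> SC_points (subdiff g)" "\<And>k. dist (p k) z < inverse (real (Suc k))"
      "\<And>k. isotropic (tangent_cone (gph (subdiff g)) (p k))" by metis
  let ?T = "\<lambda>k. tangent_cone (gph (subdiff g)) (p k)"
  have T: "?T k \<in> Zn" for k using p(1) by (simp add: SC_points_def)
  have pz: "p \<longlonglongrightarrow> z"
    by (rule metric_tendsto_imp_tendsto[OF LIMSEQ_inverse_real_of_nat])
      (use p(2) in \<open>auto intro!: always_eventually less_imp_le\<close>)
  obtain M r where M: "M \<in> Zn" "strict_mono (r :: nat \<Rightarrow> nat)" "(\<lambda>k. subspace_dist M (?T (r k))) \<longlonglongrightarrow> 0"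
    using Zn_sequentially_compact[of ?T, OF T] by metis
  have "(\<lambda>k. p (r k)) \<longlonglongrightarrow> z" using LIMSEQ_subseq_LIMSEQ[OF pz M(2)] by (simp add: o_def)
  then have "M \<in> SC_deriv (subdiff g) z"
    by (rule SC_deriv_closed[OF M(1) SC_point_deriv[OF p(1)] _ M(3)])
  moreover have "isotropic M"
    using M(1) T by (intro isotropic_closed[OF M(3) _ _ p(3)]) (auto simp: Zn_def)
  ultimately show ?thesis
    using isotropic_imp_Zn_PW[OF M(1)] unfolding SC_deriv_PW_def by blast
qed

text \<open>If no constant worked, there would be subspaces in the SC derivative at points tending to \<open>zb\<close>
with elements whose first component has norm one and whose sheared second component tends to zero. A
cluster point of the subspaces contains the limit of these elements.\<close>

lemma uniform_regularity:
  assumes reg: "SC_deriv (subdiff \<phi>) (lift zb) \<subseteq> Zn_reg"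
  obtains \<kappa> \<delta> where "\<kappa> > 0" "\<delta> > 0" "\<And>z L l. \<lbrakk>dist z zb < \<delta>; L \<in> SC_deriv (subdiff g) z; l \<in> L\<rbrakk> \<Longrightarrow>
      norm (fst l) \<le> \<kappa> * norm (snd (shear (hessian f (fst z)) l))"
proof (rule ccontr)
  assume neg: "\<not> thesis"
  have "\<exists>z L l. dist z zb < inverse (real (Suc k)) \<and> L \<in> SC_deriv (subdiff g) z \<and> l \<in> L \<and>
      real (Suc k) * norm (snd (shear (hessian f (fst z)) l)) < norm (fst l)" for k
  proof (rule ccontr)
    assume none: "\<not> ?thesis"
    have "thesis"
    proof (rule that)
      show "real (Suc k) > 0" "inverse (real (Suc k)) > 0" by simp_all
      show "norm (fst l) \<le> real (Suc k) * norm (snd (shear (hessian f (fst z)) l))"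
        if "dist z zb < inverse (real (Suc k))" "L \<in> SC_deriv (subdiff g) z" "l \<in> L" for z L l
        using none that not_less by blast
    qed
    then show False using neg by blast
  qed
  then obtain z L l where z: "\<And>k. dist (z k) zb < inverse (real (Suc k))"
      and L: "\<And>k. L k \<in> SC_deriv (subdiff g) (z k)" and l: "\<And>k. l k \<in> L k"
      and lt: "\<And>k. real (Suc k) * norm (snd (shear (hessian f (fst (z k))) (l k))) < norm (fst (l k))"
    by metis
  have LZ: "L k \<in> Zn" for k using L[of k] by (simp add: SC_deriv_def)
  have sL: "subspace (L k)" for k using LZ[of k] by (simp add: Zn_def)
  define m where "m = (\<lambda>k. l k /\<^sub>R norm (fst (l k)))"
  have m: "m k \<in> L k" for k unfolding m_def by (intro subspace_scale sL l)
  have pos: "norm (fst (l k)) > 0" for k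
    using lt[of k] by (meson le_less_trans mult_nonneg_nonneg norm_ge_zero of_nat_0_le_iff)
  have m1: "norm (fst (m k)) = 1" for k using pos[of k] by (simp add: m_def)
  define r where "r = (\<lambda>k. snd (shear (hessian f (fst (z k))) (m k)))"
  have r: "norm (r k) \<le> inverse (real (Suc k))" for k
  proof -
    have "r k = snd (shear (hessian f (fst (z k))) (l k)) /\<^sub>R norm (fst (l k))"
      unfolding r_def m_def by (simp only: linear_scale[OF linear_shear] snd_scaleR)
    then have "norm (r k) = norm (snd (shear (hessian f (fst (z k))) (l k))) / norm (fst (l k))"
      by (simp add: divide_inverse mult.commute)
    moreover have "N / F \<le> inverse a" if "a * N < F" "a > 0" "F > 0" for N F a :: real
      using that by (simp add: field_simps)
    ultimately show ?thesis using lt[of k] pos[of k] by simp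
  qed
  have zlim: "z \<longlonglongrightarrow> zb"
    by (rule metric_tendsto_imp_tendsto[OF LIMSEQ_inverse_real_of_nat])
      (use z in \<open>auto intro!: always_eventually less_imp_le\<close>)
  have rlim: "r \<longlonglongrightarrow> 0"
    by (rule Lim_null_comparison[OF _ LIMSEQ_inverse_real_of_nat]) (use r in auto)
  obtain M s where M: "M \<in> Zn" "strict_mono (s :: nat \<Rightarrow> nat)" "(\<lambda>k. subspace_dist M (L (s k))) \<longlonglongrightarrow> 0"
    using Zn_sequentially_compact[of L, OF LZ] by metis
  have "bounded (range (\<lambda>k. fst (m (s k))))" using m1 by (auto simp: bounded_iff)
  then obtain u t where t: "strict_mono (t :: nat \<Rightarrow> nat)" "((\<lambda>k. fst (m (s k))) \<circ> t) \<longlonglongrightarrow> u"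
    using bounded_imp_convergent_subsequence by blast
  have st: "strict_mono (\<lambda>k. s (t k))" using strict_mono_o[OF M(2) t(1)] by (simp add: o_def)
  have ulim: "(\<lambda>k. fst (m (s (t k)))) \<longlonglongrightarrow> u" using t(2) by (simp add: o_def)
  have zlim': "(\<lambda>k. z (s (t k))) \<longlonglongrightarrow> zb" using LIMSEQ_subseq_LIMSEQ[OF zlim st] by (simp add: o_def)
  have rlim': "(\<lambda>k. r (s (t k))) \<longlonglongrightarrow> 0" using LIMSEQ_subseq_LIMSEQ[OF rlim st] by (simp add: o_def)
  have Mlim: "(\<lambda>k. subspace_dist M (L (s (t k)))) \<longlonglongrightarrow> 0" using LIMSEQ_subseq_LIMSEQ[OF M(3) t(1)] by (simp add: o_def)
  have snd_m: "snd (m k) = r k - hessian f (fst (z k)) *v fst (m k)" for k by (simp add: r_def shear_def)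
  have "(\<lambda>k. (fst (m (s (t k))), snd (m (s (t k))))) \<longlonglongrightarrow> (u, 0 - hessian f (fst zb) *v u)"
    unfolding snd_m by (intro tendsto_intros ulim rlim' tendsto_matrix_vector_mult tendsto_hessian zlim')
  then have "(\<lambda>k. m (s (t k))) \<longlonglongrightarrow> (u, - (hessian f (fst zb) *v u))" by simp
  then have uM: "(u, - (hessian f (fst zb) *v u)) \<in> M"
    using M(1) sL m by (intro subspace_dist_tendsto_imp_limit_in[OF Mlim]) (auto simp: Zn_def)
  have "M \<in> SC_deriv (subdiff g) zb" by (rule SC_deriv_closed[OF M(1) L zlim' Mlim])
  then have "shear (hessian f (fst zb)) ` M \<in> Zn_reg" using SC_deriv_lift reg by blast
  moreover have "(u, 0) \<in> shear (hessian f (fst zb)) ` M"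
    by (rule image_eqI[OF _ uM]) (simp add: shear_def)
  ultimately have "u = 0" unfolding Zn_reg_def by blast
  moreover have "norm u = 1"
    using tendsto_norm[OF ulim] m1 by (simp add: LIMSEQ_const_iff)
  ultimately show False by simp
qed

text \<open>Subspaces in the SC derivative near the solution inherit regularity from the uniform bound, which
makes the direction exist for every admissible pair of matrices.\<close>

lemma newton_step_well_defined:
  assumes dense: "gph (subdiff \<phi>) \<subseteq> closure (proxreg \<phi>)"
    and scd: "SCD_around (subdiff g) (unlift (xb, 0))"
    and reg: "SC_deriv (subdiff \<phi>) (xb, 0) \<subseteq> Zn_reg"
  obtains \<delta> where "\<delta> > 0"
    "\<And>xh yh. \<lbrakk>(xh, yh) \<in> gph (subdiff \<phi>); norm (xh - xb, yh) < \<delta>\<rbrakk> \<Longrightarrow>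
      (\<exists>P W. matrix_choice f g xh yh P W) \<and>
      (\<forall>P W. matrix_choice f g xh yh P W \<longrightarrow> (\<exists>s. direction_choice f xh yh P W s))"
proof -
  let ?zb = "unlift (xb, 0)"
  obtain V where V: "open V" "?zb \<in> V" "\<And>w. w \<in> gph (subdiff g) \<inter> V \<Longrightarrow> SCD_at (subdiff g) w"
    using scd unfolding SCD_around_def by blast
  have "SC_deriv (subdiff \<phi>) (lift ?zb) \<subseteq> Zn_reg" using reg by simp
  then obtain \<kappa> \<delta>1 where \<kappa>: "\<kappa> > 0" "\<delta>1 > 0" "\<And>z L l. \<lbrakk>dist z ?zb < \<delta>1; L \<in> SC_deriv (subdiff g) z; l \<in> L\<rbrakk> \<Longrightarrow>
      norm (fst l) \<le> \<kappa> * norm (snd (shear (hessian f (fst z)) l))"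
    using uniform_regularity by blast
  have "isCont unlift (xb, 0)"
    by (rule has_derivative_continuous[OF unlift_has_derivative])
  moreover have "open (V \<inter> ball ?zb \<delta>1)" "?zb \<in> V \<inter> ball ?zb \<delta>1" using V \<kappa>(2) by auto
  ultimately have "\<forall>\<^sub>F w in nhds (xb, 0). unlift w \<in> V \<inter> ball ?zb \<delta>1"
    unfolding isCont_def tendsto_def using eventually_at_filter by (fastforce simp: eventually_nhds_conv_at)
  then obtain \<delta> where \<delta>: "\<delta> > 0" "\<And>w. dist w (xb, 0) < \<delta> \<Longrightarrow> unlift w \<in> V \<inter> ball ?zb \<delta>1"
    unfolding eventually_nhds_metric by blast
  show ?thesis
  proof (rule that[OF \<delta>(1)])
    fix xh yh assume xy: "(xh, yh) \<in> gph (subdiff \<phi>)" "norm (xh - xb, yh) < \<delta>"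
    let ?z = "unlift (xh, yh)"
    have zV: "?z \<in> V" "dist ?z ?zb < \<delta>1" using \<delta>(2)[of "(xh, yh)"] xy(2) by (auto simp: dist_norm norm_minus_commute)
    have "?z \<in> gph (subdiff g)" using xy(1) gph_phi_iff by blast
    then have ne: "SC_deriv_PW (subdiff g) ?z \<noteq> {}"
      by (intro SC_deriv_PW_nonempty[OF dense V(1)] V(3) zV(1))
    have z_eq: "(xh, yh - grad f xh) = ?z" by (simp add: unlift_def)
    have "\<exists>P W. matrix_choice f g xh yh P W"
      using ne unfolding matrix_choice_def z_eq SC_deriv_PW_def Zn_PW_def by blast
    moreover have "\<exists>s. direction_choice f xh yh P W s" if mc: "matrix_choice f g xh yh P W" for P W
    proof -
      have PW: "PW_pair P W" and L: "rge P W \<in> SC_deriv (subdiff g) ?z"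
        using mc by (auto simp: matrix_choice_def SC_deriv_PW_def z_eq)
      let ?M = "shear (hessian f xh) ` rge P W"
      have "?M \<in> Zn" using L by (intro shear_image_Zn) (simp add: SC_deriv_def)
      moreover have "u = 0" if uM: "(u, 0) \<in> ?M" for u
      proof -
        obtain l where l: "(u, 0) = shear (hessian f xh) l" "l \<in> rge P W" using uM by (rule imageE)
        then have "fst l = u" "snd (shear (hessian f xh) l) = 0" by (auto simp: shear_def prod_eq_iff)
        then show ?thesis using \<kappa>(3)[OF zV(2) L l(2)] by simp
      qed
      ultimately have "?M \<in> Zn_reg" unfolding Zn_reg_def by blast
      then show ?thesis
        unfolding direction_choice_iff[OF PW hessian_symmetric] by (rule regular_subspace_solvable)
    qed
    ultimately show "(\<exists>P W. matrix_choice f g xh yh P W) \<and>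
      (\<forall>P W. matrix_choice f g xh yh P W \<longrightarrow> (\<exists>s. direction_choice f xh yh P W s))" by blast
  qed
qed

text \<open>With \<open>d = xh - xb\<close>, let \<open>(u, w)\<close> be the projection of \<open>(d, yh - G)\<close> onto \<open>rge P W\<close>, where
\<open>G\<close> is the increment of the gradient. The sheared subspace contains \<open>(s, - yh)\<close> and the shear of
\<open>(u, w)\<close>, hence also their sum, whose first component \<open>s + u\<close> is the new error up to \<open>d - u\<close>.
Its second component is \<open>(H d - G) - (yh - G - w) - H (d - u)\<close>, in which
each term is small compared with \<open>m = norm (xh - xb, yh)\<close>.\<close>

lemma newton_step_estimate:
  assumes semi: "SCD_semismooth (subdiff g) (unlift (xb, 0))"
    and reg: "SC_deriv (subdiff \<phi>) (xb, 0) \<subseteq> Zn_reg" and c: "c > 0"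
  obtains \<delta> where "\<delta> > 0"
    "\<And>xh yh P W s. \<lbrakk>(xh, yh) \<in> gph (subdiff \<phi>); norm (xh - xb, yh) < \<delta>;
        matrix_choice f g xh yh P W; direction_choice f xh yh P W s\<rbrakk>
      \<Longrightarrow> norm (xh + s - xb) \<le> c * norm (xh - xb, yh)"
proof -
  let ?zb = "unlift (xb, 0)"
  let ?H = "hessian f"
  obtain B where B: "B > 0" "\<And>(A :: real^'n^'n) x. norm (A *v x) \<le> norm A * norm x * B"
    using matrix_vector_norm_bound by blast
  have "SC_deriv (subdiff \<phi>) (lift ?zb) \<subseteq> Zn_reg" using reg by simp
  then obtain \<kappa> \<delta>1 where \<kappa>: "\<kappa> > 0" "\<delta>1 > 0" "\<And>z L l. \<lbrakk>dist z ?zb < \<delta>1; L \<in> SC_deriv (subdiff g) z; l \<in> L\<rbrakk> \<Longrightarrow>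
      norm (fst l) \<le> \<kappa> * norm (snd (shear (hessian f (fst z)) l))"
    using uniform_regularity by blast
  define K where "K = (norm (?H xb) + 1) * B"
  have K: "K \<ge> 0" using B(1) by (simp add: K_def)
  define K1 where "K1 = 2 + K"
  \<comment> \<open>The total error is at most \<open>\<epsilon> C m\<close>; \<open>K\<close> bounds the Hessian near \<open>xb\<close>, and \<open>K1\<close> the distortion of distances by \<open>unlift\<close>.\<close>
  define C where "C = K1 + \<kappa> * (K1 + 2 + K * K1)"
  have C: "C > 0" unfolding C_def K1_def using K \<kappa>(1) by (simp add: add_pos_nonneg)
  define \<epsilon> where "\<epsilon> = min 1 (c / C)"
  have \<epsilon>: "\<epsilon> > 0" "\<epsilon> \<le> 1" "\<epsilon> * C \<le> c" using c C by (auto simp: \<epsilon>_def min_def field_simps)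
  obtain \<delta>2 where \<delta>2: "\<delta>2 > 0" "\<And>z L. \<lbrakk>z \<in> gph (subdiff g); z \<in> cball ?zb \<delta>2; L \<in> SC_deriv (subdiff g) z\<rbrakk>
      \<Longrightarrow> infdist (z - ?zb) L \<le> \<epsilon> * norm (z - ?zb)"
    using semi \<epsilon>(1) unfolding SCD_semismooth_def by blast
  obtain \<delta>3 where \<delta>3: "\<delta>3 > 0" "\<And>x. norm (x - xb) < \<delta>3 \<Longrightarrow>
      norm (grad f x - grad f xb - ?H xb *v (x - xb)) \<le> \<epsilon> * norm (x - xb)"
    using grad_has_derivative[of xb] \<epsilon>(1) unfolding has_derivative_at_alt by metis
  have "min 1 (\<epsilon> / B) > 0" using \<epsilon>(1) B(1) by simp
  then obtain \<delta>4 where \<delta>4: "\<delta>4 > 0" "\<And>x. norm (x - xb) < \<delta>4 \<Longrightarrow> norm (?H x - ?H xb) < min 1 (\<epsilon> / B)"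
    using isCont_hessian[of xb] unfolding continuous_at_eps_delta dist_norm by blast
  define \<delta> where "\<delta> = min (min \<delta>1 \<delta>2 / (1 + K1)) (min \<delta>3 \<delta>4)"
  have "\<delta> > 0" using \<kappa>(2) \<delta>2(1) \<delta>3(1) \<delta>4(1) K by (simp add: \<delta>_def K1_def)
  moreover have "norm (xh + s - xb) \<le> c * norm (xh - xb, yh)"
    if xy: "(xh, yh) \<in> gph (subdiff \<phi>)" "norm (xh - xb, yh) < \<delta>"
      and mc: "matrix_choice f g xh yh P W" and dc: "direction_choice f xh yh P W s" for xh yh P W s
  proof -
    define m where "m = norm (xh - xb, yh)"
    define d where "d = xh - xb"
    have dm: "norm d \<le> m" "norm yh \<le> m"
      unfolding m_def d_def by (rule norm_fst_le norm_snd_le)+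
    have m0: "m \<ge> 0" by (simp add: m_def)
    have md: "m < \<delta>3" "m < \<delta>4" "(1 + K1) * m < \<delta>1" "(1 + K1) * m < \<delta>2"
      using xy(2) K by (auto simp: \<delta>_def m_def[symmetric] K1_def pos_less_divide_eq mult.commute)
    define G where "G = grad f xh - grad f xb"
    have G1: "norm (G - ?H xb *v d) \<le> \<epsilon> * m"
    proof -
      have "norm (xh - xb) < \<delta>3" using dm(1) md(1) by (simp add: d_def)
      from \<delta>3(2)[OF this] have "norm (G - ?H xb *v d) \<le> \<epsilon> * norm d" by (simp add: G_def d_def)
      also have "\<dots> \<le> \<epsilon> * m" using \<epsilon>(1) dm(1) by (intro mult_left_mono) auto
      finally show ?thesis .
    qed
    have Hd: "norm (?H xh - ?H xb) < min 1 (\<epsilon> / B)" using \<delta>4(2)[of xh] dm md by (simp add: d_def)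
    have Hnorm: "norm (?H xh *v v) \<le> K * norm v" for v
    proof -
      have "norm (?H xh) \<le> norm (?H xb) + 1"
        using norm_triangle_ineq2[of "?H xh" "?H xb"] Hd by simp
      then have "norm (?H xh) * norm v * B \<le> (norm (?H xb) + 1) * norm v * B"
        using B(1) by (intro mult_right_mono) auto
      then show ?thesis using B(2)[of "?H xh" v] by (simp add: K_def mult_ac)
    qed
    have Hbnorm: "norm (?H xb *v v) \<le> K * norm v" for v
    proof -
      have "norm (?H xb) * norm v * B \<le> (norm (?H xb) + 1) * norm v * B"
        using B(1) by (intro mult_right_mono) auto
      then show ?thesis using B(2)[of "?H xb" v] by (simp add: K_def mult_ac)
    qed
    have G2: "norm (?H xh *v d - G) \<le> 2 * \<epsilon> * m"
    proof -
      have "norm ((?H xh - ?H xb) *v d) \<le> norm (?H xh - ?H xb) * norm d * B" by (rule B(2))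
      also have "\<dots> \<le> (\<epsilon> / B) * m * B"
        using Hd dm B(1) \<epsilon>(1) by (intro mult_right_mono mult_mono) auto
      finally have "norm ((?H xh - ?H xb) *v d) \<le> \<epsilon> * m" using B(1) by simp
      moreover have eq: "?H xh *v d - G = (?H xh - ?H xb) *v d - (G - ?H xb *v d)"
        by (simp add: matrix_vector_mult_diff_rdistrib)
      ultimately show ?thesis
        unfolding eq using G1 norm_triangle_ineq4[of "(?H xh - ?H xb) *v d" "G - ?H xb *v d"] by linarith
    qed
    have Gn: "norm G \<le> (1 + K) * m"
    proof -
      have "norm G \<le> norm (G - ?H xb *v d) + norm (?H xb *v d)"
        using norm_triangle_ineq[of "G - ?H xb *v d" "?H xb *v d"] by simp
      also have "\<dots> \<le> 1 * m + K * m"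
        using G1 Hbnorm[of d] mult_right_mono[OF \<epsilon>(2) m0] mult_left_mono[OF dm(1) K] by linarith
      finally show ?thesis by (simp add: algebra_simps)
    qed
    let ?z = "unlift (xh, yh)"
    have zd: "?z - ?zb = (d, yh - G)" by (simp add: unlift_def d_def G_def)
    have zn: "norm (?z - ?zb) \<le> K1 * m"
    proof -
      have "(d, yh - G) = (d, yh) - (0, G)" by simp
      then have "norm (?z - ?zb) \<le> norm (d, yh) + norm (0 :: real^'n, G)"
        unfolding zd by (simp only: norm_triangle_ineq4)
      also have "\<dots> \<le> m + (1 + K) * m" using Gn by (simp add: m_def d_def norm_Pair)
      finally show ?thesis by (simp add: K1_def algebra_simps)
    qed
    have "K1 * m \<le> (1 + K1) * m" using m0 by (intro mult_right_mono) auto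
    then have zd1: "dist ?z ?zb < \<delta>1" "?z \<in> cball ?zb \<delta>2"
      using zn md by (auto simp: dist_norm norm_minus_commute)
    have z_eq: "(xh, yh - grad f xh) = ?z" by (simp add: unlift_def)
    have PW: "PW_pair P W" and L: "rge P W \<in> SC_deriv (subdiff g) ?z"
      using mc by (auto simp: matrix_choice_def SC_deriv_PW_def z_eq)
    have sL: "subspace (rge P W)" using L by (auto simp: SC_deriv_def Zn_def)
    obtain u w where uw: "orth_proj (rge P W) (?z - ?zb) = (u, w)" by (cases "orth_proj (rge P W) (?z - ?zb)")
    have uwL: "(u, w) \<in> rge P W" using orth_proj_in[OF sL, of "?z - ?zb"] by (simp add: uw)
    have "?z \<in> gph (subdiff g)" using xy(1) gph_phi_iff by blast
    from \<delta>2(2)[OF this zd1(2) L]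
    have "norm (d - u, yh - G - w) \<le> \<epsilon> * norm (?z - ?zb)"
      by (simp add: infdist_eq_norm_orth_proj[OF sL] uw) (simp add: zd)
    also have "\<dots> \<le> \<epsilon> * (K1 * m)" using zn \<epsilon>(1) by (intro mult_left_mono) auto
    finally have close: "norm (d - u, yh - G - w) \<le> \<epsilon> * K1 * m" by (simp add: mult_ac)
    have cu: "norm (d - u) \<le> \<epsilon> * K1 * m" and cw: "norm (yh - G - w) \<le> \<epsilon> * K1 * m"
      by (rule order_trans[OF norm_fst_le close] order_trans[OF norm_snd_le close])+
    obtain l where l: "l \<in> rge P W" "shear (?H xh) l = (s, - yh)"
      using dc unfolding direction_choice_iff[OF PW hessian_symmetric] by (elim imageE) metis
    have "l + (u, w) \<in> rge P W" by (intro subspace_add sL l uwL)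
    from \<kappa>(3)[OF zd1(1) L this]
    have "norm (fst l + u) \<le> \<kappa> * norm (snd (shear (?H xh) l) + snd (shear (?H xh) (u, w)))"
      by (simp add: linear_add[OF linear_shear])
    then have su: "norm (s + u) \<le> \<kappa> * norm (- yh + (w + ?H xh *v u))"
    proof -
      have "fst l = s" using l(2) by (simp add: shear_def)
      moreover have "snd (shear (?H xh) (u, w)) = w + ?H xh *v u" by (simp add: shear_def)
      ultimately show ?thesis using \<open>norm (fst l + u) \<le> _\<close> by (simp only: l(2) snd_conv)
    qed
    have eq: "- yh + (w + ?H xh *v u) = (?H xh *v d - G) - (yh - G - w) - ?H xh *v (d - u)"
      by (simp add: matrix_vector_mult_diff_distrib)
    have "norm (- yh + (w + ?H xh *v u)) \<le> norm (?H xh *v d - G) + norm (yh - G - w) + norm (?H xh *v (d - u))"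
      unfolding eq using norm_triangle_ineq4[of "(?H xh *v d - G) - (yh - G - w)" "?H xh *v (d - u)"]
        norm_triangle_ineq4[of "?H xh *v d - G" "yh - G - w"] by linarith
    also have "\<dots> \<le> 2 * \<epsilon> * m + \<epsilon> * K1 * m + K * (\<epsilon> * K1 * m)"
      using G2 cw Hnorm[of "d - u"] mult_left_mono[OF cu K] by linarith
    finally have "norm (s + u) \<le> \<kappa> * (2 * \<epsilon> * m + \<epsilon> * K1 * m + K * (\<epsilon> * K1 * m))"
      using su \<kappa>(1) by (meson mult_left_mono less_imp_le order_trans)
    moreover have "norm (xh + s - xb) \<le> norm (d - u) + norm (s + u)"
      using norm_triangle_ineq[of "d - u" "s + u"] by (simp add: d_def algebra_simps)
    ultimately have "norm (xh + s - xb) \<le> \<epsilon> * K1 * m + \<kappa> * (2 * \<epsilon> * m + \<epsilon> * K1 * m + K * (\<epsilon> * K1 * m))"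
      using cu by linarith
    also have "\<dots> = (\<epsilon> * C) * m" by (simp add: C_def algebra_simps)
    also have "\<dots> \<le> c * m" using \<epsilon>(3) m0 by (rule mult_right_mono)
    finally show ?thesis by (simp add: m_def)
  qed
  ultimately show ?thesis using that by blast
qed

end

section \<open>Superlinear convergence\<close>

theorem theorem4p3:
  fixes f :: "real^'n \<Rightarrow> real"
    and g \<phi> :: "real^'n \<Rightarrow> ereal"
    and xb :: "real^'n"
  assumes phi: "\<phi> = (\<lambda>x. ereal (f x) + g x)"
    and f: "twice_continuously_differentiable f"
    and g: "proper g" "lsc g" "prox_bounded g"
    and dense: "gph (subdiff \<phi>) \<subseteq> closure (proxreg \<phi>)"
    and stationary: "0 \<in> subdiff \<phi> xb"
    and semismooth: "SCD_semismooth (subdiff g) (xb, - grad f xb)"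
    and regularity: "SC_deriv (subdiff \<phi>) (xb, 0) \<subseteq> Zn_reg"
  shows "\<forall>\<eta>>0. \<exists>U. open U \<and> xb \<in> U \<and>
           (\<forall>x0\<in>U. newton_well_defined f g xb \<eta> x0 \<and>
              (\<forall>X. newton_iterates f g xb \<eta> x0 X \<longrightarrow> superlinearly_converges X xb))"
proof (intro allI impI)
  fix \<eta> :: real assume \<eta>: "\<eta> > 0"
  interpret composite f g \<phi> using phi f g(1,2) by unfold_locales
  have zb: "unlift (xb, 0) = (xb, - grad f xb)" by (simp add: unlift_def)
  have semi: "SCD_semismooth (subdiff g) (unlift (xb, 0))" using semismooth by (simp add: zb)
  then have scd: "SCD_around (subdiff g) (unlift (xb, 0))" by (simp add: SCD_semismooth_def)
  obtain \<delta>w where \<delta>w: "\<delta>w > 0"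
    "\<And>xh yh. \<lbrakk>(xh, yh) \<in> gph (subdiff \<phi>); norm (xh - xb, yh) < \<delta>w\<rbrakk> \<Longrightarrow>
      (\<exists>P W. matrix_choice f g xh yh P W) \<and>
      (\<forall>P W. matrix_choice f g xh yh P W \<longrightarrow> (\<exists>s. direction_choice f xh yh P W s))"
    by (rule newton_step_well_defined[OF dense scd regularity]) blast
  have contraction: "\<exists>r>0. \<forall>x x'. norm (x - xb) < r \<longrightarrow> newton_step f g xb \<eta> x x' \<longrightarrow> norm (x' - xb) \<le> c * norm (x - xb)"
    if c: "c > 0" for c
  proof -
    have c\<eta>: "c / \<eta> > 0" using c \<eta> by simp
    obtain \<delta> where \<delta>: "\<delta> > 0" "\<And>xh yh P W s. \<lbrakk>(xh, yh) \<in> gph (subdiff \<phi>); norm (xh - xb, yh) < \<delta>;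
        matrix_choice f g xh yh P W; direction_choice f xh yh P W s\<rbrakk>
      \<Longrightarrow> norm (xh + s - xb) \<le> c / \<eta> * norm (xh - xb, yh)"
      by (rule newton_step_estimate[OF semi regularity c\<eta>]) blast
    show ?thesis
    proof (intro exI[of _ "\<delta> / \<eta>"] conjI allI impI)
      show "\<delta> / \<eta> > 0" using \<delta>(1) \<eta> by simp
      fix x x' assume x: "norm (x - xb) < \<delta> / \<eta>" and step: "newton_step f g xb \<eta> x x'"
      obtain xh yh P W s where ac: "approx_choice f g xb \<eta> x xh yh" and mc: "matrix_choice f g xh yh P W"
          and dc: "direction_choice f xh yh P W s" and x': "x' = xh + s"
        using step unfolding newton_step_def by blast
      have gp: "(xh, yh) \<in> gph (subdiff \<phi>)" and le: "norm (xh - xb, yh) \<le> \<eta> * norm (x - xb)"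
        using ac by (simp_all add: approx_choice_def phi)
      have "\<eta> * norm (x - xb) < \<delta>" using x \<eta> by (simp add: pos_less_divide_eq mult.commute)
      then have "norm (x' - xb) \<le> c / \<eta> * norm (xh - xb, yh)"
        unfolding x' using le by (intro \<delta>(2)[OF gp _ mc dc]) simp
      also have "\<dots> \<le> c / \<eta> * (\<eta> * norm (x - xb))" using le c\<eta> by (intro mult_left_mono) auto
      finally show "norm (x' - xb) \<le> c * norm (x - xb)" using \<eta> by simp
    qed
  qed
  obtain r0 where r0: "r0 > 0" "\<And>x x'. norm (x - xb) < r0 \<Longrightarrow> newton_step f g xb \<eta> x x' \<Longrightarrow> norm (x' - xb) \<le> 1/2 * norm (x - xb)"
    using contraction[of "1/2"] by auto
  define r where "r = min r0 (\<delta>w / \<eta>)"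
  have r: "r > 0" using r0(1) \<delta>w(1) \<eta> by (simp add: r_def)
  have half: "norm (x' - xb) \<le> 1/2 * norm (x - xb)" if "norm (x - xb) < r" "newton_step f g xb \<eta> x x'" for x x'
    using r0(2)[of x x'] that by (simp add: r_def)
  show "\<exists>U. open U \<and> xb \<in> U \<and> (\<forall>x0\<in>U. newton_well_defined f g xb \<eta> x0 \<and>
              (\<forall>X. newton_iterates f g xb \<eta> x0 X \<longrightarrow> superlinearly_converges X xb))"
  proof (intro exI[of _ "ball xb r"] conjI ballI allI impI)
    show "open (ball xb r)" "xb \<in> ball xb r" using r by simp_all
    fix x0 assume "x0 \<in> ball xb r"
    then have x0: "norm (x0 - xb) < r" by (simp add: dist_norm norm_minus_commute)
    show "newton_well_defined f g xb \<eta> x0"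
      unfolding newton_well_defined_def
    proof (intro allI impI)
      fix x assume "(newton_step f g xb \<eta>)\<^sup>*\<^sup>* x0 x"
      then have x: "norm (x - xb) < r"
      proof (induction rule: rtranclp_induct)
        case (step y z)
        then show ?case using half[of y z] norm_ge_zero[of "y - xb"] by linarith
      qed (rule x0)
      have "approx_choice f g xb \<eta> x xb 0"
        using stationary \<eta> by (simp add: approx_choice_def gph_def phi[symmetric] zero_prod_def[symmetric])
      moreover have "(\<exists>P W. matrix_choice f g xh yh P W) \<and>
           (\<forall>P W. matrix_choice f g xh yh P W \<longrightarrow> (\<exists>s. direction_choice f xh yh P W s))"
        if ac: "approx_choice f g xb \<eta> x xh yh" for xh yh
      proof (rule \<delta>w(2))
        show "(xh, yh) \<in> gph (subdiff \<phi>)" using ac by (simp add: approx_choice_def phi)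
        have "norm (xh - xb, yh) \<le> \<eta> * norm (x - xb)" using ac by (simp add: approx_choice_def)
        also have "\<dots> < \<delta>w" using x \<eta> by (simp add: r_def pos_less_divide_eq mult.commute)
        finally show "norm (xh - xb, yh) < \<delta>w" .
      qed
      ultimately show "(\<exists>xh yh. approx_choice f g xb \<eta> x xh yh) \<and>
        (\<forall>xh yh. approx_choice f g xb \<eta> x xh yh \<longrightarrow> (\<exists>P W. matrix_choice f g xh yh P W) \<and>
           (\<forall>P W. matrix_choice f g xh yh P W \<longrightarrow> (\<exists>s. direction_choice f xh yh P W s)))" by blast
    qed
    fix X assume "newton_iterates f g xb \<eta> x0 X"
    then have X0: "X 0 = x0" and step: "\<And>k. newton_step f g xb \<eta> (X k) (X (Suc k))"
      by (auto simp: newton_iterates_def)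
    have Xk: "norm (X k - xb) < r \<and> norm (X k - xb) \<le> (1/2)^k * r" for k
    proof (induction k)
      case (Suc k)
      then have "norm (X (Suc k) - xb) \<le> 1/2 * norm (X k - xb)" using half step by blast
      moreover have "0 \<le> norm (X (Suc k) - xb)" "(1/2)^Suc k * r = 1/2 * ((1/2)^k * r)" by simp_all
      ultimately show ?case using Suc by linarith
    qed (use x0 X0 in simp)
    have "(\<lambda>k. (1/2)^k * r) \<longlonglongrightarrow> 0 * r" by (intro tendsto_intros LIMSEQ_power_zero) simp
    then have "(\<lambda>k. (1/2)^k * r) \<longlonglongrightarrow> 0" by simp
    then have "(\<lambda>k. X k - xb) \<longlonglongrightarrow> 0"
      by (rule Lim_null_comparison[rotated]) (use Xk in auto)
    then have Xlim: "X \<longlonglongrightarrow> xb" by (rule LIM_zero_cancel)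
    moreover have "(\<lambda>k. norm (X (Suc k) - xb)) \<in> o(\<lambda>k. norm (X k - xb))"
    proof (rule landau_o.smallI)
      fix c :: real assume "c > 0"
      then obtain r' where r': "r' > 0" "\<And>x x'. norm (x - xb) < r' \<Longrightarrow> newton_step f g xb \<eta> x x' \<Longrightarrow>
          norm (x' - xb) \<le> c * norm (x - xb)"
        using contraction by blast
      have "\<forall>\<^sub>F k in sequentially. dist (X k) xb < r'" by (rule tendstoD[OF Xlim r'(1)])
      then show "\<forall>\<^sub>F k in sequentially. norm (norm (X (Suc k) - xb)) \<le> c * norm (norm (X k - xb))"
        by eventually_elim (use r'(2) step in \<open>auto simp: dist_norm\<close>)
    qed
    ultimately show "superlinearly_converges X xb" by (simp add: superlinearly_converges_def)
  qed
qed

end
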